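(* Let $w$ be a $C^1$ 1-form field on $\mathcal{M}$. The codifferential operator $\delta_\zeta$ associated with cone kernels admits the asymptotic expansion, as $\zeta\to1$ with $\zeta\in[0,1)$, $$\delta_\zeta w=\frac{1}{1-\zeta}\,\bar\delta w+O\big((1-\zeta)^0\big),\qquad \bar\delta w=-\operatorname{div}_{\bar\nu}[\,w(v)\,v\,],$$ where $\operatorname{div}_{\bar\nu}$ is the divergence operator associated with the volume form $\bar\nu=\mu/\|v\|_g^m$.
   Context: Setting: $\mathcal{M}$ is a smooth compact $m$-dimensional manifold without boundary, carrying a nowhere-vanishing vector field $v$ of class at least $C^1$ (the dynamical vector field of a flow on $\mathcal{M}$). $F:\mathcal{M}\to\mathbb{R}^n$ is a $C^2$ embedding, $\mathbb{R}^n$ carries an inner product $(\cdot,\cdot)$, and $g(u,u')=(DF\,u,DF\,u')$ is the induced Riemannian metric on $\mathcal{M}$, with volume form $\mu$ and $\|v\|_g=\sqrt{g(v,v)}$. For $\zeta\in[0,1)$, the Riemannian metric associated with cone kernels is $$h=\frac{1}{\|v\|_g^2}\left(g-\zeta\,\frac{v^*\otimes v^*}{\|v\|_g^2}\right),\qquad v^*=g(v,\cdot),$$ with volume form $\nu=(1-\zeta)^{1/2}\bar\nu$, $\bar\nu=\mu/\|v\|_g^m$. The codifferential associated with cone kernels, $\delta_\zeta$, is the codifferential of $h$: it maps 1-forms to functions and satisfies $\int_{\mathcal{M}}h^{-1}(w,df)\,\nu=\int_{\mathcal{M}}(\delta_\zeta w)f\,\nu$ for all smooth functions $f$, where $h^{-1}$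 is the inverse metric on 1-forms. For a volume form $\sigma$, the divergence $\operatorname{div}_\sigma X$ of a vector field $X$ is defined by $L_X\sigma=(\operatorname{div}_\sigma X)\,\sigma$, where $L_X$ is the Lie derivative. *)

theory Defs
  imports "HOL-Analysis.Analysis"
begin

text \<open>
  Here \<open>S\<close> is meant to be open. By continuity of the partial derivatives this is the usual
  notion of class \<open>C\<^sup>k\<close>.
\<close>

primrec Ck_on :: "nat \<Rightarrow> ('e::euclidean_space \<Rightarrow> 'f::real_normed_vector) \<Rightarrow> 'e set \<Rightarrow> bool" where
  "Ck_on 0 f S \<longleftrightarrow> continuous_on S f"
| "Ck_on (Suc k) f S \<longleftrightarrow>
     f differentiable_on S \<and> (\<forall>b\<in>Basis. Ck_on k (\<lambda>x. frechet_derivative f (at x) b) S)"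

definition smooth_on :: "('e::euclidean_space \<Rightarrow> 'f::real_normed_vector) \<Rightarrow> 'e set \<Rightarrow> bool" where
  "smooth_on f S \<longleftrightarrow> (\<forall>k. Ck_on k f S)"


section \<open>Manifolds\<close>

text \<open>
  A manifold is a subspace \<open>M\<close> of a Hausdorff space together with a smooth atlas \<open>A\<close>. Its dimension
  is \<open>CARD('m)\<close>. Chart images are open in \<open>real ^ 'm\<close>, so there is no boundary. The topology on \<open>M\<close>
  is the subspace topology only; no smooth structure of the surrounding type is used.
\<close>

type_synonym ('a, 'm) chart = "'a set \<times> ('a \<Rightarrow> real ^ 'm)"

abbreviation chart_dom :: "('a, 'm) chart \<Rightarrow> 'a set" where
  "chart_dom c \<equiv> fst c"

abbreviation chart_map :: "('a, 'm) chart \<Rightarrow> 'a \<Rightarrow> real ^ 'm" where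
  "chart_map c \<equiv> snd c"

abbreviation chart_image :: "('a, 'm) chart \<Rightarrow> (real ^ 'm) set" where
  "chart_image c \<equiv> chart_map c ` chart_dom c"

definition chart_inv :: "('a, 'm) chart \<Rightarrow> real ^ 'm \<Rightarrow> 'a" where
  "chart_inv c = inv_into (chart_dom c) (chart_map c)"

definition is_chart :: "'a::t2_space set \<Rightarrow> ('a, 'm::finite) chart \<Rightarrow> bool" where
  "is_chart M c \<longleftrightarrow>
     openin (top_of_set M) (chart_dom c) \<and> open (chart_image c) \<and>
     homeomorphism (chart_dom c) (chart_image c) (chart_map c) (chart_inv c)"

definition transition :: "('a, 'm) chart \<Rightarrow> ('a, 'm) chart \<Rightarrow> real ^ 'm \<Rightarrow> real ^ 'm" where
  "transition c d = chart_map d \<circ> chart_inv c"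

definition smooth_atlas :: "'a::t2_space set \<Rightarrow> ('a, 'm::finite) chart set \<Rightarrow> bool" where
  "smooth_atlas M A \<longleftrightarrow>
     (\<forall>c\<in>A. is_chart M c) \<and> M = (\<Union>c\<in>A. chart_dom c) \<and>
     (\<forall>c\<in>A. \<forall>d\<in>A. smooth_on (transition c d) (chart_map c ` (chart_dom c \<inter> chart_dom d)))"

definition Ck_map ::
  "nat \<Rightarrow> ('a, 'm::finite) chart set \<Rightarrow> ('a \<Rightarrow> 'f::real_normed_vector) \<Rightarrow> bool" where
  "Ck_map k A f \<longleftrightarrow> (\<forall>c\<in>A. Ck_on k (f \<circ> chart_inv c) (chart_image c))"

definition smooth_map :: "('a, 'm::finite) chart set \<Rightarrow> ('a \<Rightarrow> 'f::real_normed_vector) \<Rightarrow> bool" where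
  "smooth_map A f \<longleftrightarrow> (\<forall>k. Ck_map k A f)"


section \<open>Tensor fields\<close>

text \<open>
  A tensor field is given by its coordinate expression in every chart of the atlas, subject to the
  transformation law on overlaps: \<open>X c p\<close> is the coordinate vector of \<open>X\<close> at \<open>p\<close> in the chart \<open>c\<close>,
  and a covariant tensor in the chart \<open>c\<close> is a function of such coordinate vectors.
\<close>

type_synonym ('a, 'm) vec_field = "('a, 'm) chart \<Rightarrow> 'a \<Rightarrow> real ^ 'm"
type_synonym ('a, 'm) covec_field = "('a, 'm) chart \<Rightarrow> 'a \<Rightarrow> real ^ 'm \<Rightarrow> real"
type_synonym ('a, 'm) bilin_field = "('a, 'm) chart \<Rightarrow> 'a \<Rightarrow> real ^ 'm \<Rightarrow> real ^ 'm \<Rightarrow> real"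

definition vector_field :: "nat \<Rightarrow> ('a, 'm::finite) chart set \<Rightarrow> ('a, 'm) vec_field \<Rightarrow> bool" where
  "vector_field k A X \<longleftrightarrow>
     (\<forall>c\<in>A. \<forall>d\<in>A. \<forall>p\<in>chart_dom c \<inter> chart_dom d.
        X d p = frechet_derivative (transition c d) (at (chart_map c p)) (X c p)) \<and>
     (\<forall>c\<in>A. Ck_on k (X c \<circ> chart_inv c) (chart_image c))"

definition one_form :: "nat \<Rightarrow> ('a, 'm::finite) chart set \<Rightarrow> ('a, 'm) covec_field \<Rightarrow> bool" where
  "one_form k A w \<longleftrightarrow>
     (\<forall>c\<in>A. \<forall>p\<in>chart_dom c. linear (w c p)) \<and>
     (\<forall>c\<in>A. \<forall>d\<in>A. \<forall>p\<in>chart_dom c \<inter> chart_dom d. \<forall>a.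
        w c p a = w d p (frechet_derivative (transition c d) (at (chart_map c p)) a)) \<and>
     (\<forall>c\<in>A. \<forall>a. Ck_on k (\<lambda>x. w c (chart_inv c x) a) (chart_image c))"

definition differential ::
  "('a \<Rightarrow> 'f::real_normed_vector) \<Rightarrow> ('a, 'm::finite) chart \<Rightarrow> 'a \<Rightarrow> real ^ 'm \<Rightarrow> 'f" where
  "differential f c p = frechet_derivative (f \<circ> chart_inv c) (at (chart_map c p))"

definition Ck_embedding ::
  "nat \<Rightarrow> 'a::t2_space set \<Rightarrow> ('a, 'm::finite) chart set \<Rightarrow> ('a \<Rightarrow> 'f::real_normed_vector) \<Rightarrow> bool" where
  "Ck_embedding k M A F \<longleftrightarrow>
     Ck_map k A F \<and> (\<forall>c\<in>A. \<forall>p\<in>chart_dom c. inj (differential F c p)) \<and>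
     (\<exists>G. homeomorphism M (F ` M) F G)"


section \<open>Forms of top degree\<close>

text \<open>
  A form of degree \<open>CARD('m)\<close> takes its vector arguments as the rows of a matrix. The volume form
  of a metric is taken positive on the coordinate frame of each chart. If all transition maps
  preserve orientation, this is the volume form of the oriented manifold; in general it
  changes sign under orientation-reversing transitions, i.e. it represents the Riemannian density.
  Integrals and divergences do not see this sign, so no orientation of \<open>M\<close> is required.
\<close>

type_synonym ('a, 'm) top_form = "('a, 'm) chart \<Rightarrow> 'a \<Rightarrow> real ^ 'm ^ 'm \<Rightarrow> real"

definition gram :: "('a, 'm::finite) bilin_field \<Rightarrow> ('a, 'm) chart \<Rightarrow> 'a \<Rightarrow> real ^ 'm ^ 'm" where
  "gram h c p = (\<chi> i j. h c p (axis i 1) (axis j 1))"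

definition volume_form :: "('a, 'm::finite) bilin_field \<Rightarrow> ('a, 'm) top_form" where
  "volume_form h c p U = sqrt (det (gram h c p)) * det U"

text \<open>
  The integral over a compact manifold: cover \<open>M\<close> by finitely many charts, cut it into disjoint
  Borel pieces each inside one chart, and integrate the coefficient (the value on the coordinate
  frame \<open>mat 1\<close>) over the image of each piece. For the forms considered here, the change of
  variables formula makes the result independent of the chosen cover.
\<close>

definition form_integral ::
  "'a set \<Rightarrow> ('a, 'm::finite) chart set \<Rightarrow> ('a, 'm) top_form \<Rightarrow> real" where
  "form_integral M A \<omega> =
     (let cs = (SOME cs. set cs \<subseteq> A \<and> M = (\<Union>c\<in>set cs. chart_dom c))
      in \<Sum>i<length cs.
           LINT x : chart_map (cs ! i) ` (chart_dom (cs ! i) - (\<Union>j<i. chart_dom (cs ! j))) | lborel.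
             \<omega> (cs ! i) (chart_inv (cs ! i) x) (mat 1))"

text \<open>
  The Lie derivative
  \<open>(L\<^sub>X \<sigma>)(u\<^sub>1, \<dots>, u\<^sub>m) = X (\<sigma>(u\<^sub>1, \<dots>, u\<^sub>m)) - (\<Sum>k. \<sigma>(u\<^sub>1, \<dots>, [X, u\<^sub>k], \<dots>, u\<^sub>m))\<close>,
  evaluated on fields \<open>u\<^sub>k\<close> with constant coordinates in the chart, for which \<open>[X, u\<^sub>k] = - DX u\<^sub>k\<close>.
\<close>

definition lie_derivative ::
  "('a, 'm::finite) vec_field \<Rightarrow> ('a, 'm) top_form \<Rightarrow> ('a, 'm) top_form" where
  "lie_derivative X \<sigma> c p U =
     frechet_derivative (\<lambda>x. \<sigma> c (chart_inv c x) U) (at (chart_map c p)) (X c p) +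
     (\<Sum>k\<in>UNIV. \<sigma> c p (\<chi> j. if j = k
        then frechet_derivative (X c \<circ> chart_inv c) (at (chart_map c p)) (U $ k) else U $ j))"

definition divergence ::
  "('a, 'm::finite) chart set \<Rightarrow> ('a, 'm) top_form \<Rightarrow> ('a, 'm) vec_field \<Rightarrow> 'a \<Rightarrow> real" where
  "divergence A \<sigma> X p =
     (THE r. \<forall>c\<in>A. p \<in> chart_dom c \<longrightarrow> (\<forall>U. lie_derivative X \<sigma> c p U = r * \<sigma> c p U))"


section \<open>The codifferential of a metric\<close>

definition inverse_metric ::
  "('a, 'm::finite) bilin_field \<Rightarrow> ('a, 'm) chart \<Rightarrow> 'a \<Rightarrow>
     (real ^ 'm \<Rightarrow> real) \<Rightarrow> (real ^ 'm \<Rightarrow> real) \<Rightarrow> real" where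
  "inverse_metric h c p \<alpha> \<beta> =
     (\<Sum>i\<in>UNIV. \<Sum>j\<in>UNIV. \<alpha> (axis i 1) * matrix_inv (gram h c p) $ i $ j * \<beta> (axis j 1))"

definition is_codifferential ::
  "'a::t2_space set \<Rightarrow> ('a, 'm::finite) chart set \<Rightarrow> ('a, 'm) bilin_field \<Rightarrow>
     ('a, 'm) covec_field \<Rightarrow> ('a \<Rightarrow> real) \<Rightarrow> bool" where
  "is_codifferential M A h w u \<longleftrightarrow>
     continuous_on M u \<and>
     (\<forall>f :: 'a \<Rightarrow> real. smooth_map A f \<longrightarrow>
        form_integral M A (\<lambda>c p U. inverse_metric h c p (w c p) (differential f c p) * volume_form h c p U) =
        form_integral M A (\<lambda>c p U. u p * f p * volume_form h c p U))"

text \<open>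
  Among continuous functions the integral identity determines the codifferential at every point
  of \<open>M\<close>; \<open>SOME\<close> only leaves the irrelevant values outside \<open>M\<close> open.
\<close>

definition codifferential ::
  "'a::t2_space set \<Rightarrow> ('a, 'm::finite) chart set \<Rightarrow> ('a, 'm) bilin_field \<Rightarrow>
     ('a, 'm) covec_field \<Rightarrow> 'a \<Rightarrow> real" where
  "codifferential M A h w = (SOME u. is_codifferential M A h w u)"


section \<open>Cone kernels\<close>

definition is_inner_product :: "('f::real_vector \<Rightarrow> 'f \<Rightarrow> real) \<Rightarrow> bool" where
  "is_inner_product ip \<longleftrightarrow>
     bilinear ip \<and> (\<forall>x y. ip x y = ip y x) \<and> (\<forall>x. x \<noteq> 0 \<longrightarrow> ip x x > 0)"

definition induced_metric ::
  "('f \<Rightarrow> 'f \<Rightarrow> real) \<Rightarrow> ('a \<Rightarrow> 'f::real_normed_vector) \<Rightarrow> ('a, 'm::finite) bilin_field" where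
  "induced_metric ip F c p a b = ip (differential F c p a) (differential F c p b)"

definition metric_norm ::
  "('a, 'm) bilin_field \<Rightarrow> ('a, 'm) vec_field \<Rightarrow> ('a, 'm) chart \<Rightarrow> 'a \<Rightarrow> real" where
  "metric_norm g v c p = sqrt (g c p (v c p) (v c p))"

definition cone_metric ::
  "('a, 'm) bilin_field \<Rightarrow> ('a, 'm) vec_field \<Rightarrow> real \<Rightarrow> ('a, 'm) bilin_field" where
  "cone_metric g v \<zeta> c p a b =
     1 / (metric_norm g v c p)\<^sup>2 *
       (g c p a b - \<zeta> * (g c p (v c p) a * g c p (v c p) b / (metric_norm g v c p)\<^sup>2))"

definition cone_codifferential ::
  "'a::t2_space set \<Rightarrow> ('a, 'm::finite) chart set \<Rightarrow> ('a, 'm) bilin_field \<Rightarrow> ('a, 'm) vec_field \<Rightarrow>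
     real \<Rightarrow> ('a, 'm) covec_field \<Rightarrow> 'a \<Rightarrow> real" where
  "cone_codifferential M A g v \<zeta> w = codifferential M A (cone_metric g v \<zeta>) w"

definition nu_bar :: "('a, 'm::finite) bilin_field \<Rightarrow> ('a, 'm) vec_field \<Rightarrow> ('a, 'm) top_form" where
  "nu_bar g v c p U = volume_form g c p U / metric_norm g v c p ^ CARD('m)"

definition delta_bar ::
  "('a, 'm::finite) chart set \<Rightarrow> ('a, 'm) bilin_field \<Rightarrow> ('a, 'm) vec_field \<Rightarrow>
     ('a, 'm) covec_field \<Rightarrow> 'a \<Rightarrow> real" where
  "delta_bar A g v w p = - divergence A (nu_bar g v) (\<lambda>c q. w c q (v c q) *\<^sub>R v c q) p"

end

theory Submission
  imports Defs
begin

text \<open>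
  In terms of \<open>h\<^sub>0 = g / \<parallel>v\<parallel>\<^sup>2\<close> and the 1-form \<open>\<theta> = h\<^sub>0(v, \<cdot>)\<close> the metric of the cone kernels is
  \<open>h\<^sub>\<zeta> = h\<^sub>0 - \<zeta> \<theta> \<otimes> \<theta>\<close>, and \<open>h\<^sub>0(v, v) = 1\<close>. So \<open>h\<^sub>\<zeta>\<close> agrees with \<open>h\<^sub>0\<close> on the \<open>h\<^sub>0\<close>-orthogonal
  complement of \<open>v\<close> and is \<open>(1 - \<zeta>) h\<^sub>0\<close> along \<open>v\<close>. Consequently the volume form of \<open>h\<^sub>\<zeta>\<close> is a constant
  multiple of the volume form of \<open>h\<^sub>0\<close>, which is \<open>\<nu>\<close>-bar, and the vector field dual to \<open>w\<close> is
  \<open>w(v) v / (1 - \<zeta>) + Y\<close> with a field \<open>Y\<close> independent of \<open>\<zeta>\<close> (lemmas \<open>metric_density_cone_metric\<close> and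
  \<open>sharp_cone_metric\<close>). The codifferential of a metric is minus the divergence of the dual field, and
  a divergence does not change when the volume form is multiplied by a constant. Hence \<open>\<delta>\<^sub>\<zeta> w\<close>
  differs from the claimed leading term by the divergence of \<open>Y\<close>, which does not depend on \<open>\<zeta>\<close> and
  is bounded because \<open>M\<close> is compact.

  The analytic content is that the weakly defined codifferential exists and is a pointwise divergence
  (\<open>codifferential_eq_divergence_sharp\<close>). Existence is the divergence theorem. A smooth function is
  split into summands supported in single charts. There the integral over the manifold is one integral
  over a coordinate domain (\<open>form_integral_localized\<close>, which rests on the change of variables
  formula), and it can be integrated by parts. Uniqueness follows by testing with smooth bump
  functions. The same test functions show that the coordinate expression of the divergence is the
  same in all charts (\<open>chart_divergence_independent\<close>).
\<close>

section \<open>Functions of class \<open>C\<^sup>k\<close> on open subsets of a Euclidean space\<close>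

lemma Ck_on_Suc_has_derivative:
  assumes "Ck_on (Suc k) f S" "open S" "x \<in> S"
  shows "(f has_derivative frechet_derivative f (at x)) (at x)"
  using assms by (metis Ck_on.simps(2) differentiable_on_eq_differentiable_at frechet_derivative_works)

lemma Ck_on_cong:
  assumes "open S" "\<And>x. x \<in> S \<Longrightarrow> f x = g x"
  shows "Ck_on k f S \<longleftrightarrow> Ck_on k g S"
proof -
  have "Ck_on k g S" if "Ck_on k f S" "\<And>x. x \<in> S \<Longrightarrow> f x = g x" for f g :: "'a \<Rightarrow> 'b"
    using that
  proof (induction k arbitrary: f g)
    case 0
    then show ?case using continuous_on_cong by (metis Ck_on.simps(1))
  next
    case (Suc k)
    have fd: "(f has_derivative frechet_derivative f (at x)) (at x)" if "x \<in> S" for x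
      using Ck_on_Suc_has_derivative[OF Suc.prems(1) assms(1) that] .
    have gd: "(g has_derivative frechet_derivative f (at x)) (at x)" if "x \<in> S" for x
      using has_derivative_transform_within_open[OF fd[OF that] assms(1) that] Suc.prems(2) by simp
    have eq: "frechet_derivative f (at x) = frechet_derivative g (at x)" if "x \<in> S" for x
      using frechet_derivative_at[OF gd[OF that]] .
    have "g differentiable_on S"
      unfolding differentiable_on_def using gd by (meson differentiable_at_withinI differentiableI)
    moreover have "Ck_on k (\<lambda>x. frechet_derivative g (at x) b) S" if "b \<in> Basis" for b
      by (rule Suc.IH[of "\<lambda>x. frechet_derivative f (at x) b"]) (use Suc.prems(1) that eq in auto)
    ultimately show ?case by simp
  qed
  from this[of f g] this[of g f] assms(2) show ?thesis by auto
qed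

lemma Ck_on_SucI:
  assumes "open S" "\<And>x. x \<in> S \<Longrightarrow> (f has_derivative D x) (at x)"
    and "\<And>b. b \<in> Basis \<Longrightarrow> Ck_on k (\<lambda>x. D x b) S"
  shows "Ck_on (Suc k) f S"
proof -
  have "f differentiable_on S"
    unfolding differentiable_on_def using assms(2) by (meson differentiable_at_withinI differentiableI)
  moreover have "Ck_on k (\<lambda>x. frechet_derivative f (at x) b) S" if "b \<in> Basis" for b
  proof -
    have "D x b = frechet_derivative f (at x) b" if "x \<in> S" for x
      using frechet_derivative_at[OF assms(2)[OF that]] by simp
    with Ck_on_cong[OF assms(1), of "\<lambda>x. D x b" "\<lambda>x. frechet_derivative f (at x) b" k] assms(3)[OF that]
    show ?thesis by blast
  qed
  ultimately show ?thesis by simp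
qed

lemma Ck_on_continuous: "Ck_on k f S \<Longrightarrow> continuous_on S f"
  by (cases k) (auto intro: differentiable_imp_continuous_on)

lemma Ck_on_Suc_imp: "Ck_on (Suc k) f S \<Longrightarrow> Ck_on k f S"
proof (induction k arbitrary: f)
  case 0
  then show ?case by (auto intro: differentiable_imp_continuous_on)
next
  case (Suc k)
  from Suc.prems have "\<forall>b\<in>Basis. Ck_on k (\<lambda>x. frechet_derivative f (at x) b) S"
    using Suc.IH by (metis Ck_on.simps(2))
  then show ?case using Suc.prems by simp
qed

lemma Ck_on_Un:
  assumes "open S" "open T" "Ck_on k f S" "Ck_on k f T"
  shows "Ck_on k f (S \<union> T)"
  using assms(3,4)
proof (induction k arbitrary: f)
  case 0
  then show ?case using assms(1,2) by (simp add: continuous_on_open_Un)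
next
  case (Suc k)
  then have "f differentiable_on (S \<union> T)"
    using assms(1,2) by (auto simp: differentiable_on_eq_differentiable_at open_Un)
  with Suc show ?case by simp
qed

lemma Ck_on_const: "Ck_on k (\<lambda>x. c) S"
  by (induction k arbitrary: c) (auto simp: frechet_derivative_const)

lemma Ck_on_add:
  assumes "open S" "Ck_on k f S" "Ck_on k g S"
  shows "Ck_on k (\<lambda>x. f x + g x) S"
  using assms(2,3)
proof (induction k arbitrary: f g)
  case 0
  then show ?case by (auto intro: continuous_intros)
next
  case (Suc k)
  show ?case
  proof (rule Ck_on_SucI[OF assms(1)])
    fix x assume x: "x \<in> S"
    show "((\<lambda>x. f x + g x) has_derivative
      (\<lambda>b. frechet_derivative f (at x) b + frechet_derivative g (at x) b)) (at x)"
      by (intro has_derivative_add Ck_on_Suc_has_derivative[OF Suc.prems(1) assms(1) x]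
        Ck_on_Suc_has_derivative[OF Suc.prems(2) assms(1) x])
  qed (use Suc in auto)
qed

lemma Ck_on_bounded_linear:
  assumes "bounded_linear L" "open S" "Ck_on k f S"
  shows "Ck_on k (\<lambda>x. L (f x)) S"
  using assms(3)
proof (induction k arbitrary: f)
  case 0
  then show ?case using assms(1) by (auto intro: bounded_linear.continuous_on)
next
  case (Suc k)
  show ?case
  proof (rule Ck_on_SucI[OF assms(2)])
    fix x assume x: "x \<in> S"
    show "((\<lambda>x. L (f x)) has_derivative (\<lambda>b. L (frechet_derivative f (at x) b))) (at x)"
      by (intro bounded_linear.has_derivative[OF assms(1)] Ck_on_Suc_has_derivative[OF Suc.prems assms(2) x])
  qed (use Suc in auto)
qed

lemma Ck_on_bilinear:
  fixes f :: "'e::euclidean_space \<Rightarrow> 'f::real_normed_vector" and g :: "'e \<Rightarrow> 'g::real_normed_vector"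
  assumes B: "bounded_bilinear B" and "open S" "Ck_on k f S" "Ck_on k g S"
  shows "Ck_on k (\<lambda>x. B (f x) (g x)) S"
  using assms(3,4)
proof (induction k arbitrary: f g)
  case 0
  then show ?case using B by (auto intro: bounded_bilinear.continuous_on)
next
  case (Suc k)
  show ?case
  proof (rule Ck_on_SucI[OF assms(2)])
    fix x assume x: "x \<in> S"
    show "((\<lambda>x. B (f x) (g x)) has_derivative
      (\<lambda>b. B (f x) (frechet_derivative g (at x) b) + B (frechet_derivative f (at x) b) (g x))) (at x)"
      by (intro bounded_bilinear.FDERIV[OF B] Ck_on_Suc_has_derivative[OF Suc.prems(1) assms(2) x]
        Ck_on_Suc_has_derivative[OF Suc.prems(2) assms(2) x])
  next
    fix b :: 'e assume b: "b \<in> Basis"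
    show "Ck_on k (\<lambda>x. B (f x) (frechet_derivative g (at x) b) + B (frechet_derivative f (at x) b) (g x)) S"
      using Suc.prems b Ck_on_Suc_imp[OF Suc.prems(1)] Ck_on_Suc_imp[OF Suc.prems(2)]
      by (intro Ck_on_add assms(2) Suc.IH) auto
  qed
qed

lemmas Ck_on_mult = Ck_on_bilinear[OF bounded_bilinear_mult]
lemmas Ck_on_scaleR = Ck_on_bilinear[OF bounded_bilinear_scaleR]
lemmas Ck_on_inner = Ck_on_bilinear[OF bounded_bilinear_inner]

lemma Ck_on_diff:
  assumes "open S" "Ck_on k f S" "Ck_on k g S"
  shows "Ck_on k (\<lambda>x. f x - g x) S"
  using Ck_on_add[OF assms(1,2) Ck_on_bounded_linear[OF bounded_linear_minus[OF bounded_linear_ident] assms(1,3)]] by simp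

lemma Ck_on_sum:
  assumes "open S" "\<And>i. i \<in> I \<Longrightarrow> Ck_on k (f i) S"
  shows "Ck_on k (\<lambda>x. \<Sum>i\<in>I. f i x) S"
proof (cases "finite I")
  case True
  then show ?thesis using assms(2)
    by (induction I rule: finite_induct) (auto simp: Ck_on_const intro: Ck_on_add assms(1))
qed (simp add: Ck_on_const)

lemma Ck_on_prod:
  fixes f :: "'i \<Rightarrow> 'e::euclidean_space \<Rightarrow> real"
  assumes "open S" "\<And>i. i \<in> I \<Longrightarrow> Ck_on k (f i) S"
  shows "Ck_on k (\<lambda>x. \<Prod>i\<in>I. f i x) S"
proof (cases "finite I")
  case True
  then show ?thesis using assms(2)
    by (induction I rule: finite_induct) (auto simp: Ck_on_const intro: Ck_on_mult assms(1))
qed (simp add: Ck_on_const)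

lemma Ck_on_vec_nth: "open S \<Longrightarrow> Ck_on k f S \<Longrightarrow> Ck_on k (\<lambda>x. f x $ i) S"
  by (rule Ck_on_bounded_linear[OF bounded_linear_vec_nth])

lemma Ck_on_vec_lambda:
  fixes f :: "'e::euclidean_space \<Rightarrow> real ^ 'm::finite"
  assumes "open S" "\<And>i. Ck_on k (\<lambda>x. f x $ i) S"
  shows "Ck_on k f S"
proof -
  have "(\<lambda>x. \<Sum>i\<in>UNIV. f x $ i *\<^sub>R (axis i 1 :: real ^ 'm)) = f"
    by (simp add: fun_eq_iff basis_expansion flip: scalar_mult_eq_scaleR)
  moreover have "Ck_on k (\<lambda>x. \<Sum>i\<in>UNIV. f x $ i *\<^sub>R (axis i 1 :: real ^ 'm)) S"
    by (intro Ck_on_sum Ck_on_scaleR assms Ck_on_const)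
  ultimately show ?thesis by simp
qed

lemma Ck_on_det:
  fixes G :: "'e::euclidean_space \<Rightarrow> real ^ 'm ^ 'm::finite"
  assumes "open S" "\<And>i j. Ck_on k (\<lambda>x. G x $ i $ j) S"
  shows "Ck_on k (\<lambda>x. det (G x)) S"
  unfolding det_def by (intro Ck_on_sum Ck_on_mult Ck_on_prod assms Ck_on_const)

lemma linear_expansion_axis:
  fixes L :: "real ^ 'm::finite \<Rightarrow> 'f::real_vector"
  assumes "linear L"
  shows "L a = (\<Sum>i\<in>UNIV. a $ i *\<^sub>R L (axis i 1))"
proof -
  have "L a = L (\<Sum>i\<in>UNIV. a $ i *\<^sub>R axis i 1)"
    using basis_expansion[of a] by (simp add: scalar_mult_eq_scaleR)
  also have "\<dots> = (\<Sum>i\<in>UNIV. a $ i *\<^sub>R L (axis i 1))"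
    using assms by (simp add: linear_sum linear_cmul)
  finally show ?thesis .
qed

text \<open>
  This turns smoothness of the coefficients of a tensor field into smoothness of the tensor field
  evaluated on a vector field.
\<close>

lemma Ck_on_linear_apply:
  fixes V :: "'e::euclidean_space \<Rightarrow> real ^ 'm::finite"
  assumes "open S" "\<And>i. Ck_on k (\<lambda>x. L x (axis i 1)) S" "\<And>x. x \<in> S \<Longrightarrow> linear (L x)" "Ck_on k V S"
  shows "Ck_on k (\<lambda>x. L x (V x)) S"
proof -
  have "Ck_on k (\<lambda>x. \<Sum>i\<in>UNIV. V x $ i *\<^sub>R L x (axis i 1)) S"
    by (intro Ck_on_sum Ck_on_scaleR Ck_on_vec_nth assms)
  then show ?thesis
    using Ck_on_cong[OF assms(1), of "\<lambda>x. \<Sum>i\<in>UNIV. V x $ i *\<^sub>R L x (axis i 1)" "\<lambda>x. L x (V x)" k]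
      linear_expansion_axis[OF assms(3)] by metis
qed

lemma C1_on_compose_real:
  fixes Q :: "'e::euclidean_space \<Rightarrow> real"
  assumes "open S" "Ck_on 1 Q S"
    and "\<And>x. x \<in> S \<Longrightarrow> (\<phi> has_real_derivative \<phi>' (Q x)) (at (Q x))" "continuous_on (Q ` S) \<phi>'"
  shows "Ck_on 1 (\<lambda>x. \<phi> (Q x)) S"
  unfolding One_nat_def
proof (rule Ck_on_SucI[OF assms(1), where D = "\<lambda>x b. frechet_derivative Q (at x) b * \<phi>' (Q x)"])
  fix x assume x: "x \<in> S"
  show "((\<lambda>x. \<phi> (Q x)) has_derivative (\<lambda>b. frechet_derivative Q (at x) b * \<phi>' (Q x))) (at x)"
    using has_derivative_compose[OF Ck_on_Suc_has_derivative[OF assms(2)[unfolded One_nat_def] assms(1) x]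
      assms(3)[OF x, unfolded has_field_derivative_def]] by (simp add: mult.commute)
next
  fix b :: 'e assume "b \<in> Basis"
  then show "Ck_on 0 (\<lambda>x. frechet_derivative Q (at x) b * \<phi>' (Q x)) S"
    using assms(2) continuous_on_compose2[OF assms(4) Ck_on_continuous[OF assms(2)] subset_refl]
    by (auto intro!: continuous_on_mult)
qed

lemma C1_on_inverse:
  fixes Q :: "'e::euclidean_space \<Rightarrow> real"
  assumes "open S" "Ck_on 1 Q S" "\<And>x. x \<in> S \<Longrightarrow> Q x \<noteq> 0"
  shows "Ck_on 1 (\<lambda>x. inverse (Q x)) S"
  by (rule C1_on_compose_real[OF assms(1,2), where \<phi>' = "\<lambda>t. - (inverse t * inverse t)"])
    (use assms(3) in \<open>auto intro!: derivative_eq_intros continuous_intros simp: power2_eq_square\<close>)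

lemma C1_on_sqrt:
  fixes Q :: "'e::euclidean_space \<Rightarrow> real"
  assumes "open S" "Ck_on 1 Q S" "\<And>x. x \<in> S \<Longrightarrow> Q x > 0"
  shows "Ck_on 1 (\<lambda>x. sqrt (Q x)) S"
  by (rule C1_on_compose_real[OF assms(1,2), where \<phi>' = "\<lambda>t. inverse (sqrt t) / 2"])
    (use assms(3) in \<open>fastforce intro!: DERIV_real_sqrt continuous_intros\<close>)+

text \<open>
  The function \<open>flat 0\<close> is the standard smooth function that vanishes exactly on the nonpositive
  reals. The index is there because the linear span of the family is closed under differentiation.
\<close>

definition flat :: "nat \<Rightarrow> real \<Rightarrow> real" where
  "flat j t = (if t > 0 then exp (- 1 / t) / t ^ j else 0)"

lemma flat_tendsto_0: "((\<lambda>t. exp (- 1 / t) / t ^ j) \<longlongrightarrow> 0) (at_right (0::real))"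
proof -
  have "((\<lambda>x::real. x ^ j / exp x) \<longlongrightarrow> 0) at_top" by (rule tendsto_power_div_exp_0)
  then have "((\<lambda>x::real. inverse x ^ j / exp (inverse x)) \<longlongrightarrow> 0) (at_right 0)"
    by (rule filterlim_compose[OF _ filterlim_inverse_at_top_right])
  moreover have "inverse x ^ j / exp (inverse x) = exp (- 1 / x) / x ^ j" for x :: real
    by (simp add: exp_minus field_simps power_inverse)
  ultimately show ?thesis by simp
qed

lemma flat_has_derivative:
  "(flat j has_real_derivative (flat (j + 2) t - real j * flat (j + 1) t)) (at t)"
proof -
  consider "t > 0" | "t < 0" | "t = 0" by linarith
  then show ?thesis
  proof cases
    case 1
    have "((\<lambda>t. exp (- 1 / t) / t ^ j) has_real_derivative (flat (j + 2) t - real j * flat (j + 1) t)) (at t)"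
      using 1 by (auto intro!: derivative_eq_intros simp: flat_def)
        (cases j; simp add: field_simps power2_eq_square)
    then show ?thesis
      by (rule DERIV_cong_ev[OF refl _ refl, THEN iffD1, rotated])
        (use 1 in \<open>auto simp: flat_def eventually_nhds_in_open intro!: eventually_mono[OF eventually_nhds_in_open[of "{0<..}"]]\<close>)
  next
    case 2
    have "((\<lambda>t. 0) has_real_derivative (flat (j + 2) t - real j * flat (j + 1) t)) (at t)"
      using 2 by (auto simp: flat_def)
    then show ?thesis
      by (rule DERIV_cong_ev[OF refl _ refl, THEN iffD1, rotated])
        (use 2 in \<open>auto simp: flat_def intro!: eventually_mono[OF eventually_nhds_in_open[of "{..<0}"]]\<close>)
  next
    case 3
    \<comment> \<open>the difference quotient at 0 from the right is \<open>exp (- 1 / h) / h ^ (j + 1)\<close>\<close>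
    have "((\<lambda>h. flat j h / h) \<longlongrightarrow> 0) (at_right 0)"
      by (rule Lim_transform_eventually[OF flat_tendsto_0[of "Suc j"]])
        (auto simp: flat_def eventually_at_right_less field_simps intro: eventually_mono[OF eventually_at_right_less[of 0]])
    moreover have "((\<lambda>h. flat j h / h) \<longlongrightarrow> 0) (at_left 0)"
      by (rule Lim_transform_eventually[OF tendsto_const])
        (auto simp: flat_def intro: eventually_at_leftI[of "-1"])
    ultimately have "((\<lambda>h. flat j h / h) \<longlongrightarrow> 0) (at 0)"
      by (simp add: filterlim_split_at)
    then show ?thesis using 3 by (simp add: DERIV_def flat_def)
  qed
qed

lemma Ck_on_flat:
  fixes Q :: "'e::euclidean_space \<Rightarrow> real"
  assumes "open S" "Ck_on k Q S"
  shows "Ck_on k (\<lambda>x. flat j (Q x)) S"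
  using assms(2)
proof (induction k arbitrary: j)
  case 0
  have "continuous_on UNIV (flat j)"
    using flat_has_derivative by (metis DERIV_isCont continuous_at_imp_continuous_on)
  with 0 show ?case by (auto intro: continuous_on_compose2)
next
  case (Suc k)
  show ?case
  proof (rule Ck_on_SucI[OF assms(1),
        where D = "\<lambda>x b. frechet_derivative Q (at x) b * (flat (j + 2) (Q x) - real j * flat (j + 1) (Q x))"])
    fix x assume x: "x \<in> S"
    show "((\<lambda>x. flat j (Q x)) has_derivative
      (\<lambda>b. frechet_derivative Q (at x) b * (flat (j + 2) (Q x) - real j * flat (j + 1) (Q x)))) (at x)"
      using has_derivative_compose[OF Ck_on_Suc_has_derivative[OF Suc.prems assms(1) x]
        flat_has_derivative[unfolded has_field_derivative_def]] by (simp add: mult.commute)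
  next
    fix b :: 'e assume "b \<in> Basis"
    then show "Ck_on k (\<lambda>x. frechet_derivative Q (at x) b * (flat (j + 2) (Q x) - real j * flat (j + 1) (Q x))) S"
      using Suc.prems by (intro Ck_on_mult Ck_on_diff assms(1) Ck_on_const Suc.IH Ck_on_Suc_imp[OF Suc.prems]) auto
  qed
qed

lemma flat_nonneg: "flat 0 t \<ge> 0" and flat_pos_iff: "flat 0 t > 0 \<longleftrightarrow> t > 0"
  by (auto simp: flat_def)

section \<open>Matrices and determinants\<close>

lemma det_perturb_rows_derivative:
  fixes R D :: "'m::finite \<Rightarrow> real ^ 'm"
  shows "((\<lambda>t. det (\<chi> i. R i + t *\<^sub>R D i)) has_real_derivative
    (\<Sum>k\<in>UNIV. det (\<chi> i. if i = k then D i else R i))) (at 0)"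
proof -
  let ?P = "{p. p permutes (UNIV :: 'm set)}"
  have "((\<lambda>t. det (\<chi> i. R i + t *\<^sub>R D i)) has_real_derivative
    (\<Sum>p\<in>?P. of_int (sign p) * (\<Sum>k\<in>UNIV. D k $ p k * (\<Prod>i\<in>UNIV - {k}. R i $ p i)))) (at 0)"
    unfolding det_def
    by (auto intro!: DERIV_sum DERIV_cmult has_field_derivative_prod[THEN DERIV_cong] derivative_eq_intros)
  moreover have "(\<Prod>i\<in>UNIV. (if i = k then D i else R i) $ p i) = D k $ p k * (\<Prod>i\<in>UNIV - {k}. R i $ p i)"
    for p k
    by (subst prod.remove[of _ k]) (auto intro!: prod.cong)
  then have "(\<Sum>p\<in>?P. of_int (sign p) * (\<Sum>k\<in>UNIV. D k $ p k * (\<Prod>i\<in>UNIV - {k}. R i $ p i))) =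
    (\<Sum>k\<in>UNIV. det (\<chi> i. if i = k then D i else R i))"
    unfolding det_def by (subst sum.swap) (simp add: sum_distrib_left)
  ultimately show ?thesis by simp
qed

lemma sum_det_replace_row_mat_1:
  fixes B :: "real ^ 'm ^ 'm::finite"
  shows "(\<Sum>k\<in>UNIV. det (\<chi> i. if i = k then B $ i else mat 1 $ i)) = trace B"
proof -
  have "(\<chi> i. if i = k then B $ i else mat 1 $ i) =
    (\<chi> i. if i = k then \<Sum>j\<in>UNIV. (B $ k) $ j *s row j (mat 1) else row i (mat 1))" for k
    by (auto simp: vec_eq_iff row_def mat_def if_distrib cong: if_cong)
  then show ?thesis
    by (simp add: cramer_lemma_transpose trace_def)
qed

text \<open>
  Both sides are the derivative at \<open>t = 0\<close> of \<open>det (U (1 + t B\<^sup>T)) = det U * det (1 + t B\<^sup>T)\<close>: on the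
  left the determinant is differentiated row by row, on the right only the second factor varies.
  The left-hand side is the sum that appears in the Lie derivative of a volume form.
\<close>

lemma sum_det_replace_row:
  fixes B U :: "real ^ 'm ^ 'm::finite"
  shows "(\<Sum>k\<in>UNIV. det (\<chi> j. if j = k then B *v (U $ k) else U $ j)) = trace B * det U"
proof -
  let ?C = "transpose B"
  have l: "(\<chi> i. U $ i + t *\<^sub>R (B *v (U $ i))) = U ** (\<chi> i. mat 1 $ i + t *\<^sub>R ?C $ i)" for t
  proof -
    have "U ** (\<chi> i. mat 1 $ i + t *\<^sub>R ?C $ i) = U ** (mat 1 + (\<chi> i j. t * ?C $ i $ j))"
      by (rule arg_cong[where f = "(**) U"]) (simp add: vec_eq_iff)
    also have "\<dots> = U + U ** (\<chi> i j. t * ?C $ i $ j)" by (simp add: matrix_add_ldistrib)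
    also have "\<dots> = (\<chi> i. U $ i + t *\<^sub>R (B *v (U $ i)))"
      by (simp add: vec_eq_iff matrix_matrix_mult_def matrix_vector_mult_def transpose_def
          sum_distrib_left mult_ac)
    finally show ?thesis by simp
  qed
  have "((\<lambda>t. det U * det (\<chi> i. mat 1 $ i + t *\<^sub>R ?C $ i)) has_real_derivative
      det U * (\<Sum>k\<in>UNIV. det (\<chi> i. if i = k then ?C $ i else mat 1 $ i))) (at 0)"
    by (intro DERIV_cmult det_perturb_rows_derivative)
  moreover have "((\<lambda>t. det U * det (\<chi> i. mat 1 $ i + t *\<^sub>R ?C $ i)) has_real_derivative
      (\<Sum>k\<in>UNIV. det (\<chi> j. if j = k then B *v (U $ j) else U $ j))) (at 0)"
    using det_perturb_rows_derivative[of "\<lambda>i. U $ i" "\<lambda>i. B *v (U $ i)"]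
    unfolding l det_mul .
  ultimately have "(\<Sum>k\<in>UNIV. det (\<chi> j. if j = k then B *v (U $ j) else U $ j)) = det U * trace ?C"
    unfolding sum_det_replace_row_mat_1 by (rule DERIV_unique[rotated])
  moreover have "(\<chi> j. if j = k then B *v (U $ j) else U $ j) = (\<chi> j. if j = k then B *v (U $ k) else U $ j)" for k
    by (auto simp: vec_eq_iff)
  ultimately show ?thesis by (simp add: trace_def transpose_def mult.commute)
qed

text \<open>
  An orthogonal change of basis turns \<open>u\<close> into a multiple of a basis vector, and then the matrix
  differs from the identity in one row only.
\<close>

lemma det_mat_1_plus_rank_one:
  fixes u w :: "real ^ 'm::finite"
  shows "det (mat 1 + (\<chi> i j. u $ i * w $ j)) = 1 + u \<bullet> w"
proof (cases "u = 0")
  case True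
  then have "(\<chi> i j. u $ i * w $ j) = (0 :: real ^ 'm ^ 'm)" by (simp add: vec_eq_iff)
  with True show ?thesis by simp
next
  case False
  fix k :: 'm
  let ?r = "norm u"
  obtain Q :: "real ^ 'm ^ 'm" where Q: "orthogonal_matrix Q" "Q *v axis k 1 = (1 / ?r) *\<^sub>R u"
    using orthogonal_matrix_exists_basis[of "(1 / ?r) *\<^sub>R u" k] False by auto
  have QQ: "transpose Q ** Q = mat 1" "Q ** transpose Q = mat 1"
    using Q(1) by (auto simp: orthogonal_matrix_def)
  define y where "y = transpose Q *v w"
  have u: "u = Q *v (?r *\<^sub>R axis k 1)"
    using Q(2) False by (simp add: matrix_vector_mult_scaleR)
  have uk: "u $ i = ?r * Q $ i $ k" for i
    by (subst u) (simp add: matrix_vector_mult_scaleR matrix_vector_mult_basis column_def)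
  have rows: "(\<chi> i. if i = k then \<Sum>j\<in>UNIV. z $ j *s row j (mat 1) else row i (mat 1)) =
      (\<chi> i. if i = k then z else axis i 1)" for z :: "real ^ 'm"
  proof -
    have "row j (mat 1) = (axis j 1 :: real ^ 'm)" for j
      by (auto simp: vec_eq_iff row_def mat_def axis_def)
    then show ?thesis by (simp only: basis_expansion)
  qed
  define E where "E = (\<chi> i j. (if i = k then ?r * y $ j else 0))"
  define W where "W = (\<chi> i j. u $ i * w $ j)"
  define N where "N = (\<chi> i. if i = k then axis k 1 + ?r *\<^sub>R y else axis i 1)"
  have N: "N = mat 1 + E"
    by (auto simp: N_def E_def vec_eq_iff mat_def axis_def)
  have QE: "Q ** E = W ** Q"
  proof -
    have "Q ** E = (\<chi> i j. u $ i * y $ j)"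
      by (auto simp: E_def vec_eq_iff matrix_matrix_mult_def uk if_distrib cong: if_cong)
    also have "\<dots> = W ** Q"
      by (auto simp: W_def vec_eq_iff matrix_matrix_mult_def y_def matrix_vector_mult_def transpose_def
          sum_distrib_left algebra_simps)
    finally show ?thesis .
  qed
  have "Q ** N = Q + W ** Q"
    by (simp add: N matrix_add_ldistrib QE)
  also have "\<dots> = (mat 1 + W) ** Q"
    by (simp add: vec_eq_iff matrix_matrix_mult_def sum.distrib distrib_right mat_def if_distrib[of "\<lambda>x. x * _"] cong: if_cong)
  finally have "det Q * det N = det (mat 1 + W) * det Q"
    by (metis det_mul)
  moreover have "det Q \<noteq> 0"
    using QQ(1) det_mul[of "transpose Q" Q] by auto
  moreover have "det N = 1 + ?r * y $ k"
    using cramer_lemma_transpose[of k "axis k 1 + ?r *\<^sub>R y" "mat 1"] unfolding rows N_def by simp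
  moreover have "?r * y $ k = u \<bullet> w"
    by (simp add: y_def matrix_vector_mult_def transpose_def inner_vec_def uk sum_distrib_left mult.assoc)
  ultimately show ?thesis by (simp add: W_def)
qed

lemma det_scaleR:
  fixes G :: "real ^ 'm ^ 'm::finite"
  shows "det (k *\<^sub>R G) = k ^ CARD('m) * det G"
proof -
  have "k *\<^sub>R G = (\<chi> i. k *s G $ i)" by (simp add: vec_eq_iff)
  then show ?thesis using det_rows_mul[of "\<lambda>_. k" "\<lambda>i. G $ i"] by simp
qed

lemma matrix_inv_mult:
  fixes G :: "real ^ 'm ^ 'm::finite"
  assumes "invertible G"
  shows "matrix_inv G ** G = mat 1"
  using someI_ex[OF assms[unfolded invertible_def]] unfolding matrix_inv_def by blast

lemma matrix_eq_via_inner: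
  fixes G :: "real ^ 'm ^ 'm::finite"
  assumes "\<And>a b. a \<bullet> (G *v b) = a \<bullet> (H *v b)"
  shows "G = H"
proof -
  have "G *v b = H *v b" for b
    using assms by (subst vector_eq_ldot[symmetric]) simp
  then show ?thesis by (simp add: matrix_eq)
qed

text \<open>
  A positive definite matrix is joined to the identity by a segment of positive definite, hence
  invertible, matrices, and the determinant cannot change sign along it.
\<close>

lemma det_pos_definite:
  fixes G :: "real ^ 'm ^ 'm::finite"
  assumes "\<And>a. a \<noteq> 0 \<Longrightarrow> a \<bullet> (G *v a) > 0"
  shows "det G > 0"
proof (rule ccontr)
  assume neg: "\<not> det G > 0"
  let ?H = "\<lambda>t::real. (1 - t) *\<^sub>R mat 1 + t *\<^sub>R G"
  have "continuous_on {0..1} (\<lambda>t. det (?H t))"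
    unfolding det_def by (intro continuous_intros)
  moreover have "det (?H 1) \<le> 0" "0 \<le> det (?H 0)" using neg by auto
  ultimately obtain t where t: "0 \<le> t" "t \<le> 1" "det (?H t) = 0"
    using IVT2'[of "\<lambda>t. det (?H t)" 1 0 0] by auto
  then obtain a where a: "a \<noteq> 0" "?H t *v a = 0"
    using invertible_det_nz invertible_left_inverse matrix_left_invertible_ker by metis
  have "0 = a \<bullet> (?H t *v a)" using a by simp
  also have "\<dots> = (1 - t) * (a \<bullet> a) + t * (a \<bullet> (G *v a))"
    by (simp add: matrix_vector_mult_add_rdistrib scaleR_matrix_vector_assoc[symmetric] inner_add_right)
  also have "\<dots> > 0"
    using assms[OF a(1)] a(1) t(1,2)
    by (cases "t = 0") (auto intro!: add_nonneg_pos mult_nonneg_nonneg mult_pos_pos)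
  finally show False by simp
qed

lemma inner_pullback:
  fixes J G :: "real ^ 'm ^ 'm::finite"
  shows "(J *v a) \<bullet> (G *v (J *v b)) = a \<bullet> ((transpose J ** (G ** J)) *v b)"
proof -
  have "(J *v a) \<bullet> y = a \<bullet> (transpose J *v y)" for y
    by (metis dot_lmul_matrix vector_transpose_matrix)
  then show ?thesis by (simp add: matrix_vector_mul_assoc[symmetric])
qed

section \<open>Integration in Euclidean space\<close>

lemma integrable_continuous_compact_support:
  fixes f :: "'e::euclidean_space \<Rightarrow> real"
  assumes "compact K" "K \<subseteq> S" "continuous_on S f" "\<And>x. x \<in> S - K \<Longrightarrow> f x = 0"
  shows "set_integrable lborel S f"
proof -
  have "integrable lborel (\<lambda>x. indicator K x *\<^sub>R f x)"
    using assms by (intro borel_integrable_compact continuous_on_subset[OF assms(3)])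
  moreover have "(\<lambda>x. indicator K x *\<^sub>R f x) = (\<lambda>x. indicator S x *\<^sub>R f x)"
    using assms(2,4) by (auto simp: indicator_def fun_eq_iff)
  ultimately show ?thesis unfolding set_integrable_def by metis
qed

text \<open>
  The set where \<open>f\<close> does not vanish is open and of measure zero, hence empty.
\<close>

lemma integral_nonneg_eq_0_imp_0:
  fixes f :: "'e::euclidean_space \<Rightarrow> real"
  assumes "open S" "continuous_on S f" "set_integrable lborel S f" "\<And>x. x \<in> S \<Longrightarrow> f x \<ge> 0"
    and "(LINT x:S|lborel. f x) = 0" "x \<in> S"
  shows "f x = 0"
proof (rule ccontr)
  assume "f x \<noteq> 0"
  let ?N = "S \<inter> f -` (- {0})"
  have op: "open ?N"
    by (intro continuous_open_preimage assms(1,2)) auto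
  have "AE x in lborel. indicator S x *\<^sub>R f x = 0"
    using assms(3-5) unfolding set_integrable_def set_lebesgue_integral_def
    by (subst (asm) integral_nonneg_eq_0_iff_AE) (auto simp: indicator_def)
  then have "AE x in lborel. x \<notin> ?N"
    by eventually_elim auto
  then have "?N \<in> null_sets lborel"
    using op by (subst (asm) AE_iff_null_sets[symmetric]) auto
  then have "negligible ?N"
    by (metis negligible_iff_null_sets null_sets_completionI)
  with op have "?N = {}" using open_not_negligible by blast
  with \<open>x \<in> S\<close> \<open>f x \<noteq> 0\<close> show False by auto
qed

text \<open>
  By translation invariance the difference quotients of \<open>f\<close> in the direction \<open>b\<close> have integral
  zero; they converge dominatedly to the directional derivative.
\<close>

lemma integral_directional_derivative_eq_0:
  fixes f :: "'e::euclidean_space \<Rightarrow> real"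
  assumes "compact K" "\<And>x. x \<notin> K \<Longrightarrow> f x = 0"
    and df: "\<And>x. (f has_derivative f' x) (at x)" and cont: "continuous_on UNIV (\<lambda>x. f' x b)"
  shows "(\<integral>x. f' x b \<partial>lborel) = 0"
proof -
  have f'0: "f' x b = 0" if "x \<notin> K" for x
  proof -
    have "(f has_derivative (\<lambda>_. 0)) (at x)"
      by (rule has_derivative_transform_within_open[OF has_derivative_const, where s = "- K"])
        (use that assms compact_imp_closed in auto)
    with df[of x] show ?thesis by (metis has_derivative_unique)
  qed
  define L where "L = (\<lambda>(t, x). x - t *\<^sub>R b) ` ({0..1::real} \<times> K)"
  have "compact L" unfolding L_def
    by (intro compact_continuous_image compact_Times assms) (auto intro!: continuous_intros simp: case_prod_unfold)
  have "bounded ((\<lambda>x. f' x b) ` K)"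
    using assms(1) cont by (intro compact_imp_bounded compact_continuous_image) (auto intro: continuous_on_subset)
  then obtain B where B: "\<And>x. x \<in> K \<Longrightarrow> \<bar>f' x b\<bar> \<le> B" and "B > 0"
    by (force simp: bounded_pos)
  then have B: "\<bar>f' x b\<bar> \<le> B" for x by (cases "x \<in> K") (auto simp: f'0)
  define t where "t n = inverse (real (Suc n))" for n
  have t: "0 < t n" "t n \<le> 1" for n by (auto simp: t_def inverse_le_1_iff)
  have t0: "t \<longlonglongrightarrow> 0" unfolding t_def by (rule LIMSEQ_inverse_real_of_nat)
  have contf: "continuous_on UNIV f"
    using df by (meson continuous_at_imp_continuous_on has_derivative_continuous)
  have intf: "integrable lborel f"
    using integrable_continuous_compact_support[of K UNIV f] assms contf by (simp add: set_integrable_def)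
  have line: "((\<lambda>s. f (x + s *\<^sub>R b)) has_real_derivative f' (x + s *\<^sub>R b) b) (at s)" for x s
  proof -
    have "((\<lambda>s. f (x + s *\<^sub>R b)) has_derivative (\<lambda>r. f' (x + s *\<^sub>R b) (r *\<^sub>R b))) (at s)"
      by (rule has_derivative_compose[OF _ df]) (auto intro!: derivative_eq_intros)
    then show ?thesis
      using linear_cmul[OF has_derivative_linear[OF df]]
      by (simp add: has_field_derivative_def mult_commute_abs)
  qed
  let ?g = "\<lambda>n x. (f (x + t n *\<^sub>R b) - f x) / t n"
  have shift: "integrable lborel (\<lambda>x. f (x + c))" "(\<integral>x. f (x + c) \<partial>lborel) = (\<integral>x. f x \<partial>lborel)" for c
  proof -
    have m: "f \<in> borel_measurable borel" using contf by (rule borel_measurable_continuous_onI)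
    have *: "lborel = distr lborel borel (\<lambda>x. c + x)" by (simp add: lborel_distr_plus)
    show "integrable lborel (\<lambda>x. f (x + c))"
      using intf by (subst (asm) *, subst (asm) integrable_distr_eq) (auto simp: m add.commute)
    show "(\<integral>x. f (x + c) \<partial>lborel) = (\<integral>x. f x \<partial>lborel)"
      by (subst (2) *, subst integral_distr) (auto simp: m add.commute)
  qed
  have int0: "(\<integral>x. ?g n x \<partial>lborel) = 0" for n
    using shift[of "t n *\<^sub>R b"] intf by simp
  have "(\<lambda>n. \<integral>x. ?g n x \<partial>lborel) \<longlonglongrightarrow> (\<integral>x. f' x b \<partial>lborel)"
  proof (rule integral_dominated_convergence)
    show "integrable lborel (\<lambda>x. indicator L x *\<^sub>R B)"
      by (intro borel_integrable_compact \<open>compact L\<close> continuous_on_const)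
    show "?g n \<in> borel_measurable lborel" for n
      using shift(1)[of "t n *\<^sub>R b"] intf by (auto dest: borel_measurable_integrable)
    show "(\<lambda>x. f' x b) \<in> borel_measurable lborel"
      using borel_measurable_continuous_onI[OF cont] by simp
    show "AE x in lborel. (\<lambda>n. ?g n x) \<longlonglongrightarrow> f' x b"
    proof (rule AE_I2)
      fix x
      have "((\<lambda>s. f (x + s *\<^sub>R b)) has_real_derivative f' x b) (at 0)"
        using line[of x 0] by simp
      then have "((\<lambda>s. (f (x + s *\<^sub>R b) - f x) / s) \<longlongrightarrow> f' x b) (at 0)"
        by (simp add: DERIV_def)
      moreover have "filterlim t (at 0) sequentially"
        unfolding filterlim_at using t0 t(1) by (auto simp: less_imp_neq[symmetric] intro!: always_eventually)      ultimately show "(\<lambda>n. ?g n x) \<longlonglongrightarrow> f' x b"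
        by (rule filterlim_compose)
    qed
    show "AE x in lborel. norm (?g n x) \<le> indicator L x *\<^sub>R B" for n
    proof (rule AE_I2)
      fix x
      show "norm (?g n x) \<le> indicator L x *\<^sub>R B"
      proof (cases "x \<in> L")
        case True
        obtain s where "f (x + t n *\<^sub>R b) - f (x + 0 *\<^sub>R b) = (t n - 0) * f' (x + s *\<^sub>R b) b"
          using MVT2[OF t(1)[of n], of "\<lambda>s. f (x + s *\<^sub>R b)" "\<lambda>s. f' (x + s *\<^sub>R b) b"] line by blast
        then have "?g n x = f' (x + s *\<^sub>R b) b" using t(1)[of n] by simp
        with B True show ?thesis by simp
      next
        case False
        have "x + s *\<^sub>R b \<notin> K" if "0 \<le> s" "s \<le> 1" for s
        proof
          assume "x + s *\<^sub>R b \<in> K"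
          then have "(x + s *\<^sub>R b) - s *\<^sub>R b \<in> L" unfolding L_def using that by force
          with False show False by simp
        qed
        from this[of "t n"] this[of 0] have "?g n x = 0"
          using t[of n] by (simp add: assms(2))
        with False show ?thesis by simp
      qed
    qed
  qed
  then show ?thesis unfolding int0 by (simp add: LIMSEQ_const_iff)
qed


definition coord_div :: "(real ^ 'm \<Rightarrow> real ^ 'm) \<Rightarrow> real ^ 'm::finite \<Rightarrow> real" where
  "coord_div Z x = trace (matrix (frechet_derivative Z (at x)))"

lemma coord_div_eq: "coord_div Z x = (\<Sum>i\<in>UNIV. frechet_derivative Z (at x) (axis i 1) $ i)"
  by (simp add: coord_div_def trace_def matrix_def)

lemma continuous_on_coord_div:
  assumes "open S" "Ck_on 1 Z S"
  shows "continuous_on S (coord_div Z)"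
  unfolding coord_div_eq[abs_def]
  using assms by (intro continuous_intros) (auto simp: axis_in_Basis_iff)

lemma coord_div_linear_combination:
  assumes "open S" "x \<in> S" "Ck_on 1 Z S" "Ck_on 1 Z' S" "\<And>y. y \<in> S \<Longrightarrow> Y y = r *\<^sub>R Z y + s *\<^sub>R Z' y"
  shows "coord_div Y x = r * coord_div Z x + s * coord_div Z' x"
proof -
  note D = Ck_on_Suc_has_derivative[OF assms(3)[unfolded One_nat_def] assms(1,2)]
    and D' = Ck_on_Suc_has_derivative[OF assms(4)[unfolded One_nat_def] assms(1,2)]
  let ?D = "\<lambda>a. r *\<^sub>R frechet_derivative Z (at x) a + s *\<^sub>R frechet_derivative Z' (at x) a"
  have "((\<lambda>y. r *\<^sub>R Z y + s *\<^sub>R Z' y) has_derivative ?D) (at x)"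
    by (intro has_derivative_add has_derivative_scaleR_right D D')
  then have "(Y has_derivative ?D) (at x)"
    by (rule has_derivative_transform_within_open[OF _ assms(1,2)]) (simp add: assms(5))
  then have "frechet_derivative Y (at x) = ?D" by (rule frechet_derivative_at[symmetric])
  then show ?thesis by (simp add: coord_div_eq sum.distrib sum_distrib_left)
qed

lemma continuous_on_frechet_derivative_apply:
  fixes Z :: "real ^ 'm::finite \<Rightarrow> real ^ 'm" and f :: "real ^ 'm \<Rightarrow> real"
  assumes "open S" "Ck_on 1 f S" "continuous_on S Z"
  shows "continuous_on S (\<lambda>x. frechet_derivative f (at x) (Z x))"
proof -
  have "Ck_on 0 (\<lambda>x. frechet_derivative f (at x) (Z x)) S"
    by (rule Ck_on_linear_apply[OF assms(1)])
      (use assms(2,3) has_derivative_linear[OF Ck_on_Suc_has_derivative[OF assms(2)[unfolded One_nat_def] assms(1)]]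
        in \<open>auto simp: axis_in_Basis_iff\<close>)
  then show ?thesis by simp
qed

text \<open>
  Each product \<open>f Z\<^sub>i\<close>, extended by zero, is differentiable on the whole space, and the integral of its
  \<open>i\<close>-th partial derivative vanishes.
\<close>

lemma integral_by_parts_compact_support:
  fixes Z :: "real ^ 'm::finite \<Rightarrow> real ^ 'm" and f :: "real ^ 'm \<Rightarrow> real"
  assumes S: "open S" and f: "Ck_on 1 f S" and Z: "Ck_on 1 Z S"
    and K: "compact K" "K \<subseteq> S" "\<And>x. x \<in> S - K \<Longrightarrow> f x = 0"
  shows "(LINT x:S|lborel. frechet_derivative f (at x) (Z x)) = - (LINT x:S|lborel. f x * coord_div Z x)"
proof -
  have df: "(f has_derivative frechet_derivative f (at x)) (at x)" if "x \<in> S" for x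
    using Ck_on_Suc_has_derivative f S that by (metis One_nat_def)
  have dZ: "(Z has_derivative frechet_derivative Z (at x)) (at x)" if "x \<in> S" for x
    using Ck_on_Suc_has_derivative Z S that by (metis One_nat_def)
  (* F i is the i-th product and F' i x its derivative; testing membership in K instead of S makes both
     vanish off K by definition *)
  define F where "F i x = (if x \<in> K then f x * Z x $ i else 0)" for i x
  define F' where "F' i x y = (if x \<in> K then
    f x * frechet_derivative Z (at x) y $ i + frechet_derivative f (at x) y * Z x $ i else 0)" for i x y
  have opK: "open (- K)" using K(1) compact_imp_closed by blast
  have f'0: "frechet_derivative f (at x) y = 0" if "x \<in> S - K" for x y
  proof -
    have "(f has_derivative (\<lambda>_. 0)) (at x)"
      by (rule has_derivative_transform_within_open[OF has_derivative_const, where s = "S - K"])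
        (use that K S opK in \<open>auto simp: Diff_eq\<close>)
    then show ?thesis using frechet_derivative_at by metis
  qed
  have F'S: "F' i x y = f x * frechet_derivative Z (at x) y $ i + frechet_derivative f (at x) y * Z x $ i"
    if "x \<in> S" for i x y
    using f'0[of x] K(3)[of x] that by (auto simp: F'_def)
  have dF: "(F i has_derivative F' i x) (at x)" for i x
  proof (cases "x \<in> S")
    case True
    have "((\<lambda>x. f x * Z x $ i) has_derivative (\<lambda>y. f x * frechet_derivative Z (at x) y $ i +
        frechet_derivative f (at x) y * Z x $ i)) (at x)"
      by (intro has_derivative_mult df True bounded_linear.has_derivative[OF bounded_linear_vec_nth] dZ)
    then have "((\<lambda>x. f x * Z x $ i) has_derivative F' i x) (at x)"
      unfolding ext[of "F' i x", OF F'S[OF True]] .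
    then show ?thesis
      by (rule has_derivative_transform_within_open[OF _ S True]) (use K(3) in \<open>auto simp: F_def\<close>)
  next
    case False
    have "(F i has_derivative (\<lambda>_. 0)) (at x)"
      by (rule has_derivative_transform_within_open[OF has_derivative_const, where s = "- K"])
        (use False K opK in \<open>auto simp: F_def\<close>)
    moreover have "F' i x = (\<lambda>_. 0)" using False K(2) by (auto simp: F'_def fun_eq_iff)
    ultimately show ?thesis by simp
  qed
  have cS: "continuous_on S (\<lambda>x. F' i x (axis i 1))" for i
  proof -
    have "continuous_on S (\<lambda>x. f x * frechet_derivative Z (at x) (axis i 1) $ i +
        frechet_derivative f (at x) (axis i 1) * Z x $ i)"
      using f Z by (intro continuous_intros Ck_on_continuous[OF f] Ck_on_continuous[OF Z])
        (auto simp: axis_in_Basis_iff)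
    then show ?thesis by (rule continuous_on_eq) (simp add: F'S)
  qed
  have cont: "continuous_on UNIV (\<lambda>x. F' i x (axis i 1))" for i
  proof -
    have "continuous_on (- K) (\<lambda>x. F' i x (axis i 1))"
      by (rule continuous_on_eq[OF continuous_on_const[of _ 0]]) (auto simp: F'_def)
    with cS[of i] have "continuous_on (S \<union> - K) (\<lambda>x. F' i x (axis i 1))"
      by (intro continuous_on_open_Un S opK)
    moreover have "S \<union> - K = UNIV" using K(2) by auto
    ultimately show ?thesis by simp
  qed
  have "(\<integral>x. F' i x (axis i 1) \<partial>lborel) = 0" for i
    by (rule integral_directional_derivative_eq_0[OF K(1) _ dF cont]) (auto simp: F_def)
  then have *: "(LINT x:S|lborel. F' i x (axis i 1)) = 0" for i
  proof -
    have "(\<lambda>x. indicator S x *\<^sub>R F' i x (axis i 1)) = (\<lambda>x. F' i x (axis i 1))"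
      using K(2) by (auto simp: F'_def indicator_def fun_eq_iff)
    with \<open>(\<integral>x. F' i x (axis i 1) \<partial>lborel) = 0\<close> show ?thesis
      unfolding set_lebesgue_integral_def by simp
  qed
  have int: "set_integrable lborel S (\<lambda>x. F' i x (axis i 1))" for i
    by (rule integrable_continuous_compact_support[OF K(1,2) cS]) (auto simp: F'_def)
  have eq: "frechet_derivative f (at x) (Z x) + f x * coord_div Z x = (\<Sum>i\<in>UNIV. F' i x (axis i 1))"
    if "x \<in> S" for x
    using linear_expansion_axis[OF has_derivative_linear[OF df[OF that]], of "Z x"]
    by (simp add: F'S[OF that] coord_div_eq sum.distrib sum_distrib_left mult.commute)
  have i1: "set_integrable lborel S (\<lambda>x. frechet_derivative f (at x) (Z x))"
    by (rule integrable_continuous_compact_support[OF K(1,2)])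
      (use f'0 continuous_on_frechet_derivative_apply[OF S f Ck_on_continuous[OF Z]] in auto)
  have i2: "set_integrable lborel S (\<lambda>x. f x * coord_div Z x)"
    by (rule integrable_continuous_compact_support[OF K(1,2)])
      (use K(3) continuous_on_coord_div[OF S Z] Ck_on_continuous[OF f] in \<open>auto intro!: continuous_intros\<close>)
  have "(LINT x:S|lborel. frechet_derivative f (at x) (Z x)) + (LINT x:S|lborel. f x * coord_div Z x) =
    (LINT x:S|lborel. frechet_derivative f (at x) (Z x) + f x * coord_div Z x)"
    using i1 i2 by (simp add: set_integral_add)
  also have "\<dots> = (LINT x:S|lborel. (\<Sum>i\<in>UNIV. F' i x (axis i 1)))"
    by (rule set_lebesgue_integral_cong) (use S eq in auto)
  also have "\<dots> = (\<Sum>i\<in>UNIV. LINT x:S|lborel. F' i x (axis i 1))"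
    unfolding set_lebesgue_integral_def scaleR_sum_right
    by (rule Bochner_Integration.integral_sum) (use int in \<open>simp add: set_integrable_def\<close>)
  finally show ?thesis unfolding * by simp
qed

section \<open>Change of variables\<close>

text \<open>
  The theorem \<open>has_absolute_integral_change_of_variables\<close> is about well-ordered index types. Every
  finite index type has a well-ordered copy, in which an enumeration of the elements gives the order.
\<close>

typedef 'm enumerated = "UNIV :: 'm::finite set" by auto

definition index_of :: "'m::finite enumerated \<Rightarrow> nat" where
  "index_of = (SOME e. inj e)"

lemma inj_index_of: "inj (index_of :: 'm::finite enumerated \<Rightarrow> nat)"
proof -
  have "finite (UNIV :: 'm enumerated set)"
    by (rule finite_imageD[of Rep_enumerated]) (auto simp: inj_on_def Rep_enumerated_inject)
  then have "\<exists>e :: 'm enumerated \<Rightarrow> nat. inj e"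
    using finite_imp_inj_to_nat_seg by blast
  then show ?thesis unfolding index_of_def by (rule someI_ex)
qed

instantiation enumerated :: (finite) "{finite, wellorder}"
begin

definition "a \<le> b \<longleftrightarrow> index_of a \<le> index_of b" for a b :: "'a enumerated"
definition "a < b \<longleftrightarrow> index_of a < index_of b" for a b :: "'a enumerated"

instance
proof
  show "finite (UNIV :: 'a enumerated set)"
    by (rule finite_imageD[of Rep_enumerated]) (auto simp: inj_on_def Rep_enumerated_inject)
  show "a \<le> b \<Longrightarrow> b \<le> a \<Longrightarrow> a = b" for a b :: "'a enumerated"
    using inj_index_of by (auto simp: less_eq_enumerated_def dest: injD)
  show "P a" if "\<And>x. (\<And>y. y < x \<Longrightarrow> P y) \<Longrightarrow> P x" for P and a :: "'a enumerated"
    by (rule measure_induct_rule[of index_of]) (use that in \<open>auto simp: less_enumerated_def\<close>)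
qed (auto simp: less_eq_enumerated_def less_enumerated_def)

end

definition to_enumerated :: "real ^ 'm::finite \<Rightarrow> real ^ 'm enumerated" where
  "to_enumerated y = (\<chi> j. y $ Rep_enumerated j)"

definition from_enumerated :: "real ^ 'm enumerated \<Rightarrow> real ^ 'm::finite" where
  "from_enumerated x = (\<chi> i. x $ Abs_enumerated i)"

lemma to_from_enumerated [simp]: "to_enumerated (from_enumerated x) = x"
  and from_to_enumerated [simp]: "from_enumerated (to_enumerated y) = y"
  by (simp_all add: to_enumerated_def from_enumerated_def vec_eq_iff Rep_enumerated_inverse Abs_enumerated_inverse)

lemma linear_to_enumerated: "linear to_enumerated"
  and linear_from_enumerated: "linear from_enumerated"
  by (auto simp: linear_iff to_enumerated_def from_enumerated_def vec_eq_iff)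

lemma bij_Rep_enumerated: "bij (Rep_enumerated :: 'm::finite enumerated \<Rightarrow> 'm)"
  by (auto intro!: bijI simp: inj_on_def Rep_enumerated_inject) (metis Abs_enumerated_inverse UNIV_I surjI)

lemma prod_Basis_vec:
  fixes x :: "real ^ 'm::finite"
  shows "(\<Prod>b\<in>Basis. x \<bullet> b) = (\<Prod>i\<in>UNIV. x $ i)"
proof -
  have "(\<Prod>b\<in>Basis. x \<bullet> b) = (\<Prod>b\<in>(\<lambda>i. axis i 1 :: real ^ 'm) ` UNIV. x \<bullet> b)"
    by (rule prod.cong) (auto simp: Basis_vec_def)
  also have "\<dots> = (\<Prod>i\<in>UNIV. x $ i)"
    by (subst prod.reindex) (auto simp: inj_on_def axis_eq_axis inner_axis)
  finally show ?thesis .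
qed

lemma lborel_distr_from_enumerated:
  "lborel = distr lborel borel (from_enumerated :: real ^ 'm enumerated \<Rightarrow> real ^ 'm::finite)"
proof (rule lborel_eqI)
  let ?L = "from_enumerated :: real ^ 'm enumerated \<Rightarrow> real ^ 'm"
  have meas: "?L \<in> borel_measurable borel"
    by (intro borel_measurable_continuous_onI linear_continuous_on)
      (use linear_conv_bounded_linear linear_from_enumerated in blast)
  fix l u :: "real ^ 'm" assume le: "\<And>b. b \<in> Basis \<Longrightarrow> l \<bullet> b \<le> u \<bullet> b"
  then have le': "l $ i \<le> u $ i" for i using le[of "axis i 1"] by (simp add: axis_in_Basis_iff inner_axis)
  have box: "?L -` box l u = box (to_enumerated l) (to_enumerated u)"
    by (auto simp: mem_box_cart from_enumerated_def to_enumerated_def)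
      (metis Rep_enumerated_inverse Abs_enumerated_inverse UNIV_I)+
  have "emeasure (distr lborel borel ?L) (box l u) = emeasure lborel (box (to_enumerated l) (to_enumerated u))"
    using meas by (simp add: emeasure_distr box)
  also have "\<dots> = (\<Prod>b\<in>Basis. (to_enumerated u - to_enumerated l) \<bullet> b)"
    by (rule emeasure_lborel_box) (auto simp: Basis_vec_def inner_axis to_enumerated_def le')
  also have "(\<Prod>b\<in>Basis. (to_enumerated u - to_enumerated l) \<bullet> b) = (\<Prod>j\<in>UNIV. (to_enumerated u - to_enumerated l) $ j)"
    by (rule prod_Basis_vec)
  also have "\<dots> = (\<Prod>i\<in>UNIV. (u - l) $ i)"
    using prod.reindex_bij_betw[OF bij_Rep_enumerated, of "\<lambda>i. (u - l) $ i"] by (simp add: to_enumerated_def)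
  also have "\<dots> = (\<Prod>b\<in>Basis. (u - l) \<bullet> b)"
    by (rule prod_Basis_vec[symmetric])
  finally show "emeasure (distr lborel borel ?L) (box l u) = (\<Prod>b\<in>Basis. (u - l) \<bullet> b)" .
qed simp

text \<open>
  Conjugation with \<open>e\<close> matches the permutations of the two index types and preserves their signs.
\<close>

lemma det_reindex:
  fixes A :: "real ^ 'm ^ 'm::finite" and e :: "'k::finite \<Rightarrow> 'm"
  assumes "bij e"
  shows "det (\<chi> i j. A $ e i $ e j :: real ^ 'k ^ 'k) = det A"
proof -
  let ?f = "map_permutation UNIV e"
  have f: "?f p = e \<circ> p \<circ> inv e" for p
    using assms by (simp add: map_permutation_def restrict_id_def bij_is_surj fun_eq_iff)
  have "det (\<chi> i j. A $ e i $ e j :: real ^ 'k ^ 'k) =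
    (\<Sum>p | p permutes UNIV. of_int (sign (?f p)) * (\<Prod>i\<in>UNIV. A $ i $ ?f p i))"
    unfolding det_def
  proof (rule sum.cong[OF refl])
    fix p :: "'k \<Rightarrow> 'k" assume "p \<in> {p. p permutes UNIV}"
    then have "sign (?f p) = sign p"
      using assms by (intro sign_map_permutation) (auto simp: bij_is_inj)
    moreover have "(\<Prod>i\<in>UNIV. A $ i $ ?f p i) = (\<Prod>i\<in>UNIV. A $ e i $ e (p i))"
      using prod.reindex_bij_betw[OF assms, of "\<lambda>i. A $ i $ ?f p i"] assms by (simp add: f bij_is_inj)
    ultimately show "of_int (sign p) * (\<Prod>i\<in>UNIV. (\<chi> i j. A $ e i $ e j :: real ^ 'k ^ 'k) $ i $ p i) =
        of_int (sign (?f p)) * (\<Prod>i\<in>UNIV. A $ i $ ?f p i)"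
      by simp
  qed
  also have "\<dots> = det A"
    unfolding det_def
  proof (rule sum.reindex_bij_betw)
    have "?f = (\<lambda>\<pi> x. if x \<in> UNIV then e (\<pi> (inv_into UNIV e x)) else x)"
      by (simp add: fun_eq_iff f)
    then show "bij_betw ?f {p. p permutes UNIV} {p. p permutes UNIV}"
      using bij_betw_permutations[OF assms] by simp
  qed
  finally show ?thesis .
qed

lemma change_of_variables_wellorder:
  fixes T :: "real ^ 'm::{finite, wellorder} \<Rightarrow> real ^ 'm::_" and f :: "real ^ 'm::_ \<Rightarrow> real"
  assumes S: "S \<in> sets borel"
    and dT: "\<And>x. x \<in> S \<Longrightarrow> (T has_derivative T' x) (at x within S)" and inj: "inj_on T S"
    and f: "set_integrable lborel (T ` S) f"
    and m: "(\<lambda>x. indicator S x *\<^sub>R (\<bar>det (matrix (T' x))\<bar> * f (T x))) \<in> borel_measurable borel"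
  shows "set_integrable lborel S (\<lambda>x. \<bar>det (matrix (T' x))\<bar> * f (T x))"
    and "(LINT x:S|lborel. \<bar>det (matrix (T' x))\<bar> * f (T x)) = (LINT y:T ` S|lborel. f y)"
proof -
  let ?g = "\<lambda>x. \<bar>det (matrix (T' x))\<bar> * f (T x)"
  \<comment> \<open>the general theorem concerns functions with values in \<open>real ^ 'n\<close>\<close>
  have vec_integral: "integral U (\<lambda>x. vec (h x) :: real ^ 1) = vec (integral U h)"
    if "h absolutely_integrable_on U" for U and h :: "real ^ 'm::_ \<Rightarrow> real"
  proof -
    have "linear (vec :: real \<Rightarrow> real ^ 1)" by (simp add: linear_iff vec_eq_iff)
    then show ?thesis
      using integral_linear[OF set_lebesgue_integral_eq_integral(1)[OF that], of "vec :: real \<Rightarrow> real ^ 1"]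
      by (simp add: o_def linear_conv_bounded_linear)
  qed
  have vec_integrable: "(\<lambda>x. vec (h x) :: real ^ 1) absolutely_integrable_on U \<longleftrightarrow> h absolutely_integrable_on U"
    for U and h :: "real ^ 'm::_ \<Rightarrow> real"
    by (subst absolutely_integrable_componentwise_iff) (simp add: Basis_vec_def inner_axis)
  have fm: "(\<lambda>x. indicator (T ` S) x *\<^sub>R f x) \<in> borel_measurable lborel"
    using f by (auto simp: set_integrable_def)
  have fL: "f absolutely_integrable_on T ` S"
    using f fm by (simp add: set_integrable_def integrable_completion)
  have "(\<lambda>x. \<bar>det (matrix (T' x))\<bar> *\<^sub>R (vec (f (T x)) :: real ^ 1)) absolutely_integrable_on S \<and>
      integral S (\<lambda>x. \<bar>det (matrix (T' x))\<bar> *\<^sub>R (vec (f (T x)) :: real ^ 1)) = integral (T ` S) (\<lambda>x. vec (f x))"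
    using has_absolute_integral_change_of_variables[OF _ dT inj, of "\<lambda>x. vec (f x) :: real ^ 1"] S fL
    by (simp add: vec_integrable)
  moreover have "(\<lambda>x. \<bar>det (matrix (T' x))\<bar> *\<^sub>R (vec (f (T x)) :: real ^ 1)) = (\<lambda>x. vec (?g x))"
    by (simp add: fun_eq_iff vec_eq_iff)
  ultimately have *: "?g absolutely_integrable_on S" "integral S ?g = integral (T ` S) f"
    by (auto simp: vec_integrable vec_integral fL vec_eq_iff)
  then show "set_integrable lborel S ?g"
    using m by (simp add: set_integrable_def integrable_completion)
  have "(LINT x:S|lborel. ?g x) = (LINT x:S|lebesgue. ?g x)"
    using m unfolding set_lebesgue_integral_def by (subst integral_completion) auto
  also have "\<dots> = integral S ?g" using *(1) by (rule set_lebesgue_integral_eq_integral)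
  also have "\<dots> = (LINT x:T ` S|lebesgue. f x)"
    unfolding *(2) by (rule set_lebesgue_integral_eq_integral(2)[OF fL, symmetric])
  also have "\<dots> = (LINT x:T ` S|lborel. f x)"
    using fm unfolding set_lebesgue_integral_def by (subst integral_completion) auto
  finally show "(LINT x:S|lborel. ?g x) = (LINT y:T ` S|lborel. f y)" .
qed

lemma set_integrable_from_enumerated:
  fixes f :: "real ^ 'm::finite \<Rightarrow> real"
  assumes "(\<lambda>x. indicator S x *\<^sub>R f x) \<in> borel_measurable borel"
  shows "set_integrable lborel S f \<longleftrightarrow> set_integrable lborel (to_enumerated ` S) (\<lambda>x. f (from_enumerated x))"
    and "(LINT x:S|lborel. f x) = (LINT x:to_enumerated ` S|lborel. f (from_enumerated x))"
proof -
  have meas: "(from_enumerated :: real ^ 'm enumerated \<Rightarrow> real ^ 'm) \<in> borel_measurable borel"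
    by (intro borel_measurable_continuous_onI linear_continuous_on)
      (use linear_conv_bounded_linear linear_from_enumerated in blast)
  have ind: "indicator S (from_enumerated x) = (indicator (to_enumerated ` S) x :: real)" for x
    by (auto simp: indicator_def image_iff)
  show "set_integrable lborel S f \<longleftrightarrow> set_integrable lborel (to_enumerated ` S) (\<lambda>x. f (from_enumerated x))"
    unfolding set_integrable_def ind[symmetric]
    by (subst lborel_distr_from_enumerated, subst integrable_distr_eq) (use meas assms in auto)
  show "(LINT x:S|lborel. f x) = (LINT x:to_enumerated ` S|lborel. f (from_enumerated x))"
    unfolding set_lebesgue_integral_def ind[symmetric]
    by (subst lborel_distr_from_enumerated, subst integral_distr) (use meas assms in auto)
qed

text \<open>
  Renaming the coordinates preserves the Lebesgue measure and the Jacobian determinant, so the case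
  of a well-ordered index type carries over.
\<close>

theorem change_of_variables:
  fixes T :: "real ^ 'm::finite \<Rightarrow> real ^ 'm" and f :: "real ^ 'm \<Rightarrow> real"
  assumes S: "S \<in> sets borel"
    and dT: "\<And>x. x \<in> S \<Longrightarrow> (T has_derivative T' x) (at x)" and inj: "inj_on T S"
    and f: "set_integrable lborel (T ` S) f"
    and m: "(\<lambda>x. indicator S x *\<^sub>R (\<bar>det (matrix (T' x))\<bar> * f (T x))) \<in> borel_measurable borel"
  shows "set_integrable lborel S (\<lambda>x. \<bar>det (matrix (T' x))\<bar> * f (T x))"
    and "(LINT x:S|lborel. \<bar>det (matrix (T' x))\<bar> * f (T x)) = (LINT y:T ` S|lborel. f y)"
proof -
  let ?S = "to_enumerated ` S" and ?T = "\<lambda>x. to_enumerated (T (from_enumerated x))"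
  let ?T' = "\<lambda>x y. to_enumerated (T' (from_enumerated x) (from_enumerated y))"
  let ?f = "\<lambda>x. f (from_enumerated x)"
  have bl: "bounded_linear (to_enumerated :: real ^ 'm \<Rightarrow> _)" "bounded_linear (from_enumerated :: _ \<Rightarrow> real ^ 'm)"
    using linear_conv_bounded_linear linear_from_enumerated linear_to_enumerated by blast+
  have meas: "(from_enumerated :: real ^ 'm enumerated \<Rightarrow> real ^ 'm) \<in> borel_measurable borel"
    by (intro borel_measurable_continuous_onI linear_continuous_on bl)
  have vimage: "?S = from_enumerated -` S"
    by (force simp: image_iff)
  have S': "?S \<in> sets borel"
    unfolding vimage using measurable_sets_borel[OF meas S] .
  have TS: "?T ` ?S = to_enumerated ` T ` S"
    by (auto simp: image_iff)
  have det_eq: "det (matrix (?T' x)) = det (matrix (T' (from_enumerated x)))" if "x \<in> ?S" for x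
  proof -
    have "from_enumerated (axis j 1) = (axis (Rep_enumerated j) 1 :: real ^ 'm)" for j
      by (auto simp: from_enumerated_def vec_eq_iff axis_def Abs_enumerated_inverse Rep_enumerated_inverse)
    then have "matrix (?T' x) = (\<chi> i j. matrix (T' (from_enumerated x)) $ Rep_enumerated i $ Rep_enumerated j)"
      by (simp only: matrix_def to_enumerated_def vec_lambda_beta)
    then show ?thesis by (simp only: det_reindex[OF bij_Rep_enumerated])
  qed
  have dT': "(?T has_derivative ?T' x) (at x within ?S)" if "x \<in> ?S" for x
  proof (rule has_derivative_at_withinI, rule bounded_linear.has_derivative[OF bl(1)])
    have "from_enumerated x \<in> S" using that by auto
    from has_derivative_compose[OF bounded_linear.has_derivative[OF bl(2) has_derivative_ident] dT[OF this]]
    show "((\<lambda>x. T (from_enumerated x)) has_derivative (\<lambda>y. T' (from_enumerated x) (from_enumerated y))) (at x)" .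
  qed
  have inj': "inj_on ?T ?S"
    using inj by (auto simp: inj_on_def) (metis from_to_enumerated)
  have fm: "(\<lambda>x. indicator (T ` S) x *\<^sub>R f x) \<in> borel_measurable borel"
    using f borel_measurable_integrable unfolding set_integrable_def by fastforce
  have f': "set_integrable lborel (?T ` ?S) ?f"
    unfolding TS using f set_integrable_from_enumerated(1)[OF fm] by simp
  have ind: "(indicator ?S x :: real) = indicator S (from_enumerated x)" for x
    by (simp add: vimage indicator_def)
  have m': "(\<lambda>x. indicator ?S x *\<^sub>R (\<bar>det (matrix (?T' x))\<bar> * ?f (?T x))) \<in> borel_measurable borel"
  proof -
    have "(\<lambda>x. indicator ?S x *\<^sub>R (\<bar>det (matrix (?T' x))\<bar> * ?f (?T x))) =
        (\<lambda>x. indicator S x *\<^sub>R (\<bar>det (matrix (T' x))\<bar> * f (T x))) \<circ> from_enumerated"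
      using det_eq by (auto simp: fun_eq_iff ind vimage indicator_def)
    then show ?thesis using measurable_comp[OF meas m] by simp
  qed
  note cov = change_of_variables_wellorder[OF S' dT' inj' f' m']
  have eq: "indicator ?S x *\<^sub>R (\<bar>det (matrix (?T' x))\<bar> * ?f (?T x)) =
      indicator ?S x *\<^sub>R (\<bar>det (matrix (T' (from_enumerated x)))\<bar> * f (T (from_enumerated x)))" for x
    using det_eq[of x] by (auto simp: indicator_def)
  show "set_integrable lborel S (\<lambda>x. \<bar>det (matrix (T' x))\<bar> * f (T x))"
    unfolding set_integrable_from_enumerated(1)[OF m] using cov(1) unfolding set_integrable_def eq by simp
  show "(LINT x:S|lborel. \<bar>det (matrix (T' x))\<bar> * f (T x)) = (LINT y:T ` S|lborel. f y)"
    unfolding set_integrable_from_enumerated(2)[OF m] set_integrable_from_enumerated(2)[OF fm]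
    using cov(2) unfolding TS set_lebesgue_integral_def eq by simp
qed

section \<open>Charts and smooth functions on a compact manifold\<close>

abbreviation jacobian :: "('a, 'm::finite) chart \<Rightarrow> ('a, 'm) chart \<Rightarrow> 'a \<Rightarrow> real ^ 'm \<Rightarrow> real ^ 'm" where
  "jacobian c d p \<equiv> frechet_derivative (transition c d) (at (chart_map c p))"

locale compact_manifold =
  fixes M :: "'a::t2_space set" and A :: "('a, 'm::finite) chart set"
  assumes compact_M: "compact M" and smooth_atlas: "smooth_atlas M A"
begin

lemma M_eq: "M = (\<Union>c\<in>A. chart_dom c)"
  using smooth_atlas by (simp add: smooth_atlas_def)

lemma chart_dom_subset: "c \<in> A \<Longrightarrow> chart_dom c \<subseteq> M"
  using M_eq by auto

lemma ex_chart: assumes "p \<in> M" obtains c where "c \<in> A" "p \<in> chart_dom c"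
  using assms M_eq by auto

lemma chart:
  assumes "c \<in> A"
  shows openin_chart_dom: "openin (top_of_set M) (chart_dom c)"
    and open_chart_image: "open (chart_image c)"
    and homeomorphism_chart: "homeomorphism (chart_dom c) (chart_image c) (chart_map c) (chart_inv c)"
  using assms smooth_atlas by (auto simp: smooth_atlas_def is_chart_def)

lemma chart_inv_chart_map [simp]: "c \<in> A \<Longrightarrow> p \<in> chart_dom c \<Longrightarrow> chart_inv c (chart_map c p) = p"
  using homeomorphism_chart by (metis homeomorphism_def)

lemma chart_map_chart_inv [simp]: "c \<in> A \<Longrightarrow> x \<in> chart_image c \<Longrightarrow> chart_map c (chart_inv c x) = x"
  using homeomorphism_chart by (metis homeomorphism_def)

lemma chart_inv_in_dom [simp]: "c \<in> A \<Longrightarrow> x \<in> chart_image c \<Longrightarrow> chart_inv c x \<in> chart_dom c"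
  by auto

lemma chart_inv_in_M: "c \<in> A \<Longrightarrow> x \<in> chart_image c \<Longrightarrow> chart_inv c x \<in> M"
  using chart_dom_subset chart_inv_in_dom by blast

lemma continuous_on_chart_map: "c \<in> A \<Longrightarrow> continuous_on (chart_dom c) (chart_map c)"
  and continuous_on_chart_inv: "c \<in> A \<Longrightarrow> continuous_on (chart_image c) (chart_inv c)"
  using homeomorphism_chart by (auto simp: homeomorphism_def)

lemma inj_on_chart_map: "c \<in> A \<Longrightarrow> inj_on (chart_map c) (chart_dom c)"
  by (metis chart_inv_chart_map inj_onI)

lemma open_chart_map_image:
  assumes "c \<in> A" "openin (top_of_set M) W" "W \<subseteq> chart_dom c"
  shows "open (chart_map c ` W)"
proof -
  have "openin (top_of_set (chart_dom c)) W"
    using assms chart_dom_subset openin_subset_trans by metis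
  then have "openin (top_of_set (chart_image c)) (chart_map c ` W)"
    using homeomorphism_imp_open_map[OF homeomorphism_chart[OF assms(1)]] by blast
  then show ?thesis using open_chart_image[OF assms(1)] openin_open_eq by blast
qed

lemma openin_overlap: "c \<in> A \<Longrightarrow> d \<in> A \<Longrightarrow> openin (top_of_set M) (chart_dom c \<inter> chart_dom d)"
  by (intro openin_Int openin_chart_dom)

lemma open_overlap_image:
  "c \<in> A \<Longrightarrow> d \<in> A \<Longrightarrow> open (chart_map c ` (chart_dom c \<inter> chart_dom d))"
  by (rule open_chart_map_image) (auto intro: openin_overlap)

lemma openin_Diff_compact: "compact K \<Longrightarrow> openin (top_of_set M) (M - K)"
  by (metis Diff_Int_distrib Diff_eq compact_imp_closed inf.idem open_Compl openin_open)

lemma continuous_on_openin_cover: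
  assumes "\<And>p. p \<in> M \<Longrightarrow> \<exists>W. openin (top_of_set M) W \<and> p \<in> W \<and> continuous_on W f"
  shows "continuous_on M f"
  unfolding continuous_on_eq_continuous_within
proof
  fix p assume "p \<in> M"
  with assms obtain U where U: "open U" "p \<in> U" "continuous_on (M \<inter> U) f"
    by (metis IntD2 openin_open)
  then have "continuous (at p within M \<inter> U) f"
    using \<open>p \<in> M\<close> by (simp add: continuous_on_eq_continuous_within)
  moreover have "at p within M \<inter> U = at p within M"
    by (rule at_within_nhd[OF U(2,1)]) auto
  ultimately show "continuous (at p within M) f" by simp
qed

lemma continuous_on_M:
  assumes "\<And>c. c \<in> A \<Longrightarrow> continuous_on (chart_dom c) f"
  shows "continuous_on M f"
  using ex_chart openin_chart_dom assms by (intro continuous_on_openin_cover) metis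

lemma continuous_on_chart_dom_iff:
  assumes "c \<in> A"
  shows "continuous_on (chart_dom c) f \<longleftrightarrow> continuous_on (chart_image c) (\<lambda>x. f (chart_inv c x))"
proof
  assume "continuous_on (chart_image c) (\<lambda>x. f (chart_inv c x))"
  from continuous_on_compose2[OF this continuous_on_chart_map[OF assms] subset_refl]
  show "continuous_on (chart_dom c) f" by (rule continuous_on_eq) (use assms in simp)
next
  assume "continuous_on (chart_dom c) f"
  then show "continuous_on (chart_image c) (\<lambda>x. f (chart_inv c x))"
    by (rule continuous_on_compose2[OF _ continuous_on_chart_inv[OF assms]]) (use assms in auto)
qed

text \<open>
  The sets \<open>W\<close> and \<open>M - K\<close> are open in \<open>M\<close> and cover it, and continuity is a local property.
\<close>

lemma continuous_on_extend_by_0: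
  fixes f :: "'a \<Rightarrow> real"
  assumes "compact K" "K \<subseteq> W" "openin (top_of_set M) W" "continuous_on W f" "\<And>q. q \<in> M - K \<Longrightarrow> f q = 0"
  shows "continuous_on M f"
proof -
  have "continuous_on (M - K) f"
    by (rule continuous_on_eq[OF continuous_on_const[of _ 0]]) (use assms in auto)
  with assms(2-4) openin_Diff_compact[OF assms(1)] show ?thesis
    by (intro continuous_on_openin_cover) (metis DiffI subsetD)
qed

subsection \<open>Transition maps\<close>

lemma smooth_transition:
  "c \<in> A \<Longrightarrow> d \<in> A \<Longrightarrow> Ck_on k (transition c d) (chart_map c ` (chart_dom c \<inter> chart_dom d))"
  using smooth_atlas by (auto simp: smooth_atlas_def smooth_on_def)

lemma transition_chart_map [simp]:
  "c \<in> A \<Longrightarrow> p \<in> chart_dom c \<Longrightarrow> transition c d (chart_map c p) = chart_map d p"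
  by (simp add: transition_def)

lemma transition_has_derivative:
  assumes "c \<in> A" "d \<in> A" "p \<in> chart_dom c" "p \<in> chart_dom d"
  shows "(transition c d has_derivative jacobian c d p) (at (chart_map c p))"
  using Ck_on_Suc_has_derivative[OF smooth_transition[OF assms(1,2), of "Suc 0"] open_overlap_image[OF assms(1,2)]] assms
  by auto

lemma linear_jacobian:
  "c \<in> A \<Longrightarrow> d \<in> A \<Longrightarrow> p \<in> chart_dom c \<Longrightarrow> p \<in> chart_dom d \<Longrightarrow> linear (jacobian c d p)"
  using transition_has_derivative has_derivative_linear by blast

lemma has_derivative_change_chart:
  assumes "c \<in> A" "d \<in> A" "p \<in> chart_dom c" "p \<in> chart_dom d"
    and "(f \<circ> chart_inv d has_derivative D) (at (chart_map d p))"
  shows "(f \<circ> chart_inv c has_derivative (\<lambda>a. D (jacobian c d p a))) (at (chart_map c p))"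
proof -
  have "(f \<circ> chart_inv d has_derivative D) (at (transition c d (chart_map c p)))"
    using assms by simp
  from has_derivative_compose[OF transition_has_derivative[OF assms(1-4)] this]
  show ?thesis
    by (rule has_derivative_transform_within_open[OF _ open_overlap_image[OF assms(1,2)]])
      (use assms in \<open>auto simp: transition_def\<close>)
qed

text \<open>
  The function \<open>chart_map c\<close>, read in the chart \<open>c\<close>, is the identity; read in the chart \<open>d\<close>, it is the
  transition map back to \<open>c\<close>.
\<close>

lemma jacobian_inverse:
  assumes "c \<in> A" "d \<in> A" "p \<in> chart_dom c" "p \<in> chart_dom d"
  shows "jacobian d c p (jacobian c d p a) = a"
proof -
  have "(chart_map c \<circ> chart_inv c has_derivative (\<lambda>a. jacobian d c p (jacobian c d p a))) (at (chart_map c p))"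
    using transition_has_derivative[OF assms(2,1,4,3)] unfolding transition_def[of d c]
    by (rule has_derivative_change_chart[OF assms])
  moreover have "(chart_map c \<circ> chart_inv c has_derivative (\<lambda>a. a)) (at (chart_map c p))"
    by (rule has_derivative_transform_within_open[OF has_derivative_ident open_chart_image[OF assms(1)]])
      (use assms in auto)
  ultimately show ?thesis using has_derivative_unique by metis
qed

subsection \<open>Differentials and bump functions\<close>

lemma differential_has_derivative:
  assumes "c \<in> A" "p \<in> chart_dom c" "Ck_on (Suc k) (f \<circ> chart_inv c) (chart_image c)"
  shows "(f \<circ> chart_inv c has_derivative differential f c p) (at (chart_map c p))"
  unfolding differential_def
  using Ck_on_Suc_has_derivative[OF assms(3) open_chart_image[OF assms(1)]] assms(2) by auto

lemma differential_change_chart: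
  assumes "c \<in> A" "d \<in> A" "p \<in> chart_dom c" "p \<in> chart_dom d"
    and "Ck_on (Suc k) (f \<circ> chart_inv d) (chart_image d)"
  shows "differential f c p a = differential f d p (jacobian c d p a)"
  using has_derivative_change_chart[OF assms(1-4) differential_has_derivative[OF assms(2,4,5)]]
    frechet_derivative_at unfolding differential_def by metis

lemma differential_eq_0:
  fixes f :: "'a \<Rightarrow> 'f::real_normed_vector"
  assumes "c \<in> A" "p \<in> chart_dom c" "compact K" "p \<notin> K" "\<And>q. q \<in> M - K \<Longrightarrow> f q = 0"
  shows "differential f c p a = 0"
proof -
  have op: "open (chart_map c ` (chart_dom c \<inter> (M - K)))"
    using assms by (intro open_chart_map_image openin_Int openin_Diff_compact openin_chart_dom) auto
  have "(f \<circ> chart_inv c has_derivative (\<lambda>_. 0)) (at (chart_map c p))"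
    by (rule has_derivative_transform_within_open[OF has_derivative_const op])
      (use assms chart_dom_subset[OF assms(1)] in auto)
  then show ?thesis
    unfolding differential_def using frechet_derivative_at by metis
qed

text \<open>
  With \<open>a\<close> the coordinates of \<open>p\<close>, the bump is \<open>flat 0 (r\<^sup>2 - |x - a|\<^sup>2)\<close> in the chart \<open>c\<close>. In another
  chart it is the same expression with a smooth transition map in place of \<open>x\<close>, or zero away from the
  support.
\<close>

lemma smooth_bump:
  assumes c: "c \<in> A" and W: "openin (top_of_set M) W" "W \<subseteq> chart_dom c" and p: "p \<in> W"
  obtains \<beta> :: "'a \<Rightarrow> real" and K where "smooth_map A \<beta>" "\<And>q. \<beta> q \<ge> 0" "\<beta> p > 0"
    "compact K" "K \<subseteq> W" "\<And>q. q \<in> M - K \<Longrightarrow> \<beta> q = 0"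
proof -
  let ?a = "chart_map c p"
  obtain r where r: "r > 0" "cball ?a r \<subseteq> chart_map c ` W"
    using open_chart_map_image[OF c W] p open_contains_cball by blast
  have cball_sub: "cball ?a r \<subseteq> chart_image c" using r(2) W(2) by auto
  define K where "K = chart_inv c ` cball ?a r"
  define Q where "Q x = r\<^sup>2 - (x - ?a) \<bullet> (x - ?a)" for x
  define \<beta> where "\<beta> q = (if q \<in> chart_dom c then flat 0 (Q (chart_map c q)) else 0)" for q
  have K: "compact K" unfolding K_def
    by (intro compact_continuous_image continuous_on_subset[OF continuous_on_chart_inv[OF c] cball_sub] compact_cball)
  have KW: "K \<subseteq> W"
  proof
    fix q assume "q \<in> K"
    then obtain x where "x \<in> cball ?a r" "q = chart_inv c x" by (auto simp: K_def)
    with r(2) obtain q' where "q' \<in> W" "x = chart_map c q'" by blast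
    with \<open>q = chart_inv c x\<close> c W(2) show "q \<in> W" by (metis chart_inv_chart_map subsetD)
  qed
  have Q: "Q x > 0 \<longleftrightarrow> x \<in> ball ?a r" for x
    using r(1) by (simp add: Q_def dist_norm norm_minus_commute flip: power2_norm_eq_inner)
      (metis abs_le_square_iff abs_norm_cancel abs_of_pos not_le)
  have zero: "\<beta> q = 0" if "q \<notin> K" for q
  proof (rule ccontr)
    assume "\<beta> q \<noteq> 0"
    then have q: "q \<in> chart_dom c" "flat 0 (Q (chart_map c q)) \<noteq> 0" by (auto simp: \<beta>_def split: if_splits)
    then have "chart_map c q \<in> cball ?a r"
      using flat_pos_iff flat_nonneg Q by (metis antisym_conv2 ball_subset_cball subsetD)
    with q(1) c have "q \<in> K" unfolding K_def by (metis chart_inv_chart_map imageI)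
    with that show False by simp
  qed
  have "Ck_on k (\<beta> \<circ> chart_inv d) (chart_image d)" if d: "d \<in> A" for d k
  proof -
    let ?U = "chart_map d ` (chart_dom d \<inter> chart_dom c)" and ?V = "chart_map d ` (chart_dom d \<inter> (M - K))"
    have opU: "open ?U" by (rule open_overlap_image[OF d c])
    have opV: "open ?V"
      using d K by (intro open_chart_map_image openin_Int openin_Diff_compact openin_chart_dom) auto
    have "Ck_on k (\<lambda>x. flat 0 (Q (transition d c x))) ?U"
      unfolding Q_def
      by (intro Ck_on_flat Ck_on_diff Ck_on_inner Ck_on_const smooth_transition opU d c)
    then have "Ck_on k (\<beta> \<circ> chart_inv d) ?U"
      by (rule Ck_on_cong[OF opU, THEN iffD1, rotated]) (use d in \<open>auto simp: \<beta>_def\<close>)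
    moreover have "Ck_on k (\<beta> \<circ> chart_inv d) ?V"
      by (rule Ck_on_cong[OF opV, THEN iffD1, rotated, OF Ck_on_const[of _ 0]]) (use d zero in auto)
    moreover have "chart_dom d \<inter> chart_dom c \<union> chart_dom d \<inter> (M - K) = chart_dom d"
      using chart_dom_subset[OF d] KW W(2) by auto
    then have "?U \<union> ?V = chart_image d" by (metis image_Un)
    ultimately show ?thesis using Ck_on_Un[OF opU opV] by metis
  qed
  then have "smooth_map A \<beta>" by (simp add: smooth_map_def Ck_map_def)
  moreover have "\<beta> p > 0" using p W(2) r(1) Q[of ?a] by (auto simp: \<beta>_def flat_pos_iff)
  moreover have "\<beta> q \<ge> 0" for q by (simp add: \<beta>_def flat_nonneg)
  ultimately show ?thesis using that K KW zero by blast
qed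

end

lemma vector_field_C1:
  "vector_field 1 A X \<Longrightarrow> c \<in> A \<Longrightarrow> Ck_on 1 (\<lambda>x. X c (chart_inv c x)) (chart_image c)"
  unfolding vector_field_def o_def by blast

section \<open>Riemannian metrics and their densities\<close>

text \<open>
  The coefficients are required to be of class \<open>C\<^sup>1\<close> because a metric induced by a \<open>C\<^sup>2\<close> embedding has
  no better regularity in general.
\<close>

definition C1_metric :: "('a, 'm::finite) chart set \<Rightarrow> ('a, 'm) bilin_field \<Rightarrow> bool" where
  "C1_metric A h \<longleftrightarrow>
     (\<forall>c\<in>A. \<forall>p\<in>chart_dom c. is_inner_product (h c p)) \<and>
     (\<forall>c\<in>A. \<forall>d\<in>A. \<forall>p\<in>chart_dom c \<inter> chart_dom d. \<forall>a b.
        h c p a b = h d p (jacobian c d p a) (jacobian c d p b)) \<and>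
     (\<forall>c\<in>A. \<forall>a b. Ck_on 1 (\<lambda>x. h c (chart_inv c x) a b) (chart_image c))"

text \<open>
  The coefficient of the volume form with respect to the coordinates of a chart.
\<close>

definition metric_density :: "('a, 'm::finite) bilin_field \<Rightarrow> ('a, 'm) chart \<Rightarrow> 'a \<Rightarrow> real" where
  "metric_density h c p = sqrt (det (gram h c p))"

lemma volume_form_eq_metric_density: "volume_form h c p U = metric_density h c p * det U"
  by (simp add: volume_form_def metric_density_def)

lemma bilinear_eq_inner_gram:
  assumes "bilinear (h c p)"
  shows "h c p a b = a \<bullet> (gram h c p *v b)"
proof -
  have "h c p a b = (\<Sum>i\<in>UNIV. a $ i * h c p (axis i 1) b)"
    using linear_expansion_axis[of "\<lambda>a. h c p a b" a] assms by (simp add: bilinear_def)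
  also have "\<dots> = (\<Sum>i\<in>UNIV. a $ i * (\<Sum>j\<in>UNIV. b $ j * h c p (axis i 1) (axis j 1)))"
    using linear_expansion_axis[of "h c p (axis _ 1)" b] assms by (simp add: bilinear_def)
  also have "\<dots> = a \<bullet> (gram h c p *v b)"
    by (simp add: inner_vec_def gram_def matrix_vector_mult_def mult.commute)
  finally show ?thesis .
qed

locale riemannian = compact_manifold M A
  for M :: "'a::t2_space set" and A :: "('a, 'm::finite) chart set" +
  fixes h :: "('a, 'm) bilin_field"
  assumes C1_metric: "C1_metric A h"
begin

lemma is_inner_product_metric: "c \<in> A \<Longrightarrow> p \<in> chart_dom c \<Longrightarrow> is_inner_product (h c p)"
  using C1_metric unfolding C1_metric_def by blast

lemma metric_eq_gram: "c \<in> A \<Longrightarrow> p \<in> chart_dom c \<Longrightarrow> h c p a b = a \<bullet> (gram h c p *v b)"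
  using is_inner_product_metric unfolding is_inner_product_def by (intro bilinear_eq_inner_gram) blast

lemma det_gram_pos:
  assumes "c \<in> A" "p \<in> chart_dom c"
  shows "det (gram h c p) > 0"
proof (rule det_pos_definite)
  fix a :: "real ^ 'm" assume "a \<noteq> 0"
  then show "0 < a \<bullet> (gram h c p *v a)"
    using is_inner_product_metric[OF assms] metric_eq_gram[OF assms, of a a]
    unfolding is_inner_product_def by metis
qed

lemma metric_density_pos: "c \<in> A \<Longrightarrow> p \<in> chart_dom c \<Longrightarrow> metric_density h c p > 0"
  using det_gram_pos by (simp add: metric_density_def)

lemma metric_change_chart:
  "c \<in> A \<Longrightarrow> d \<in> A \<Longrightarrow> p \<in> chart_dom c \<Longrightarrow> p \<in> chart_dom d \<Longrightarrow>
    h c p a b = h d p (jacobian c d p a) (jacobian c d p b)"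
  using C1_metric unfolding C1_metric_def by blast

text \<open>
  The Gram matrices in two charts are congruent through the Jacobian matrix, so their determinants
  differ by the square of its determinant.
\<close>

lemma metric_density_change_chart:
  assumes "c \<in> A" "d \<in> A" "p \<in> chart_dom c" "p \<in> chart_dom d"
  shows "metric_density h c p = \<bar>det (matrix (jacobian c d p))\<bar> * metric_density h d p"
proof -
  define J where "J = matrix (jacobian c d p)"
  have J: "jacobian c d p a = J *v a" for a
    unfolding J_def using matrix_works linear_matrix_vector_mul_eq linear_jacobian[OF assms] by metis
  have "gram h c p = transpose J ** (gram h d p ** J)"
  proof (rule matrix_eq_via_inner)
    fix a b
    show "a \<bullet> (gram h c p *v b) = a \<bullet> ((transpose J ** (gram h d p ** J)) *v b)"
      using metric_change_chart[OF assms, of a b]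
      unfolding inner_pullback[symmetric] J metric_eq_gram[OF assms(1,3)] metric_eq_gram[OF assms(2,4)] .
  qed
  then have "det (gram h c p) = (det J)\<^sup>2 * det (gram h d p)"
    by (simp only: det_mul det_transpose power2_eq_square mult_ac)
  then show ?thesis unfolding metric_density_def J_def[symmetric] by (simp add: real_sqrt_mult)
qed

lemma C1_gram: "c \<in> A \<Longrightarrow> Ck_on 1 (\<lambda>x. gram h c (chart_inv c x) $ i $ j) (chart_image c)"
  using C1_metric unfolding C1_metric_def gram_def vec_lambda_beta by blast

lemma C1_metric_density:
  assumes "c \<in> A"
  shows "Ck_on 1 (\<lambda>x. metric_density h c (chart_inv c x)) (chart_image c)"
  unfolding metric_density_def
  using assms det_gram_pos
  by (intro C1_on_sqrt Ck_on_det open_chart_image C1_gram) auto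

lemma continuous_on_metric_density:
  assumes "c \<in> A"
  shows "continuous_on (chart_dom c) (metric_density h c)"
  unfolding continuous_on_chart_dom_iff[OF assms] by (rule Ck_on_continuous[OF C1_metric_density[OF assms]])

end

subsection \<open>Integrals of localized functions\<close>

context compact_manifold
begin

lemma borel_chart_dom: "c \<in> A \<Longrightarrow> chart_dom c \<in> sets borel"
  using openin_chart_dom compact_M compact_imp_closed
  by (metis borel_closed borel_open openin_open sets.Int)

lemma borel_chart_map_image:
  assumes "c \<in> A" "B \<in> sets borel" "B \<subseteq> chart_dom c"
  shows "chart_map c ` B \<in> sets borel"
proof -
  have "chart_inv c \<in> measurable (restrict_space borel (chart_image c)) borel"
    using borel_measurable_continuous_on_restrict continuous_on_chart_inv assms by blast
  then have "chart_inv c -` B \<inter> space (restrict_space borel (chart_image c)) \<in> sets (restrict_space borel (chart_image c))"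
    using assms(2) by (rule measurable_sets)
  moreover have "chart_inv c -` B \<inter> space (restrict_space borel (chart_image c)) = chart_map c ` B"
    using assms by (auto simp: space_restrict_space image_iff subset_iff)
  ultimately show ?thesis
    using open_chart_image[OF assms(1)] by (auto simp: sets_restrict_space_iff)
qed

end

context riemannian
begin

text \<open>
  The integral of \<open>\<phi>\<close> over \<open>B\<close> with respect to the Riemannian measure, computed in the chart \<open>c\<close>.
\<close>

definition chart_integral :: "('a, 'm) chart \<Rightarrow> 'a set \<Rightarrow> ('a \<Rightarrow> real) \<Rightarrow> real" where
  "chart_integral c B \<phi> =
     (LINT x:chart_map c ` B|lborel. \<phi> (chart_inv c x) * metric_density h c (chart_inv c x))"

definition chart_integrable :: "('a, 'm) chart \<Rightarrow> 'a set \<Rightarrow> ('a \<Rightarrow> real) \<Rightarrow> bool" where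
  "chart_integrable c B \<phi> \<longleftrightarrow>
     set_integrable lborel (chart_map c ` B) (\<lambda>x. \<phi> (chart_inv c x) * metric_density h c (chart_inv c x))"

text \<open>
  The Jacobian factor of the change of variables formula is the ratio of the two densities.
\<close>

lemma chart_integral_change_chart:
  assumes cd: "c \<in> A" "d \<in> A" and B: "B \<in> sets borel" "B \<subseteq> chart_dom c \<inter> chart_dom d"
    and \<phi>: "continuous_on (chart_dom c \<inter> chart_dom d) \<phi>" "chart_integrable d B \<phi>"
  shows "chart_integrable c B \<phi>" and "chart_integral c B \<phi> = chart_integral d B \<phi>"
proof -
  let ?S = "chart_map c ` B" and ?T' = "\<lambda>x. jacobian c d (chart_inv c x)"
  let ?f = "\<lambda>y. \<phi> (chart_inv d y) * metric_density h d (chart_inv d y)"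
  have S: "?S \<in> sets borel" using borel_chart_map_image cd B by simp
  have dT: "(transition c d has_derivative ?T' x) (at x)" if "x \<in> ?S" for x
    using that transition_has_derivative[OF cd] B(2) cd by force
  have inj: "inj_on (transition c d) ?S"
    using B(2) cd inj_on_chart_map[of d] by (auto simp: inj_on_def subset_iff)
  have TS: "transition c d ` ?S = chart_map d ` B"
    using B(2) cd by (force simp: image_iff)
  have eq: "\<bar>det (matrix (?T' x))\<bar> * ?f (transition c d x) = \<phi> (chart_inv c x) * metric_density h c (chart_inv c x)"
    if "x \<in> ?S" for x
  proof -
    from that obtain p where p: "p \<in> B" "x = chart_map c p" by auto
    then have "p \<in> chart_dom c" "p \<in> chart_dom d" using B(2) by auto
    with metric_density_change_chart[OF cd this] p(2) cd show ?thesis by simp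
  qed
  have cont: "continuous_on ?S (\<lambda>x. \<phi> (chart_inv c x) * metric_density h c (chart_inv c x))"
    by (intro continuous_on_mult continuous_on_compose2[OF \<phi>(1)]
        continuous_on_compose2[OF continuous_on_metric_density[OF cd(1)]]
        continuous_on_subset[OF continuous_on_chart_inv[OF cd(1)]])
      (use B(2) cd in \<open>auto simp: subset_iff\<close>)
  have m: "(\<lambda>x. indicator ?S x *\<^sub>R (\<bar>det (matrix (?T' x))\<bar> * ?f (transition c d x))) \<in> borel_measurable borel"
  proof -
    have "(\<lambda>x. indicator ?S x *\<^sub>R (\<bar>det (matrix (?T' x))\<bar> * ?f (transition c d x))) =
      (\<lambda>x. indicator ?S x *\<^sub>R (\<phi> (chart_inv c x) * metric_density h c (chart_inv c x)))"
      by (intro ext) (metis eq indicator_simps(2) scaleR_zero_left)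
    then show ?thesis using borel_measurable_continuous_on_indicator[OF S cont] by simp
  qed
  have f: "set_integrable lborel (transition c d ` ?S) ?f"
    using \<phi>(2) unfolding chart_integrable_def TS .
  note cov = change_of_variables[OF S dT inj f m]
  show "chart_integrable c B \<phi>"
    unfolding chart_integrable_def by (rule set_integrable_cong[THEN iffD1, OF refl refl _ cov(1)]) (rule eq)
  have "chart_integral c B \<phi> = (LINT x:?S|lborel. \<bar>det (matrix (?T' x))\<bar> * ?f (transition c d x))"
    unfolding chart_integral_def by (rule set_lebesgue_integral_cong) (use S eq in auto)
  also have "\<dots> = chart_integral d B \<phi>"
    using cov(2) unfolding chart_integral_def TS .
  finally show "chart_integral c B \<phi> = chart_integral d B \<phi>" .
qed

lemma chart_integral_restrict:
  assumes "c \<in> A" "B \<subseteq> C" "C \<subseteq> chart_dom c" "\<And>p. p \<in> C - B \<Longrightarrow> \<phi> p = 0"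
  shows "chart_integrable c B \<phi> \<longleftrightarrow> chart_integrable c C \<phi>" and "chart_integral c B \<phi> = chart_integral c C \<phi>"
proof -
  have *: "indicator (chart_map c ` B) x *\<^sub>R (\<phi> (chart_inv c x) * metric_density h c (chart_inv c x)) =
    indicator (chart_map c ` C) x *\<^sub>R (\<phi> (chart_inv c x) * metric_density h c (chart_inv c x))" for x
  proof (cases "x \<in> chart_map c ` C")
    case True
    then obtain p where p: "p \<in> C" "x = chart_map c p" by auto
    show ?thesis
    proof (cases "p \<in> B")
      case False
      with p assms have "\<phi> (chart_inv c x) = 0" by (metis DiffI chart_inv_chart_map subsetD)
      then show ?thesis by simp
    qed (use p assms(2) in auto)
  qed (use assms(2) in \<open>auto simp: indicator_def\<close>)
  show "chart_integrable c B \<phi> \<longleftrightarrow> chart_integrable c C \<phi>"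
    unfolding chart_integrable_def set_integrable_def * ..
  show "chart_integral c B \<phi> = chart_integral c C \<phi>"
    unfolding chart_integral_def set_lebesgue_integral_def * ..
qed

lemma chart_integrable_compact_support:
  assumes "d \<in> A" "compact K" "K \<subseteq> chart_dom d" "continuous_on (chart_dom d) \<phi>" "\<And>q. q \<in> chart_dom d - K \<Longrightarrow> \<phi> q = 0"
  shows "chart_integrable d (chart_dom d) \<phi>"
  unfolding chart_integrable_def
proof (rule integrable_continuous_compact_support)
  show "compact (chart_map d ` K)"
    using assms continuous_on_chart_map continuous_on_subset by (intro compact_continuous_image) blast+
  show "continuous_on (chart_image d) (\<lambda>x. \<phi> (chart_inv d x) * metric_density h d (chart_inv d x))"
    using assms(1,4) continuous_on_metric_density[OF assms(1)] unfolding continuous_on_chart_dom_iff[OF assms(1)]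
    by (intro continuous_on_mult)
  fix x assume "x \<in> chart_image d - chart_map d ` K"
  then obtain q where "q \<in> chart_dom d - K" "x = chart_map d q" by blast
  with assms(1,5) show "\<phi> (chart_inv d x) * metric_density h d (chart_inv d x) = 0" by simp
qed (use assms in auto)

lemma chart_integrable_subset:
  assumes "d \<in> A" "B \<in> sets borel" "B \<subseteq> chart_dom d" "chart_integrable d (chart_dom d) \<phi>"
  shows "chart_integrable d B \<phi>"
  using assms(4) unfolding chart_integrable_def
  by (rule set_integrable_subset) (use assms borel_chart_map_image in auto)

lemma chart_integral_independent:
  assumes "c \<in> A" "d \<in> A" "compact K" "K \<subseteq> chart_dom c \<inter> chart_dom d"
    and "continuous_on (chart_dom c \<inter> chart_dom d) \<phi>" "\<And>q. q \<in> M - K \<Longrightarrow> \<phi> q = 0"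
  shows "chart_integral c (chart_dom c) \<phi> = chart_integral d (chart_dom d) \<phi>"
proof -
  let ?W = "chart_dom c \<inter> chart_dom d"
  have cont: "continuous_on M \<phi>"
    by (rule continuous_on_extend_by_0[OF assms(3,4) openin_overlap[OF assms(1,2)] assms(5,6)])
  have W: "?W \<in> sets borel" using assms borel_chart_dom by auto
  have z: "\<phi> q = 0" if "q \<in> chart_dom e - ?W" "e \<in> A" for q e
    using that assms(4,6) chart_dom_subset by blast
  have "chart_integrable d (chart_dom d) \<phi>"
    by (rule chart_integrable_compact_support[OF assms(2,3)])
      (use assms(2,4,6) continuous_on_subset[OF cont] chart_dom_subset[OF assms(2)] in auto)
  then have "chart_integrable d ?W \<phi>"
    using chart_integrable_subset assms(2) W by auto
  then have "chart_integral c ?W \<phi> = chart_integral d ?W \<phi>"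
    using chart_integral_change_chart[OF assms(1,2) W _ assms(5)] by auto
  moreover have "chart_integral c ?W \<phi> = chart_integral c (chart_dom c) \<phi>"
    by (rule chart_integral_restrict(2)[OF assms(1)]) (use z[OF _ assms(1)] in auto)
  moreover have "chart_integral d ?W \<phi> = chart_integral d (chart_dom d) \<phi>"
    by (rule chart_integral_restrict(2)[OF assms(2)]) (use z[OF _ assms(2)] in auto)
  ultimately show ?thesis by simp
qed

text \<open>
  This frees the integral from the arbitrarily chosen cover in its definition. On each piece of the
  cut manifold the summands are integrable, because they are so in the chart containing their
  support, and in that chart the images of the pieces fit together again.
\<close>

lemma form_integral_localized:
  assumes "finite I" and \<Phi>: "\<And>c p. c \<in> A \<Longrightarrow> p \<in> chart_dom c \<Longrightarrow> \<Phi> c p = (\<Sum>i\<in>I. \<phi> i p)"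
    and d: "\<And>i. i \<in> I \<Longrightarrow> d i \<in> A"
    and K: "\<And>i. i \<in> I \<Longrightarrow> compact (K i)" "\<And>i. i \<in> I \<Longrightarrow> K i \<subseteq> chart_dom (d i)"
    and \<phi>: "\<And>i. i \<in> I \<Longrightarrow> continuous_on (chart_dom (d i)) (\<phi> i)"
      "\<And>i q. i \<in> I \<Longrightarrow> q \<in> M - K i \<Longrightarrow> \<phi> i q = 0"
  shows "form_integral M A (\<lambda>c p U. \<Phi> c p * volume_form h c p U) =
    (\<Sum>i\<in>I. chart_integral (d i) (chart_dom (d i)) (\<phi> i))"
proof -
  \<comment> \<open>the cover \<open>cs\<close> chosen in the definition of the integral, and the pieces \<open>P k\<close> it cuts out\<close>
  define cs where "cs = (SOME cs. set cs \<subseteq> A \<and> M = (\<Union>c\<in>set cs. chart_dom c))"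
  obtain D where D: "D \<subseteq> A" "finite D" "M \<subseteq> (\<Union>c\<in>D. chart_dom c)"
  proof -
    have "\<forall>c\<in>A. \<exists>T. open T \<and> chart_dom c = M \<inter> T" using openin_chart_dom openin_open by metis
    then obtain T where T: "\<And>c. c \<in> A \<Longrightarrow> open (T c) \<and> chart_dom c = M \<inter> T c" by metis
    have "M \<subseteq> (\<Union>c\<in>A. T c)" using M_eq T by blast
    then obtain D where D: "D \<subseteq> A" "finite D" "M \<subseteq> (\<Union>c\<in>D. T c)"
      using compactE_image[OF compact_M] T by metis
    have "M \<subseteq> (\<Union>c\<in>D. chart_dom c)"
    proof
      fix p assume "p \<in> M"
      with D(3) obtain c where "c \<in> D" "p \<in> T c" by blast
      with D(1) T \<open>p \<in> M\<close> show "p \<in> (\<Union>c\<in>D. chart_dom c)" by fastforce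
    qed
    with D that show ?thesis by blast
  qed
  obtain cs0 where "set cs0 = D" using finite_list D(2) by blast
  then have "set cs0 \<subseteq> A \<and> M = (\<Union>c\<in>set cs0. chart_dom c)" using D chart_dom_subset by blast
  then have "set cs \<subseteq> A \<and> M = (\<Union>c\<in>set cs. chart_dom c)"
    unfolding cs_def by (rule someI)
  then have cs: "set cs \<subseteq> A" "M = (\<Union>c\<in>set cs. chart_dom c)" by blast+
  define P where "P k = chart_dom (cs ! k) - (\<Union>j<k. chart_dom (cs ! j))" for k
  have csA: "cs ! k \<in> A" if "k < length cs" for k using cs(1) that by auto
  have PB: "P k \<in> sets borel" if "k < length cs" for k
    unfolding P_def using that borel_chart_dom csA by (intro sets.Diff sets.finite_UN) auto
  have Pdom: "P k \<subseteq> chart_dom (cs ! k)" for k by (auto simp: P_def)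
  have Pdisj: "P k \<inter> P l = {}" if "k \<noteq> l" for k l
    using that by (cases "k < l") (auto simp: P_def)
  have PM: "M = (\<Union>k<length cs. P k)"
  proof
    show "(\<Union>k<length cs. P k) \<subseteq> M" using Pdom csA chart_dom_subset by blast
    show "M \<subseteq> (\<Union>k<length cs. P k)"
    proof
      fix p assume "p \<in> M"
      then have ex: "\<exists>k. k < length cs \<and> p \<in> chart_dom (cs ! k)"
        using cs(2) by (metis UN_E in_set_conv_nth)
      then obtain k where k: "k < length cs" "p \<in> chart_dom (cs ! k)"
        "\<And>j. j < k \<Longrightarrow> \<not> (j < length cs \<and> p \<in> chart_dom (cs ! j))"
        using exists_least_iff[of "\<lambda>k. k < length cs \<and> p \<in> chart_dom (cs ! k)"] by blast
      then have "p \<in> P k" unfolding P_def by (metis (no_types, lifting) DiffI UN_E lessThan_iff less_trans)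
      with k(1) show "p \<in> (\<Union>k<length cs. P k)" by blast
    qed
  qed
  \<comment> \<open>a summand vanishes on the part of a piece outside its own chart, so the rest can be moved to that chart\<close>
  have piece: "chart_integrable (cs ! k) (P k) (\<phi> i)"
    "chart_integral (cs ! k) (P k) (\<phi> i) = chart_integral (d i) (P k \<inter> chart_dom (d i)) (\<phi> i)"
    "chart_integrable (d i) (P k \<inter> chart_dom (d i)) (\<phi> i)"
    if i: "i \<in> I" and k: "k < length cs" for i k
  proof -
    have B: "P k \<inter> chart_dom (d i) \<in> sets borel" using PB k borel_chart_dom d i by auto
    have "chart_integrable (d i) (chart_dom (d i)) (\<phi> i)"
      by (rule chart_integrable_compact_support[OF d[OF i] K(1)[OF i] K(2)[OF i] \<phi>(1)[OF i]])
        (use \<phi>(2)[OF i] chart_dom_subset[OF d[OF i]] in auto)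
    then show di: "chart_integrable (d i) (P k \<inter> chart_dom (d i)) (\<phi> i)"
      using chart_integrable_subset d i B by auto
    have "chart_integrable (cs ! k) (P k \<inter> chart_dom (d i)) (\<phi> i)"
      "chart_integral (cs ! k) (P k \<inter> chart_dom (d i)) (\<phi> i) = chart_integral (d i) (P k \<inter> chart_dom (d i)) (\<phi> i)"
      using chart_integral_change_chart[OF csA[OF k] d[OF i] B _ _ di] Pdom continuous_on_subset[OF \<phi>(1)[OF i]]
      by auto
    moreover have "\<phi> i q = 0" if "q \<in> P k - P k \<inter> chart_dom (d i)" for q
      using that \<phi>(2)[OF i] K(2)[OF i] Pdom chart_dom_subset[OF csA[OF k]] by blast
    ultimately show "chart_integrable (cs ! k) (P k) (\<phi> i)"
      "chart_integral (cs ! k) (P k) (\<phi> i) = chart_integral (d i) (P k \<inter> chart_dom (d i)) (\<phi> i)"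
      using chart_integral_restrict[OF csA[OF k], of "P k \<inter> chart_dom (d i)" "P k" "\<phi> i"] Pdom by auto
  qed
  have "form_integral M A (\<lambda>c p U. \<Phi> c p * volume_form h c p U) =
    (\<Sum>k<length cs. LINT x:chart_map (cs ! k) ` P k|lborel.
       \<Phi> (cs ! k) (chart_inv (cs ! k) x) * volume_form h (cs ! k) (chart_inv (cs ! k) x) (mat 1))"
    unfolding form_integral_def Let_def cs_def[symmetric] P_def ..
  also have "\<dots> = (\<Sum>k<length cs. \<Sum>i\<in>I. chart_integral (cs ! k) (P k) (\<phi> i))"
  proof (rule sum.cong[OF refl])
    fix k assume "k \<in> {..<length cs}"
    then have k: "k < length cs" by simp
    have "(LINT x:chart_map (cs ! k) ` P k|lborel.
       \<Phi> (cs ! k) (chart_inv (cs ! k) x) * volume_form h (cs ! k) (chart_inv (cs ! k) x) (mat 1)) =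
      (LINT x:chart_map (cs ! k) ` P k|lborel.
       (\<Sum>i\<in>I. \<phi> i (chart_inv (cs ! k) x) * metric_density h (cs ! k) (chart_inv (cs ! k) x)))"
    proof (rule set_lebesgue_integral_cong)
      show "chart_map (cs ! k) ` P k \<in> sets lborel"
        using borel_chart_map_image[OF csA[OF k] PB[OF k] Pdom] by simp
      have "\<Phi> (cs ! k) p * volume_form h (cs ! k) p (mat 1) = (\<Sum>i\<in>I. \<phi> i p * metric_density h (cs ! k) p)"
        if "p \<in> P k" for p
        using \<Phi>[OF csA[OF k], of p] Pdom that by (simp add: volume_form_eq_metric_density sum_distrib_right subset_iff)
      moreover have "chart_inv (cs ! k) x \<in> P k" if "x \<in> chart_map (cs ! k) ` P k" for x
        using that Pdom csA[OF k] by (auto simp: subset_iff)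
      ultimately show "\<forall>x. x \<in> chart_map (cs ! k) ` P k \<longrightarrow>
        \<Phi> (cs ! k) (chart_inv (cs ! k) x) * volume_form h (cs ! k) (chart_inv (cs ! k) x) (mat 1) =
        (\<Sum>i\<in>I. \<phi> i (chart_inv (cs ! k) x) * metric_density h (cs ! k) (chart_inv (cs ! k) x))"
        by blast
    qed
    also have "\<dots> = (\<Sum>i\<in>I. chart_integral (cs ! k) (P k) (\<phi> i))"
      unfolding chart_integral_def set_lebesgue_integral_def scaleR_sum_right
      using piece(1)[OF _ k]
      by (intro Bochner_Integration.integral_sum) (auto simp: chart_integrable_def set_integrable_def)
    finally show "(LINT x:chart_map (cs ! k) ` P k|lborel.
       \<Phi> (cs ! k) (chart_inv (cs ! k) x) * volume_form h (cs ! k) (chart_inv (cs ! k) x) (mat 1)) =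
       (\<Sum>i\<in>I. chart_integral (cs ! k) (P k) (\<phi> i))" .
  qed
  also have "\<dots> = (\<Sum>i\<in>I. \<Sum>k<length cs. chart_integral (d i) (P k \<inter> chart_dom (d i)) (\<phi> i))"
    using piece(2) by (subst sum.swap) simp
  also have "\<dots> = (\<Sum>i\<in>I. chart_integral (d i) (chart_dom (d i)) (\<phi> i))"
  proof (rule sum.cong[OF refl])
    fix i assume i: "i \<in> I"
    let ?B = "\<lambda>k. chart_map (d i) ` (P k \<inter> chart_dom (d i))"
    let ?g = "\<lambda>x. \<phi> i (chart_inv (d i) x) * metric_density h (d i) (chart_inv (d i) x)"
    have un: "(\<Union>k<length cs. ?B k) = chart_image (d i)"
      using PM chart_dom_subset[OF d[OF i]] by blast
    have disj: "?B k \<inter> ?B l = {}" if "k \<noteq> l" for k l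
      using Pdisj[OF that] inj_on_chart_map[OF d[OF i]] by (auto simp: inj_on_def)
    have ind: "indicator (chart_image (d i)) x = (\<Sum>k<length cs. indicator (?B k) x :: real)" for x
      unfolding un[symmetric]
      by (rule indicator_UN_disjoint) (use disj in \<open>auto simp: disjoint_family_on_def\<close>)
    have "chart_integral (d i) (chart_dom (d i)) (\<phi> i) = (\<integral>x. (\<Sum>k<length cs. indicator (?B k) x *\<^sub>R ?g x) \<partial>lborel)"
      unfolding chart_integral_def set_lebesgue_integral_def ind scaleR_sum_left ..
    also have "\<dots> = (\<Sum>k<length cs. \<integral>x. indicator (?B k) x *\<^sub>R ?g x \<partial>lborel)"
      using piece(3)[OF i]
      by (intro Bochner_Integration.integral_sum) (auto simp: chart_integrable_def set_integrable_def)
    also have "\<dots> = (\<Sum>k<length cs. chart_integral (d i) (P k \<inter> chart_dom (d i)) (\<phi> i))"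
      unfolding chart_integral_def set_lebesgue_integral_def ..
    finally show "(\<Sum>k<length cs. chart_integral (d i) (P k \<inter> chart_dom (d i)) (\<phi> i)) =
      chart_integral (d i) (chart_dom (d i)) (\<phi> i)" ..
  qed
  finally show ?thesis .
qed

end

section \<open>The divergence of a vector field\<close>

text \<open>
  The classical formula \<open>(\<Sum>i. \<partial>\<^sub>i (\<rho> X\<^sup>i)) / \<rho>\<close> for the divergence with respect to the density \<open>\<rho>\<close>.
\<close>

definition chart_divergence ::
  "('a, 'm::finite) bilin_field \<Rightarrow> ('a, 'm) vec_field \<Rightarrow> ('a, 'm) chart \<Rightarrow> 'a \<Rightarrow> real" where
  "chart_divergence h X c p =
     coord_div (\<lambda>x. metric_density h c (chart_inv c x) *\<^sub>R X c (chart_inv c x)) (chart_map c p) / metric_density h c p"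

context compact_manifold
begin

lemma continuous_on_differential_apply:
  fixes f :: "'a \<Rightarrow> real"
  assumes "c \<in> A" "Ck_on 1 (f \<circ> chart_inv c) (chart_image c)" "continuous_on (chart_image c) (\<lambda>x. X c (chart_inv c x))"
  shows "continuous_on (chart_dom c) (\<lambda>p. differential f c p (X c p))"
  unfolding continuous_on_chart_dom_iff[OF assms(1)] differential_def
  by (rule continuous_on_eq[OF continuous_on_frechet_derivative_apply[OF open_chart_image[OF assms(1)] assms(2,3)]])
    (use assms(1) in simp)

lemma differential_apply_change_chart:
  assumes "vector_field 1 A X" "c \<in> A" "d \<in> A" "p \<in> chart_dom c" "p \<in> chart_dom d"
    and "Ck_on 1 (f \<circ> chart_inv d) (chart_image d)"
  shows "differential f c p (X c p) = differential f d p (X d p)"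
proof -
  have "X d p = jacobian c d p (X c p)"
    using assms(1-5) unfolding vector_field_def by blast
  then show ?thesis
    using differential_change_chart[OF assms(2-5) assms(6)[unfolded One_nat_def]] by simp
qed

lemma differential_sum:
  assumes "c \<in> A" "p \<in> chart_dom c" "\<And>i. i \<in> I \<Longrightarrow> Ck_on 1 (f i \<circ> chart_inv c) (chart_image c)"
    and "\<And>q. q \<in> M \<Longrightarrow> F q = (\<Sum>i\<in>I. f i q)"
  shows "differential F c p a = (\<Sum>i\<in>I. differential (f i) c p a)"
proof -
  have "((\<lambda>x. \<Sum>i\<in>I. (f i \<circ> chart_inv c) x) has_derivative (\<lambda>a. \<Sum>i\<in>I. differential (f i) c p a)) (at (chart_map c p))"
    by (rule has_derivative_sum) (rule differential_has_derivative[OF assms(1,2) assms(3)[unfolded One_nat_def]])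
  then have "(F \<circ> chart_inv c has_derivative (\<lambda>a. \<Sum>i\<in>I. differential (f i) c p a)) (at (chart_map c p))"
    by (rule has_derivative_transform_within_open[OF _ open_chart_image[OF assms(1)]])
      (use assms(2,4) chart_inv_in_M[OF assms(1)] in simp_all)
  then show ?thesis
    unfolding differential_def[of F] using frechet_derivative_at by metis
qed

text \<open>
  This serves as a partition of unity: dividing a function by the positive sum of the bumps and
  multiplying it with each of them splits it into summands supported in single charts.
\<close>

lemma finite_bump_cover:
  obtains I :: "'a set" and \<beta> :: "'a \<Rightarrow> 'a \<Rightarrow> real" and d K where "finite I"
    "\<And>i. i \<in> I \<Longrightarrow> smooth_map A (\<beta> i)" "\<And>i. i \<in> I \<Longrightarrow> d i \<in> A"
    "\<And>i. i \<in> I \<Longrightarrow> compact (K i)" "\<And>i. i \<in> I \<Longrightarrow> K i \<subseteq> chart_dom (d i)"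
    "\<And>i q. i \<in> I \<Longrightarrow> q \<in> M - K i \<Longrightarrow> \<beta> i q = 0" "\<And>q. q \<in> M \<Longrightarrow> (\<Sum>i\<in>I. \<beta> i q) > 0"
proof -
  have "\<exists>\<beta> d K. smooth_map A \<beta> \<and> (\<forall>q. \<beta> q \<ge> (0::real)) \<and> \<beta> p > 0 \<and> d \<in> A \<and> compact K \<and> K \<subseteq> chart_dom d \<and>
    (\<forall>q\<in>M - K. \<beta> q = 0)" if "p \<in> M" for p
  proof -
    obtain c where c: "c \<in> A" "p \<in> chart_dom c" by (rule ex_chart[OF \<open>p \<in> M\<close>])
    obtain \<beta> :: "'a \<Rightarrow> real" and K where "smooth_map A \<beta>" "\<And>q. \<beta> q \<ge> 0" "\<beta> p > 0"
      "compact K" "K \<subseteq> chart_dom c" "\<And>q. q \<in> M - K \<Longrightarrow> \<beta> q = 0"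
      by (rule smooth_bump[OF c(1) openin_chart_dom[OF c(1)] subset_refl c(2)]) blast
    with c(1) show ?thesis by blast
  qed
  then obtain \<beta> d K where *: "\<And>p. p \<in> M \<Longrightarrow> smooth_map A (\<beta> p) \<and> (\<forall>q. \<beta> p q \<ge> (0::real)) \<and> \<beta> p p > 0 \<and>
    d p \<in> A \<and> compact (K p) \<and> K p \<subseteq> chart_dom (d p) \<and> (\<forall>q\<in>M - K p. \<beta> p q = 0)" by metis
  have "\<exists>T. open T \<and> {q \<in> M. \<beta> p q > 0} = M \<inter> T" if "p \<in> M" for p
  proof -
    have "continuous_on (chart_dom c) (\<beta> p)" if "c \<in> A" for c
      using *[OF \<open>p \<in> M\<close>] that Ck_on_continuous
      unfolding continuous_on_chart_dom_iff[OF that] smooth_map_def Ck_map_def o_def by blast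
    then have "continuous_on M (\<beta> p)" by (rule continuous_on_M)
    then have "openin (top_of_set M) (M \<inter> \<beta> p -` {0<..})"
      by (rule continuous_openin_preimage_gen) simp
    moreover have "M \<inter> \<beta> p -` {0<..} = {q \<in> M. \<beta> p q > 0}" by auto
    ultimately show ?thesis by (metis openin_open)
  qed
  then obtain T where T: "\<And>p. p \<in> M \<Longrightarrow> open (T p) \<and> {q \<in> M. \<beta> p q > 0} = M \<inter> T p" by metis
  have T': "q \<in> T p \<longleftrightarrow> \<beta> p q > 0" if "p \<in> M" "q \<in> M" for p q
    using T[OF that(1)] that(2) by blast
  have cover: "M \<subseteq> (\<Union>p\<in>M. T p)"
  proof
    fix q assume "q \<in> M"
    with T'[of q q] *[of q] show "q \<in> (\<Union>p\<in>M. T p)" by auto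
  qed
  have opT: "open (T p)" if "p \<in> M" for p by (rule conjunct1[OF T[OF that]])
  obtain I where I: "I \<subseteq> M" "finite I" "M \<subseteq> (\<Union>p\<in>I. T p)"
    by (rule compactE_image[OF compact_M opT cover]) blast+
  have pos: "(\<Sum>i\<in>I. \<beta> i q) > 0" if "q \<in> M" for q
  proof -
    obtain i where "i \<in> I" "q \<in> T i" using I(3) \<open>q \<in> M\<close> by blast
    then have "\<beta> i q > 0" using T'[of i q] I(1) that by (simp add: subset_iff)
    moreover have "\<beta> j q \<ge> 0" if "j \<in> I" for j using *[of j] I(1) that by (simp add: subset_iff)
    ultimately show ?thesis using I(2) \<open>i \<in> I\<close> by (intro sum_pos2[of I i]) auto
  qed
  have "smooth_map A (\<beta> i) \<and> d i \<in> A \<and> compact (K i) \<and> K i \<subseteq> chart_dom (d i) \<and> (\<forall>q\<in>M - K i. \<beta> i q = 0)"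
    if "i \<in> I" for i
    using *[of i] I(1) that by (simp add: subset_iff)
  then show ?thesis using that[of I \<beta> d K] I(2) pos by blast
qed

end

context riemannian
begin

lemma C1_density_times_field:
  assumes "c \<in> A" "Ck_on 1 (\<lambda>x. X c (chart_inv c x)) (chart_image c)"
  shows "Ck_on 1 (\<lambda>x. metric_density h c (chart_inv c x) *\<^sub>R X c (chart_inv c x)) (chart_image c)"
  by (intro Ck_on_scaleR C1_metric_density open_chart_image assms)

lemma continuous_on_chart_divergence:
  assumes "c \<in> A" "Ck_on 1 (\<lambda>x. X c (chart_inv c x)) (chart_image c)"
  shows "continuous_on (chart_dom c) (chart_divergence h X c)"
proof -
  have "continuous_on (chart_dom c) (\<lambda>p. coord_div (\<lambda>x. metric_density h c (chart_inv c x) *\<^sub>R X c (chart_inv c x)) (chart_map c p))"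
    by (rule continuous_on_compose2[OF continuous_on_coord_div[OF open_chart_image[OF assms(1)]
          C1_density_times_field[where X = X, OF assms]] continuous_on_chart_map[OF assms(1)]]) simp
  then show ?thesis unfolding chart_divergence_def
    by (rule continuous_on_divide[OF _ continuous_on_metric_density[OF assms(1)]])
      (use metric_density_pos[OF assms(1)] in \<open>simp add: less_imp_neq[symmetric]\<close>)
qed

lemma chart_integral_cong:
  assumes "c \<in> A" "\<And>p. p \<in> chart_dom c \<Longrightarrow> \<phi> p = \<psi> p"
  shows "chart_integral c (chart_dom c) \<phi> = chart_integral c (chart_dom c) \<psi>"
  unfolding chart_integral_def
  by (rule set_lebesgue_integral_cong) (use assms open_chart_image[OF assms(1)] in simp_all)

lemma chart_integral_uminus: "chart_integral c B (\<lambda>p. - \<phi> p) = - chart_integral c B \<phi>"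
  unfolding chart_integral_def set_lebesgue_integral_def by simp

text \<open>
  Multiplied by the density \<open>\<rho>\<close>, the integrand is \<open>df(\<rho> X)\<close>, and integration by parts with respect to
  the Lebesgue measure applies to the field \<open>\<rho> X\<close>.
\<close>

lemma chart_integral_by_parts:
  fixes f :: "'a \<Rightarrow> real"
  assumes c: "c \<in> A" and X: "Ck_on 1 (\<lambda>x. X c (chart_inv c x)) (chart_image c)"
    and f: "Ck_on 1 (f \<circ> chart_inv c) (chart_image c)"
    and K: "compact K" "K \<subseteq> chart_dom c" "\<And>q. q \<in> M - K \<Longrightarrow> f q = 0"
  shows "chart_integral c (chart_dom c) (\<lambda>p. differential f c p (X c p)) =
    chart_integral c (chart_dom c) (\<lambda>p. - chart_divergence h X c p * f p)"
proof -
  let ?Z = "\<lambda>x. metric_density h c (chart_inv c x) *\<^sub>R X c (chart_inv c x)"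
  have K': "compact (chart_map c ` K)" "chart_map c ` K \<subseteq> chart_image c"
    using K(1,2) continuous_on_subset[OF continuous_on_chart_map[OF c] K(2)]
    by (auto intro!: compact_continuous_image)
  have f0: "(f \<circ> chart_inv c) x = 0" if "x \<in> chart_image c - chart_map c ` K" for x
  proof -
    from that obtain q where "q \<in> chart_dom c" "x = chart_map c q" "q \<notin> K" by blast
    then show ?thesis using K(3)[of q] chart_dom_subset[OF c] c by auto
  qed
  have "chart_integral c (chart_dom c) (\<lambda>p. differential f c p (X c p)) =
    (LINT x:chart_image c|lborel. frechet_derivative (f \<circ> chart_inv c) (at x) (?Z x))"
    unfolding chart_integral_def
  proof (rule set_lebesgue_integral_cong)
    have "differential f c p (X c p) * metric_density h c p =
        frechet_derivative (f \<circ> chart_inv c) (at (chart_map c p)) (metric_density h c p *\<^sub>R X c p)" if "p \<in> chart_dom c" for p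
      using linear_cmul[OF has_derivative_linear[OF differential_has_derivative[OF c that f[unfolded One_nat_def]]]]
      by (simp add: differential_def)
    then show "\<forall>x. x \<in> chart_image c \<longrightarrow> differential f c (chart_inv c x) (X c (chart_inv c x)) * metric_density h c (chart_inv c x) =
        frechet_derivative (f \<circ> chart_inv c) (at x) (?Z x)"
      using chart_inv_in_dom[OF c] chart_map_chart_inv[OF c] by metis
  qed (use open_chart_image[OF c] in simp)
  also have "\<dots> = - (LINT x:chart_image c|lborel. (f \<circ> chart_inv c) x * coord_div ?Z x)"
    by (rule integral_by_parts_compact_support[OF open_chart_image[OF c] f C1_density_times_field[where X = X, OF c X] K' f0])
  also have "(LINT x:chart_image c|lborel. (f \<circ> chart_inv c) x * coord_div ?Z x) =
    chart_integral c (chart_dom c) (\<lambda>p. chart_divergence h X c p * f p)"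
    unfolding chart_integral_def
  proof (rule set_lebesgue_integral_cong)
    show "\<forall>x. x \<in> chart_image c \<longrightarrow> (f \<circ> chart_inv c) x * coord_div ?Z x =
        chart_divergence h X c (chart_inv c x) * f (chart_inv c x) * metric_density h c (chart_inv c x)"
    proof (intro allI impI)
      fix x assume x: "x \<in> chart_image c"
      show "(f \<circ> chart_inv c) x * coord_div ?Z x =
        chart_divergence h X c (chart_inv c x) * f (chart_inv c x) * metric_density h c (chart_inv c x)"
        using metric_density_pos[OF c chart_inv_in_dom[OF c x]]
        unfolding chart_divergence_def chart_map_chart_inv[OF c x] by simp
    qed
  qed (use open_chart_image[OF c] in simp)
  finally show ?thesis by (simp flip: chart_integral_uminus)
qed

text \<open>
  The positive form of the fundamental lemma of the calculus of variations; the bump is supported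
  where \<open>u\<close> is positive.
\<close>

lemma bump_integral_pos:
  assumes c: "c \<in> A" and W: "openin (top_of_set M) W" "W \<subseteq> chart_dom c"
    and u: "continuous_on W u" and p: "p \<in> W" "u p > 0"
  obtains \<beta> :: "'a \<Rightarrow> real" and K where "smooth_map A \<beta>" "compact K" "K \<subseteq> W" "\<And>q. q \<in> M - K \<Longrightarrow> \<beta> q = 0"
    "chart_integral c (chart_dom c) (\<lambda>q. u q * \<beta> q) > 0"
proof -
  let ?W = "W \<inter> u -` {0<..}"
  have "openin (top_of_set W) ?W"
    by (rule continuous_openin_preimage_gen[OF u]) simp
  then have W': "openin (top_of_set M) ?W" using W(1) openin_trans by blast
  have W'_dom: "?W \<subseteq> chart_dom c" and pW': "p \<in> ?W" using W(2) p by auto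
  obtain \<beta> :: "'a \<Rightarrow> real" and K where \<beta>: "smooth_map A \<beta>" "\<And>q. \<beta> q \<ge> 0" "\<beta> p > 0"
    and K: "compact K" "K \<subseteq> ?W" "\<And>q. q \<in> M - K \<Longrightarrow> \<beta> q = 0"
    by (rule smooth_bump[OF c W' W'_dom pW']) (rule that)
  let ?g = "\<lambda>q. u q * \<beta> q"
  have \<beta>c: "continuous_on (chart_dom c) \<beta>"
    using \<beta>(1) c Ck_on_continuous
    unfolding continuous_on_chart_dom_iff[OF c] smooth_map_def Ck_map_def o_def by blast
  have "continuous_on M ?g"
    by (rule continuous_on_extend_by_0[OF K(1) _ W(1)])
      (use K(2,3) u continuous_on_subset[OF \<beta>c W(2)] in \<open>auto intro!: continuous_on_mult\<close>)
  then have g: "continuous_on (chart_dom c) ?g"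
    using chart_dom_subset[OF c] continuous_on_subset by blast
  have int: "chart_integrable c (chart_dom c) ?g"
    by (rule chart_integrable_compact_support[OF c K(1) _ g]) (use K W(2) chart_dom_subset[OF c] in auto)
  have nonneg: "?g q \<ge> 0" if "q \<in> chart_dom c" for q
  proof (cases "q \<in> K")
    case True
    then show ?thesis using K(2) \<beta>(2)[of q] by auto
  qed (use K(3) that chart_dom_subset[OF c] in auto)
  let ?f = "\<lambda>x. ?g (chart_inv c x) * metric_density h c (chart_inv c x)"
  have f: "continuous_on (chart_image c) ?f"
    using g continuous_on_metric_density[OF c] unfolding continuous_on_chart_dom_iff[OF c] by (rule continuous_on_mult)
  have f0: "?f x \<ge> 0" if "x \<in> chart_image c" for x
    using nonneg metric_density_pos[OF c] chart_inv_in_dom[OF c that] by (metis less_imp_le mult_nonneg_nonneg)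
  have "chart_integral c (chart_dom c) ?g \<noteq> 0"
  proof
    assume "chart_integral c (chart_dom c) ?g = 0"
    then have "?f (chart_map c p) = 0"
      using integral_nonneg_eq_0_imp_0[OF open_chart_image[OF c] f int[unfolded chart_integrable_def] f0] p W(2)
      unfolding chart_integral_def by blast
    then show False
      using p W(2) c \<beta>(3) metric_density_pos[OF c, of p] by (auto simp: subset_iff)
  qed
  moreover have "chart_integral c (chart_dom c) ?g \<ge> 0"
    unfolding chart_integral_def set_lebesgue_integral_def
    by (rule Bochner_Integration.integral_nonneg) (use f0 in \<open>auto simp: indicator_def\<close>)
  ultimately show ?thesis using that[OF \<beta>(1) K(1) _ K(3)] K(2) by auto
qed

text \<open>
  Tested against a bump supported in the overlap of two charts, both coordinate expressions give
  minus the integral of \<open>d\<beta>(X)\<close>, which does not depend on the chart. This avoids differentiating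
  the Jacobian determinant of the transition map.
\<close>

lemma chart_divergence_independent:
  assumes X: "vector_field 1 A X" and c: "c \<in> A" "p \<in> chart_dom c" and d: "d \<in> A" "p \<in> chart_dom d"
  shows "chart_divergence h X c p = chart_divergence h X d p"
proof -
  have le: "chart_divergence h X c p \<le> chart_divergence h X d p"
    if c: "c \<in> A" "p \<in> chart_dom c" and d: "d \<in> A" "p \<in> chart_dom d" for c d
  proof (rule ccontr)
    assume neg: "\<not> ?thesis"
    let ?W = "chart_dom c \<inter> chart_dom d"
    let ?C = "chart_divergence h X c" and ?D = "chart_divergence h X d"
    have XC: "Ck_on 1 (\<lambda>x. X c (chart_inv c x)) (chart_image c)" "Ck_on 1 (\<lambda>x. X d (chart_inv d x)) (chart_image d)"
      using vector_field_C1[OF X] c d by auto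
    have cont: "continuous_on ?W ?C" "continuous_on ?W ?D"
      using continuous_on_chart_divergence[where X = X, OF c(1) XC(1)]
        continuous_on_chart_divergence[where X = X, OF d(1) XC(2)]
      by (auto intro: continuous_on_subset)
    have pW: "p \<in> ?W" "?C p - ?D p > 0" using c d neg by auto
    obtain \<beta> :: "'a \<Rightarrow> real" and K where \<beta>: "smooth_map A \<beta>" and K: "compact K" "K \<subseteq> ?W" "\<And>q. q \<in> M - K \<Longrightarrow> \<beta> q = 0"
      and pos: "chart_integral c (chart_dom c) (\<lambda>q. (?C q - ?D q) * \<beta> q) > 0"
      by (rule bump_integral_pos[OF c(1) openin_overlap[OF c(1) d(1)] Int_lower1 continuous_on_diff[OF cont] pW])
        (rule that)
    have \<beta>C: "Ck_on 1 (\<beta> \<circ> chart_inv e) (chart_image e)" if "e \<in> A" for e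
      using \<beta> that unfolding smooth_map_def Ck_map_def by blast
    have \<beta>c: "continuous_on ?W \<beta>"
      using Ck_on_continuous[OF \<beta>C[OF c(1)]] continuous_on_chart_dom_iff[OF c(1), of \<beta>]
      by (auto intro: continuous_on_subset simp: o_def)
    have ext: "chart_integral c (chart_dom c) \<phi> = chart_integral d (chart_dom d) \<phi>"
      if "continuous_on ?W \<phi>" "\<And>q. q \<in> M - K \<Longrightarrow> \<phi> q = 0" for \<phi>
      by (rule chart_integral_independent[OF c(1) d(1) K(1,2) that])
    let ?d = "\<lambda>e q. differential \<beta> e q (X e q)"
    \<comment> \<open>\<open>\<phi>\<close> is the chart-independent function \<open>d\<beta>(X)\<close>\<close>
    define \<phi> where "\<phi> q = (if q \<in> ?W then ?d c q else 0)" for q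
    have \<phi>0: "?d e q = 0" if "e \<in> A" "q \<in> chart_dom e - K" for e q
      using that K differential_eq_0[OF that(1) _ K(1), of q \<beta>] by blast
    have \<phi>c: "chart_integral c (chart_dom c) \<phi> = chart_integral c (chart_dom c) (?d c)"
      by (rule chart_integral_cong[OF c(1)]) (use \<phi>0[OF c(1)] K(2) in \<open>auto simp: \<phi>_def\<close>)
    have "\<phi> q = ?d d q" if "q \<in> chart_dom d" for q
    proof (cases "q \<in> ?W")
      case True
      then show ?thesis
        using differential_apply_change_chart[OF X c(1) d(1) _ _ \<beta>C[OF d(1)], of q] by (simp add: \<phi>_def)
    next
      case False
      then show ?thesis using \<phi>0[OF d(1), of q] that K(2) by (auto simp: \<phi>_def)
    qed
    then have \<phi>d: "chart_integral d (chart_dom d) \<phi> = chart_integral d (chart_dom d) (?d d)"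
      by (rule chart_integral_cong[OF d(1)])
    have "continuous_on (chart_dom c) (?d c)"
      by (rule continuous_on_differential_apply[where X = X, OF c(1) \<beta>C[OF c(1)] Ck_on_continuous[OF XC(1)]])
    then have "continuous_on ?W \<phi>"
      using continuous_on_subset[of "chart_dom c" "?d c" ?W] by (intro continuous_on_eq[of ?W "?d c" \<phi>]) (auto simp: \<phi>_def)
    then have "chart_integral c (chart_dom c) \<phi> = chart_integral d (chart_dom d) \<phi>"
      by (rule ext) (use K(2) \<phi>0[OF c(1)] in \<open>auto simp: \<phi>_def\<close>)
    then have "chart_integral c (chart_dom c) (?d c) = chart_integral d (chart_dom d) (?d d)"
      unfolding \<phi>c \<phi>d .
    moreover have "chart_integral c (chart_dom c) (?d c) = - chart_integral c (chart_dom c) (\<lambda>q. ?C q * \<beta> q)"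
      using chart_integral_by_parts[where X = X, OF c(1) XC(1) \<beta>C[OF c(1)] K(1) _ K(3)] K(2)
      by (simp flip: chart_integral_uminus)
    moreover have "chart_integral d (chart_dom d) (?d d) = - chart_integral d (chart_dom d) (\<lambda>q. ?D q * \<beta> q)"
      using chart_integral_by_parts[where X = X, OF d(1) XC(2) \<beta>C[OF d(1)] K(1) _ K(3)] K(2)
      by (simp flip: chart_integral_uminus)
    moreover have "chart_integral d (chart_dom d) (\<lambda>q. ?D q * \<beta> q) = chart_integral c (chart_dom c) (\<lambda>q. ?D q * \<beta> q)"
      by (rule ext[symmetric]) (use cont \<beta>c K(3) in \<open>auto intro: continuous_on_mult\<close>)
    ultimately have eq: "chart_integral c (chart_dom c) (\<lambda>q. ?C q * \<beta> q) = chart_integral c (chart_dom c) (\<lambda>q. ?D q * \<beta> q)"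
      by simp
    have int: "chart_integrable c (chart_dom c) (\<lambda>q. u q * \<beta> q)" if "continuous_on ?W u" for u
    proof -
      have "continuous_on M (\<lambda>q. u q * \<beta> q)"
        by (rule continuous_on_extend_by_0[OF K(1,2) openin_overlap[OF c(1) d(1)] continuous_on_mult[OF that \<beta>c]])
          (use K(3) in simp)
      then show ?thesis
        using chart_dom_subset[OF c(1)] K
        by (intro chart_integrable_compact_support[OF c(1) K(1)]) (auto intro: continuous_on_subset)
    qed
    have "chart_integral c (chart_dom c) (\<lambda>q. (?C q - ?D q) * \<beta> q) =
      chart_integral c (chart_dom c) (\<lambda>q. ?C q * \<beta> q) - chart_integral c (chart_dom c) (\<lambda>q. ?D q * \<beta> q)"
      using int[OF cont(1)] int[OF cont(2)] unfolding chart_integral_def chart_integrable_def left_diff_distrib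
      by (rule set_integral_diff)
    with eq pos show False by simp
  qed
  from le[OF c d] le[OF d c] show ?thesis by simp
qed

lemma C1_has_derivative_at_chart_map:
  assumes "c \<in> A" "p \<in> chart_dom c" "Ck_on 1 F (chart_image c)"
  shows "(F has_derivative frechet_derivative F (at (chart_map c p))) (at (chart_map c p))"
  using Ck_on_Suc_has_derivative[OF assms(3)[unfolded One_nat_def] open_chart_image[OF assms(1)]] assms(2) by blast

text \<open>
  The product rule for \<open>\<rho> X\<close> gives the two terms that make up the Lie derivative of a volume form.
\<close>

lemma chart_divergence_eq:
  assumes c: "c \<in> A" "p \<in> chart_dom c" and X: "Ck_on 1 (\<lambda>x. X c (chart_inv c x)) (chart_image c)"
  shows "chart_divergence h X c p * metric_density h c p =
    frechet_derivative (\<lambda>x. metric_density h c (chart_inv c x)) (at (chart_map c p)) (X c p) +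
    metric_density h c p * coord_div (\<lambda>x. X c (chart_inv c x)) (chart_map c p)"
proof -
  let ?x = "chart_map c p" and ?\<rho> = "\<lambda>x. metric_density h c (chart_inv c x)" and ?X = "\<lambda>x. X c (chart_inv c x)"
  let ?D\<rho> = "frechet_derivative ?\<rho> (at ?x)" and ?DX = "frechet_derivative ?X (at ?x)"
  note \<rho>' = C1_has_derivative_at_chart_map[OF c C1_metric_density[OF c(1)]]
  have "((\<lambda>x. ?\<rho> x *\<^sub>R ?X x) has_derivative (\<lambda>a. ?\<rho> ?x *\<^sub>R ?DX a + ?D\<rho> a *\<^sub>R ?X ?x)) (at ?x)"
    by (rule has_derivative_scaleR[OF \<rho>' C1_has_derivative_at_chart_map[OF c X]])
  then have D: "frechet_derivative (\<lambda>x. ?\<rho> x *\<^sub>R ?X x) (at ?x) = (\<lambda>a. ?\<rho> ?x *\<^sub>R ?DX a + ?D\<rho> a *\<^sub>R ?X ?x)"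
    by (rule frechet_derivative_at[symmetric])
  have "coord_div (\<lambda>x. ?\<rho> x *\<^sub>R ?X x) ?x = ?\<rho> ?x * coord_div ?X ?x + (\<Sum>i\<in>UNIV. ?X ?x $ i * ?D\<rho> (axis i 1))"
    unfolding coord_div_eq D by (simp add: sum.distrib sum_distrib_left mult.commute)
  also have "(\<Sum>i\<in>UNIV. ?X ?x $ i * ?D\<rho> (axis i 1)) = ?D\<rho> (?X ?x)"
    using linear_expansion_axis[OF has_derivative_linear[OF \<rho>'], of "?X ?x"] by simp
  finally show ?thesis
    using metric_density_pos[OF c] c by (simp add: chart_divergence_def)
qed

lemma lie_derivative_volume_form:
  assumes c: "c \<in> A" "p \<in> chart_dom c" and X: "Ck_on 1 (\<lambda>x. X c (chart_inv c x)) (chart_image c)"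
  shows "lie_derivative X (volume_form h) c p U = chart_divergence h X c p * volume_form h c p U"
proof -
  let ?x = "chart_map c p" and ?\<rho> = "\<lambda>x. metric_density h c (chart_inv c x)" and ?X = "\<lambda>x. X c (chart_inv c x)"
  let ?D\<rho> = "frechet_derivative ?\<rho> (at ?x)" and ?DX = "frechet_derivative ?X (at ?x)"
  have "((\<lambda>x. ?\<rho> x * det U) has_derivative (\<lambda>a. ?D\<rho> a * det U)) (at ?x)"
    by (intro has_derivative_mult_left C1_has_derivative_at_chart_map[OF c C1_metric_density[OF c(1)]])
  then have 1: "frechet_derivative (\<lambda>x. ?\<rho> x * det U) (at ?x) = (\<lambda>a. ?D\<rho> a * det U)"
    by (rule frechet_derivative_at[symmetric])
  have lin: "linear ?DX" by (rule has_derivative_linear[OF C1_has_derivative_at_chart_map[OF c X]])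
  have mv: "matrix ?DX *v a = ?DX a" for a
    by (rule matrix_works) (use lin linear_matrix_vector_mul_eq in blast)
  have 2: "(\<Sum>k\<in>UNIV. det (\<chi> j. if j = k then ?DX (U $ k) else U $ j)) = coord_div ?X ?x * det U"
    unfolding coord_div_def using sum_det_replace_row[of "matrix ?DX" U] unfolding mv .
  have "lie_derivative X (volume_form h) c p U = ?D\<rho> (X c p) * det U +
    (\<Sum>k\<in>UNIV. metric_density h c p * det (\<chi> j. if j = k then ?DX (U $ k) else U $ j))"
    unfolding lie_derivative_def volume_form_eq_metric_density o_def 1 ..
  also have "\<dots> = (?D\<rho> (X c p) + metric_density h c p * coord_div ?X ?x) * det U"
    unfolding sum_distrib_left[symmetric] 2 by (simp add: algebra_simps)
  finally show ?thesis
    unfolding chart_divergence_eq[where X = X, OF c X, symmetric] volume_form_eq_metric_density by simp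
qed

lemma divergence_eq_chart_divergence:
  assumes X: "vector_field 1 A X" and c: "c \<in> A" "p \<in> chart_dom c"
  shows "divergence A (volume_form h) X p = chart_divergence h X c p"
  unfolding divergence_def
proof (rule the_equality)
  show "\<forall>d\<in>A. p \<in> chart_dom d \<longrightarrow>
    (\<forall>U. lie_derivative X (volume_form h) d p U = chart_divergence h X c p * volume_form h d p U)"
    using lie_derivative_volume_form[where X = X, OF _ _ vector_field_C1[OF X]]
      chart_divergence_independent[OF X c] by metis
  fix r assume "\<forall>d\<in>A. p \<in> chart_dom d \<longrightarrow> (\<forall>U. lie_derivative X (volume_form h) d p U = r * volume_form h d p U)"
  then have "lie_derivative X (volume_form h) c p (mat 1) = r * volume_form h c p (mat 1)" using c by blast
  then have "chart_divergence h X c p * metric_density h c p = r * metric_density h c p"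
    unfolding lie_derivative_volume_form[where X = X, OF c vector_field_C1[OF X c(1)]]
    by (simp add: volume_form_eq_metric_density)
  then show "r = chart_divergence h X c p" using metric_density_pos[OF c] by simp
qed

lemma continuous_on_divergence:
  assumes "vector_field 1 A X"
  shows "continuous_on M (divergence A (volume_form h) X)"
proof (rule continuous_on_M)
  fix c assume c: "c \<in> A"
  show "continuous_on (chart_dom c) (divergence A (volume_form h) X)"
    by (rule continuous_on_eq[OF continuous_on_chart_divergence[where X = X, OF c vector_field_C1[OF assms c]]])
      (simp add: divergence_eq_chart_divergence[OF assms c])
qed

text \<open>
  The function \<open>f\<close> is split into summands supported in single charts, where one can integrate by parts.
  The integrand \<open>\<Phi>\<close> has to equal \<open>df(X)\<close> on the chart domains only, so that it can be the expression
  \<open>inverse_metric h c p (w c p) (differential f c p)\<close> when \<open>X\<close> is the field dual to \<open>w\<close>.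
\<close>

theorem divergence_theorem:
  fixes f :: "'a \<Rightarrow> real"
  assumes X: "vector_field 1 A X" and f: "Ck_map 1 A f"
    and \<Phi>: "\<And>c p. c \<in> A \<Longrightarrow> p \<in> chart_dom c \<Longrightarrow> \<Phi> c p = differential f c p (X c p)"
  shows "form_integral M A (\<lambda>c p U. \<Phi> c p * volume_form h c p U) =
    form_integral M A (\<lambda>c p U. - divergence A (volume_form h) X p * f p * volume_form h c p U)"
proof -
  obtain I :: "'a set" and \<beta> :: "'a \<Rightarrow> 'a \<Rightarrow> real" and d K where I: "finite I"
    and \<beta>: "\<And>i. i \<in> I \<Longrightarrow> smooth_map A (\<beta> i)" and d: "\<And>i. i \<in> I \<Longrightarrow> d i \<in> A"
    and K: "\<And>i. i \<in> I \<Longrightarrow> compact (K i)" "\<And>i. i \<in> I \<Longrightarrow> K i \<subseteq> chart_dom (d i)"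
    and supp: "\<And>i q. i \<in> I \<Longrightarrow> q \<in> M - K i \<Longrightarrow> \<beta> i q = 0" and pos: "\<And>q. q \<in> M \<Longrightarrow> (\<Sum>i\<in>I. \<beta> i q) > 0"
    by (rule finite_bump_cover) (rule that)
  define g where "g i q = \<beta> i q * (f q * inverse (\<Sum>j\<in>I. \<beta> j q))" for i q
  have \<beta>1: "Ck_on 1 (\<lambda>x. \<beta> i (chart_inv c x)) (chart_image c)" if "i \<in> I" "c \<in> A" for i c
    using \<beta>[OF that(1)] that(2) unfolding smooth_map_def Ck_map_def o_def by blast
  have f1: "Ck_on 1 (\<lambda>x. f (chart_inv c x)) (chart_image c)" if "c \<in> A" for c
    using f that unfolding Ck_map_def o_def by blast
  have g1: "Ck_on 1 (g i \<circ> chart_inv c) (chart_image c)" if "i \<in> I" "c \<in> A" for i c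
    unfolding g_def o_def
  proof (intro Ck_on_mult C1_on_inverse Ck_on_sum open_chart_image \<beta>1 f1 that)
    fix x assume "x \<in> chart_image c"
    from pos[OF chart_inv_in_M[OF that(2) this]] show "(\<Sum>j\<in>I. \<beta> j (chart_inv c x)) \<noteq> 0" by simp
  qed
  have gsum: "f q = (\<Sum>i\<in>I. g i q)" if "q \<in> M" for q
    unfolding g_def sum_distrib_right[symmetric] using pos[OF that] by simp
  have g0: "g i q = 0" if "i \<in> I" "q \<in> M - K i" for i q
    unfolding g_def using supp[OF that] by simp
  have dg0: "differential (g i) c q a = 0" if "i \<in> I" "c \<in> A" "q \<in> chart_dom c - K i" for i c q a
    using differential_eq_0[where f = "g i", OF that(2) _ K(1)[OF that(1)] _ g0[OF that(1)]] that(3) by blast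
  have XC: "Ck_on 1 (\<lambda>x. X c (chart_inv c x)) (chart_image c)" if "c \<in> A" for c
    by (rule vector_field_C1[OF X that])
  \<comment> \<open>the differential of the \<open>i\<close>-th summand, applied to \<open>X\<close>, as a function on the whole manifold\<close>
  define \<phi> where "\<phi> i q = (if q \<in> chart_dom (d i) then differential (g i) (d i) q (X (d i) q) else 0)" for i q
  have "form_integral M A (\<lambda>c p U. \<Phi> c p * volume_form h c p U) =
    (\<Sum>i\<in>I. chart_integral (d i) (chart_dom (d i)) (\<phi> i))"
  proof (rule form_integral_localized[OF I _ d K])
    show "\<Phi> c p = (\<Sum>i\<in>I. \<phi> i p)" if "c \<in> A" "p \<in> chart_dom c" for c p
    proof -
      have "differential (g i) c p (X c p) = \<phi> i p" if i: "i \<in> I" for i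
      proof (cases "p \<in> chart_dom (d i)")
        case True
        then show ?thesis
          unfolding \<phi>_def using differential_apply_change_chart[OF X \<open>c \<in> A\<close> d[OF i] \<open>p \<in> chart_dom c\<close> True g1[OF i d[OF i]]]
          by simp
      next
        case False
        then show ?thesis
          unfolding \<phi>_def using dg0[OF i \<open>c \<in> A\<close>, of p] K(2)[OF i] \<open>p \<in> chart_dom c\<close> by auto
      qed
      then show ?thesis
        using differential_sum[where f = g and I = I and a = "X c p", OF that g1[OF _ that(1)] gsum] \<Phi>[OF that] by simp
    qed
    show "continuous_on (chart_dom (d i)) (\<phi> i)" if i: "i \<in> I" for i
      by (rule continuous_on_eq[OF continuous_on_differential_apply[where X = X, OF d[OF i] g1[OF i d[OF i]]
              Ck_on_continuous[OF XC[OF d[OF i]]]]]) (simp add: \<phi>_def)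
    show "\<phi> i q = 0" if "i \<in> I" "q \<in> M - K i" for i q
      using dg0[OF that(1) d[OF that(1)], of q] that(2) by (simp add: \<phi>_def)
  qed
  also have "\<dots> = (\<Sum>i\<in>I. chart_integral (d i) (chart_dom (d i)) (\<lambda>q. - divergence A (volume_form h) X q * g i q))"
  proof (rule sum.cong[OF refl])
    fix i assume i: "i \<in> I"
    have "chart_integral (d i) (chart_dom (d i)) (\<phi> i) =
        chart_integral (d i) (chart_dom (d i)) (\<lambda>q. differential (g i) (d i) q (X (d i) q))"
      by (rule chart_integral_cong[OF d[OF i]]) (simp add: \<phi>_def)
    also have "\<dots> = chart_integral (d i) (chart_dom (d i)) (\<lambda>q. - chart_divergence h X (d i) q * g i q)"
      by (rule chart_integral_by_parts[where X = X, OF d[OF i] XC[OF d[OF i]] g1[OF i d[OF i]] K(1)[OF i] K(2)[OF i] g0[OF i]])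
    also have "\<dots> = chart_integral (d i) (chart_dom (d i)) (\<lambda>q. - divergence A (volume_form h) X q * g i q)"
      by (rule chart_integral_cong[OF d[OF i]]) (simp add: divergence_eq_chart_divergence[OF X d[OF i]])
    finally show "chart_integral (d i) (chart_dom (d i)) (\<phi> i) =
      chart_integral (d i) (chart_dom (d i)) (\<lambda>q. - divergence A (volume_form h) X q * g i q)" .
  qed
  also have "\<dots> = form_integral M A (\<lambda>c p U. - divergence A (volume_form h) X p * f p * volume_form h c p U)"
  proof (rule form_integral_localized[OF I _ d K, symmetric])
    show "- divergence A (volume_form h) X p * f p = (\<Sum>i\<in>I. - divergence A (volume_form h) X p * g i p)"
      if "c \<in> A" "p \<in> chart_dom c" for c p
      using gsum[of p] chart_dom_subset[OF that(1)] that(2)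
      unfolding sum_distrib_left[symmetric] by auto
    show "continuous_on (chart_dom (d i)) (\<lambda>q. - divergence A (volume_form h) X q * g i q)" if i: "i \<in> I" for i
    proof -
      have "continuous_on (chart_dom (d i)) (g i)"
        using Ck_on_continuous[OF g1[OF i d[OF i]]] unfolding continuous_on_chart_dom_iff[OF d[OF i]] o_def .
      then show ?thesis
        using continuous_on_subset[OF continuous_on_divergence[OF X] chart_dom_subset[OF d[OF i]]]
        by (intro continuous_on_mult continuous_on_minus)
    qed
    show "- divergence A (volume_form h) X q * g i q = 0" if "i \<in> I" "q \<in> M - K i" for i q
      using g0[OF that] by simp
  qed
  finally show ?thesis .
qed

section \<open>The codifferential\<close>

text \<open>
  Near a point where \<open>u > u'\<close>, a bump function would distinguish the two sides of the defining identity.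
\<close>

lemma codifferential_unique:
  assumes "is_codifferential M A h w u" "is_codifferential M A h w u'" "p \<in> M"
  shows "u p = u' p"
proof -
  have le: "u p \<le> u' p" if u: "is_codifferential M A h w u" "is_codifferential M A h w u'" for u u'
  proof (rule ccontr)
    assume neg: "\<not> ?thesis"
    obtain c where c: "c \<in> A" "p \<in> chart_dom c" by (rule ex_chart[OF assms(3)])
    have cont: "continuous_on (chart_dom c) u" "continuous_on (chart_dom c) u'"
      using u chart_dom_subset[OF c(1)] continuous_on_subset unfolding is_codifferential_def by blast+
    have p': "u p - u' p > 0" using neg by simp
    obtain \<beta> :: "'a \<Rightarrow> real" and K where \<beta>: "smooth_map A \<beta>"
      and K: "compact K" "K \<subseteq> chart_dom c" "\<And>q. q \<in> M - K \<Longrightarrow> \<beta> q = 0"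
      and pos: "chart_integral c (chart_dom c) (\<lambda>q. (u q - u' q) * \<beta> q) > 0"
      by (rule bump_integral_pos[OF c(1) openin_chart_dom[OF c(1)] subset_refl continuous_on_diff[OF cont] c(2) p'])
        (rule that)
    have \<beta>c: "continuous_on (chart_dom c) \<beta>"
      using \<beta> c(1) Ck_on_continuous
      unfolding continuous_on_chart_dom_iff[OF c(1)] smooth_map_def Ck_map_def o_def by blast
    have loc: "form_integral M A (\<lambda>c p U. y p * \<beta> p * volume_form h c p U) =
      chart_integral c (chart_dom c) (\<lambda>q. y q * \<beta> q)" if "continuous_on (chart_dom c) y" for y
    proof -
      have "form_integral M A (\<lambda>c p U. y p * \<beta> p * volume_form h c p U) =
        (\<Sum>i\<in>{()}. chart_integral c (chart_dom c) (\<lambda>q. y q * \<beta> q))"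
        by (rule form_integral_localized[where K = "\<lambda>_. K"])
          (use c(1) K that \<beta>c in \<open>auto intro: continuous_on_mult\<close>)
      then show ?thesis by simp
    qed
    have int: "chart_integrable c (chart_dom c) (\<lambda>q. y q * \<beta> q)" if "continuous_on (chart_dom c) y" for y
      by (rule chart_integrable_compact_support[OF c(1) K(1,2) continuous_on_mult[OF that \<beta>c]])
        (use K(3) chart_dom_subset[OF c(1)] in auto)
    have "chart_integral c (chart_dom c) (\<lambda>q. u q * \<beta> q) = chart_integral c (chart_dom c) (\<lambda>q. u' q * \<beta> q)"
      unfolding loc[OF cont(1), symmetric] loc[OF cont(2), symmetric]
      using trans[OF sym[OF u(1)[unfolded is_codifferential_def, THEN conjunct2, rule_format, OF \<beta>]]
          u(2)[unfolded is_codifferential_def, THEN conjunct2, rule_format, OF \<beta>]] .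
    moreover have "chart_integral c (chart_dom c) (\<lambda>q. (u q - u' q) * \<beta> q) =
      chart_integral c (chart_dom c) (\<lambda>q. u q * \<beta> q) - chart_integral c (chart_dom c) (\<lambda>q. u' q * \<beta> q)"
      using int[OF cont(1)] int[OF cont(2)] unfolding chart_integral_def chart_integrable_def left_diff_distrib
      by (rule set_integral_diff)
    ultimately show False using pos by simp
  qed
  from le[OF assms(1,2)] le[OF assms(2,1)] show ?thesis by simp
qed

end

text \<open>
  The vector field that represents the 1-form \<open>w\<close> through the metric \<open>h\<close>.
\<close>

definition sharp :: "('a, 'm::finite) bilin_field \<Rightarrow> ('a, 'm) covec_field \<Rightarrow> ('a, 'm) vec_field" where
  "sharp h w c p = (\<chi> i. w c p (axis i 1)) v* matrix_inv (gram h c p)"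

lemma inverse_metric_eq_sharp:
  assumes "linear \<beta>"
  shows "inverse_metric h c p (w c p) \<beta> = \<beta> (sharp h w c p)"
proof -
  have "\<beta> (sharp h w c p) = (\<Sum>j\<in>UNIV. \<Sum>i\<in>UNIV. w c p (axis i 1) * matrix_inv (gram h c p) $ i $ j * \<beta> (axis j 1))"
    unfolding linear_expansion_axis[OF assms, of "sharp h w c p"]
    by (simp add: sharp_def vector_matrix_mult_def sum_distrib_right sum_distrib_left mult_ac)
  also have "\<dots> = inverse_metric h c p (w c p) \<beta>"
    unfolding inverse_metric_def by (rule sum.swap)
  finally show ?thesis ..
qed

context riemannian
begin

lemma invertible_gram:
  assumes "c \<in> A" "p \<in> chart_dom c"
  shows "invertible (gram h c p)"
  using det_gram_pos[OF assms] invertible_det_nz[of "gram h c p"] by simp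

lemma metric_sharp:
  assumes "c \<in> A" "p \<in> chart_dom c" "linear (w c p)"
  shows "h c p (sharp h w c p) a = w c p a"
proof -
  have "h c p (sharp h w c p) a = (\<chi> i. w c p (axis i 1)) \<bullet> (matrix_inv (gram h c p) *v (gram h c p *v a))"
    unfolding metric_eq_gram[OF assms(1,2)] sharp_def dot_lmul_matrix ..
  also have "\<dots> = (\<chi> i. w c p (axis i 1)) \<bullet> a"
    unfolding matrix_vector_mul_assoc matrix_inv_mult[OF invertible_gram[OF assms(1,2)]] by simp
  also have "\<dots> = w c p a"
    using linear_expansion_axis[OF assms(3), of a] by (simp add: inner_vec_def mult.commute)
  finally show ?thesis .
qed

lemma metric_diff_left: "c \<in> A \<Longrightarrow> p \<in> chart_dom c \<Longrightarrow> h c p (a - b) e = h c p a e - h c p b e"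
  by (simp only: metric_eq_gram inner_diff_left)

lemma metric_left_unique:
  assumes "c \<in> A" "p \<in> chart_dom c" "\<And>a. h c p x a = h c p y a"
  shows "x = y"
proof (rule ccontr)
  assume "x \<noteq> y"
  then have "h c p (x - y) (x - y) > 0"
    using is_inner_product_metric[OF assms(1,2)] unfolding is_inner_product_def by simp
  then show False unfolding metric_diff_left[OF assms(1,2)] assms(3) by simp
qed

lemma C1_one_form: "one_form 1 A w \<Longrightarrow> c \<in> A \<Longrightarrow> Ck_on 1 (\<lambda>x. w c (chart_inv c x) a) (chart_image c)"
  and linear_one_form: "one_form 1 A w \<Longrightarrow> c \<in> A \<Longrightarrow> p \<in> chart_dom c \<Longrightarrow> linear (w c p)"
  unfolding one_form_def by blast+

lemma one_form_change_chart:
  "one_form 1 A w \<Longrightarrow> c \<in> A \<Longrightarrow> d \<in> A \<Longrightarrow> p \<in> chart_dom c \<Longrightarrow> p \<in> chart_dom d \<Longrightarrow>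
    w c p a = w d p (jacobian c d p a)"
  unfolding one_form_def by blast

text \<open>
  The components of \<open>sharp h w\<close> solve a linear system whose coefficients are continuously
  differentiable; Cramer's rule transfers this to the solution.
\<close>

lemma vector_field_sharp:
  assumes w: "one_form 1 A w"
  shows "vector_field 1 A (sharp h w)"
proof -
  have "sharp h w d p = jacobian c d p (sharp h w c p)"
    if c: "c \<in> A" "p \<in> chart_dom c" and d: "d \<in> A" "p \<in> chart_dom d" for c d p
  proof (rule metric_left_unique[OF d])
    fix b
    have b: "b = jacobian c d p (jacobian d c p b)"
      using jacobian_inverse[OF d(1) c(1) d(2) c(2)] by simp
    have "h d p (jacobian c d p (sharp h w c p)) b = h c p (sharp h w c p) (jacobian d c p b)"
      by (subst b) (rule metric_change_chart[OF c(1) d(1) c(2) d(2), symmetric])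
    also have "\<dots> = w c p (jacobian d c p b)"
      by (rule metric_sharp[where w = w, OF c linear_one_form[OF w c]])
    also have "\<dots> = w d p b"
      using one_form_change_chart[OF w d(1) c(1) d(2) c(2)] by simp
    also have "\<dots> = h d p (sharp h w d p) b"
      by (rule metric_sharp[where w = w, OF d linear_one_form[OF w d], symmetric])
    finally show "h d p (sharp h w d p) b = h d p (jacobian c d p (sharp h w c p)) b" ..
  qed
  moreover have "Ck_on 1 (sharp h w c \<circ> chart_inv c) (chart_image c)" if c: "c \<in> A" for c
  proof -
    let ?G = "\<lambda>x. transpose (gram h c (chart_inv c x))" and ?\<alpha> = "\<lambda>x. \<chi> i. w c (chart_inv c x) (axis i 1)"
    define s where "s x = (\<chi> k. det (\<chi> i j. if j = k then ?\<alpha> x $ i else ?G x $ i $ j) * inverse (det (?G x)))" for x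
    have det: "det (?G x) \<noteq> 0" if "x \<in> chart_image c" for x
      using det_gram_pos[OF c chart_inv_in_dom[OF c that]] by (simp add: det_transpose)
    have "Ck_on 1 s (chart_image c)"
    proof (rule Ck_on_vec_lambda[OF open_chart_image[OF c]])
      fix k
      have "Ck_on 1 (\<lambda>x. det (\<chi> i j. if j = k then ?\<alpha> x $ i else ?G x $ i $ j)) (chart_image c)"
      proof (rule Ck_on_det[OF open_chart_image[OF c]])
        fix i j
        show "Ck_on 1 (\<lambda>x. (\<chi> i j. if j = k then ?\<alpha> x $ i else ?G x $ i $ j) $ i $ j) (chart_image c)"
          using C1_one_form[OF w c] C1_gram[OF c, of j i] by (cases "j = k") (simp_all add: transpose_def del: One_nat_def)
      qed
      moreover have "Ck_on 1 (\<lambda>x. inverse (det (?G x))) (chart_image c)"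
        by (intro C1_on_inverse Ck_on_det open_chart_image c det) (use C1_gram[OF c] in \<open>simp add: transpose_def del: One_nat_def\<close>)
      ultimately have "Ck_on 1 (\<lambda>x. det (\<chi> i j. if j = k then ?\<alpha> x $ i else ?G x $ i $ j) * inverse (det (?G x))) (chart_image c)"
        by (rule Ck_on_mult[OF open_chart_image[OF c]])
      then show "Ck_on 1 (\<lambda>x. s x $ k) (chart_image c)" by (simp add: s_def del: One_nat_def)
    qed
    moreover have "s x = (sharp h w c \<circ> chart_inv c) x" if x: "x \<in> chart_image c" for x
    proof -
      have "?G x *v (sharp h w c (chart_inv c x)) = ?\<alpha> x"
        using matrix_inv_mult[OF invertible_gram[OF c chart_inv_in_dom[OF c x]]]
        by (simp add: sharp_def vector_matrix_mul_assoc)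
      then have "sharp h w c (chart_inv c x) = (\<chi> k. det (\<chi> i j. if j = k then ?\<alpha> x $ i else ?G x $ i $ j) / det (?G x))"
        using cramer[OF det[OF x]] by blast
      then show ?thesis by (simp add: s_def divide_inverse)
    qed
    ultimately show ?thesis
      using Ck_on_cong[OF open_chart_image[OF c], of s "sharp h w c \<circ> chart_inv c" 1] by blast
  qed
  ultimately show ?thesis unfolding vector_field_def by blast
qed

text \<open>
  By the divergence theorem the right-hand side satisfies the defining identity, because
  \<open>inverse_metric\<close> pairs \<open>w\<close> with \<open>df\<close> to \<open>df (sharp h w)\<close>; uniqueness does the rest.
\<close>

theorem codifferential_eq_divergence_sharp:
  assumes w: "one_form 1 A w" and p: "p \<in> M"
  shows "codifferential M A h w p = - divergence A (volume_form h) (sharp h w) p"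
proof -
  let ?u = "\<lambda>p. - divergence A (volume_form h) (sharp h w) p"
  have "is_codifferential M A h w ?u"
    unfolding is_codifferential_def
  proof (intro conjI allI impI)
    show "continuous_on M ?u"
      by (intro continuous_on_minus continuous_on_divergence vector_field_sharp w)
    fix f :: "'a \<Rightarrow> real" assume f: "smooth_map A f"
    then have f1: "Ck_map 1 A f" unfolding smooth_map_def by blast
    show "form_integral M A (\<lambda>c p U. inverse_metric h c p (w c p) (differential f c p) * volume_form h c p U) =
      form_integral M A (\<lambda>c p U. ?u p * f p * volume_form h c p U)"
    proof (rule divergence_theorem[OF vector_field_sharp[OF w] f1])
      fix c p assume c: "c \<in> A" "p \<in> chart_dom c"
      have "Ck_on (Suc 0) (f \<circ> chart_inv c) (chart_image c)"
        using f1 c(1) unfolding Ck_map_def One_nat_def by blast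
      then show "inverse_metric h c p (w c p) (differential f c p) = differential f c p (sharp h w c p)"
        by (intro inverse_metric_eq_sharp has_derivative_linear[OF differential_has_derivative[OF c]])
    qed
  qed
  moreover from this have "is_codifferential M A h w (codifferential M A h w)"
    unfolding codifferential_def by (rule someI[of "is_codifferential M A h w"])
  ultimately show ?thesis using codifferential_unique p by blast
qed

end

section \<open>The induced metric\<close>

lemma is_inner_product_D:
  assumes "is_inner_product ip"
  shows "linear (\<lambda>x. ip x y)" "linear (ip x)" "ip x y = ip y x" "x \<noteq> 0 \<Longrightarrow> ip x x > 0" "ip x x \<ge> 0"
proof -
  show lin: "linear (\<lambda>x. ip x y)" "linear (ip x)" for x y
    using assms unfolding is_inner_product_def bilinear_def by blast+
  show "ip x y = ip y x" using assms unfolding is_inner_product_def by blast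
  show pos: "x \<noteq> 0 \<Longrightarrow> ip x x > 0" using assms unfolding is_inner_product_def by blast
  show "ip x x \<ge> 0" using pos linear_0[OF lin(2)] by (cases "x = 0") auto
qed

text \<open>
  Positivity at the vector \<open>ip x x *\<^sub>R y - ip x y *\<^sub>R x\<close>.
\<close>

lemma is_inner_product_Cauchy_Schwarz:
  assumes ip: "is_inner_product ip"
  shows "(ip x y)\<^sup>2 \<le> ip x x * ip y y"
proof (cases "x = 0")
  case True
  then show ?thesis using linear_0[OF is_inner_product_D(1)[OF ip]] by simp
next
  case False
  let ?z = "ip x x *\<^sub>R y - ip x y *\<^sub>R x"
  have "ip ?z ?z = ip x x * (ip x x * ip y y - (ip x y)\<^sup>2)"
    by (simp add: linear_diff[OF is_inner_product_D(1)[OF ip]] linear_diff[OF is_inner_product_D(2)[OF ip]]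
        linear_cmul[OF is_inner_product_D(1)[OF ip]] linear_cmul[OF is_inner_product_D(2)[OF ip]]
        is_inner_product_D(3)[OF ip, of y x] algebra_simps power2_eq_square)
  then have "0 \<le> ip x x * (ip x x * ip y y - (ip x y)\<^sup>2)"
    using is_inner_product_D(5)[OF ip, of ?z] by simp
  then show ?thesis
    using is_inner_product_D(4)[OF ip False] by (simp add: zero_le_mult_iff)
qed

lemma (in compact_manifold) C1_metric_induced_metric:
  fixes F :: "'a \<Rightarrow> real ^ 'n::finite"
  assumes F: "Ck_embedding 2 M A F" and ip: "is_inner_product ip"
  shows "C1_metric A (induced_metric ip F)"
proof -
  have F2: "Ck_on (Suc 1) (F \<circ> chart_inv c) (chart_image c)" if "c \<in> A" for c
    using F that unfolding Ck_embedding_def Ck_map_def numeral_2_eq_2 One_nat_def by blast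
  have lin: "linear (differential F c p)" if "c \<in> A" "p \<in> chart_dom c" for c p
    by (rule has_derivative_linear[OF differential_has_derivative[OF that F2[OF that(1)]]])
  have inner: "is_inner_product (induced_metric ip F c p)" if "c \<in> A" "p \<in> chart_dom c" for c p
  proof -
    have "linear (\<lambda>a. ip (differential F c p a) y)" "linear (\<lambda>a. ip y (differential F c p a))" for y
      using linear_compose[OF lin[OF that] is_inner_product_D(1)[OF ip]]
        linear_compose[OF lin[OF that] is_inner_product_D(2)[OF ip]] by (simp_all add: o_def)
    moreover have "ip (differential F c p a) (differential F c p a) > 0" if "a \<noteq> 0" for a
    proof (rule is_inner_product_D(4)[OF ip])
      have "inj (differential F c p)"
        using F \<open>c \<in> A\<close> \<open>p \<in> chart_dom c\<close> unfolding Ck_embedding_def by blast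
      then show "differential F c p a \<noteq> 0"
        using that linear_0[OF lin[OF \<open>c \<in> A\<close> \<open>p \<in> chart_dom c\<close>]] by (metis injD)
    qed
    ultimately show ?thesis
      unfolding is_inner_product_def bilinear_def induced_metric_def using is_inner_product_D(3)[OF ip] by blast
  qed
  have change: "induced_metric ip F c p a b = induced_metric ip F d p (jacobian c d p a) (jacobian c d p b)"
    if "c \<in> A" "d \<in> A" "p \<in> chart_dom c \<inter> chart_dom d" for c d p a b
    unfolding induced_metric_def
    using differential_change_chart[OF that(1,2) _ _ F2[OF that(2)], of p] that(3) by simp
  have C1: "Ck_on 1 (\<lambda>x. induced_metric ip F c (chart_inv c x) a b) (chart_image c)" if c: "c \<in> A" for c a b
  proof -
    have op: "open (chart_image c)" by (rule open_chart_image[OF c])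
    have D: "Ck_on 1 (\<lambda>x. differential F c (chart_inv c x) a) (chart_image c)" for a
    proof (rule Ck_on_linear_apply[OF op _ _ Ck_on_const])
      fix i
      have "Ck_on 1 (\<lambda>x. frechet_derivative (F \<circ> chart_inv c) (at x) (axis i 1)) (chart_image c)"
        using F2[OF c] unfolding Ck_on.simps(2) by (auto simp: axis_in_Basis_iff simp del: One_nat_def)
      then show "Ck_on 1 (\<lambda>x. differential F c (chart_inv c x) (axis i 1)) (chart_image c)"
        by (rule Ck_on_cong[OF op, THEN iffD1, rotated]) (use c in \<open>simp add: differential_def\<close>)
    qed (use lin[OF c] c in auto)
    have "bounded_bilinear ip"
      using ip unfolding is_inner_product_def bilinear_conv_bounded_bilinear by blast
    then show ?thesis
      unfolding induced_metric_def by (rule Ck_on_bilinear[OF _ op D D])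
  qed
  show ?thesis
    unfolding C1_metric_def by (intro conjI ballI allI inner change C1)
qed

section \<open>The metric associated with cone kernels\<close>

text \<open>
  For \<open>\<zeta> = 0\<close> the cone metric is the conformal rescaling \<open>g / \<parallel>v\<parallel>\<^sup>2\<close>, whose Gram determinant carries the
  factor \<open>1 / \<parallel>v\<parallel>\<^bsup>2m\<^esup>\<close>.
\<close>

lemma nu_bar_eq_volume_form:
  assumes "\<And>c p. g c p (v c p) (v c p) \<ge> 0"
  shows "nu_bar g v = volume_form (cone_metric g v 0)"
proof (intro ext)
  fix c p U
  let ?N = "metric_norm g v c p"
  have N: "?N \<ge> 0" unfolding metric_norm_def using assms by simp
  have "gram (cone_metric g v 0) c p = (1 / ?N\<^sup>2) *\<^sub>R gram g c p"
    by (simp add: gram_def cone_metric_def vec_eq_iff)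
  moreover have "(1 / ?N\<^sup>2) ^ CARD('b) = (1 / ?N ^ CARD('b))\<^sup>2"
    by (simp add: power_one_over power_mult[symmetric] mult.commute)
  ultimately have "sqrt (det (gram (cone_metric g v 0) c p)) = sqrt ((1 / ?N ^ CARD('b))\<^sup>2) * sqrt (det (gram g c p))"
    by (simp only: det_scaleR real_sqrt_mult)
  also have "sqrt ((1 / ?N ^ CARD('b))\<^sup>2) = 1 / ?N ^ CARD('b)" using N by simp
  finally show "nu_bar g v c p U = volume_form (cone_metric g v 0) c p U"
    by (simp add: nu_bar_def volume_form_def)
qed

locale riemannian_flow = riemannian M A g
  for M :: "'a::t2_space set" and A :: "('a, 'm::finite) chart set" and g :: "('a, 'm) bilin_field" +
  fixes v :: "('a, 'm) vec_field"
  assumes vector_field_v: "vector_field 1 A v"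
    and v_nonzero: "\<And>c p. c \<in> A \<Longrightarrow> p \<in> chart_dom c \<Longrightarrow> v c p \<noteq> 0"
begin

lemma v_change_chart:
  "c \<in> A \<Longrightarrow> d \<in> A \<Longrightarrow> p \<in> chart_dom c \<Longrightarrow> p \<in> chart_dom d \<Longrightarrow> v d p = jacobian c d p (v c p)"
  using vector_field_v unfolding vector_field_def by blast

lemma metric_v_pos: "c \<in> A \<Longrightarrow> p \<in> chart_dom c \<Longrightarrow> g c p (v c p) (v c p) > 0"
  using is_inner_product_D(4)[OF is_inner_product_metric] v_nonzero by blast

lemma cone_metric_eq:
  assumes "c \<in> A" "p \<in> chart_dom c"
  shows "cone_metric g v \<zeta> c p a b = inverse (g c p (v c p) (v c p)) *
    (g c p a b - \<zeta> * (g c p (v c p) a * g c p (v c p) b * inverse (g c p (v c p) (v c p))))"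
  using metric_v_pos[OF assms] by (simp add: cone_metric_def metric_norm_def divide_inverse)

text \<open>
  Positivity: by the Cauchy-Schwarz inequality \<open>g(v, a)\<^sup>2 / \<parallel>v\<parallel>\<^sup>2 \<le> g(a, a)\<close>, and \<open>\<zeta> < 1\<close>.
\<close>

lemma C1_metric_cone_metric:
  assumes \<zeta>: "0 \<le> \<zeta>" "\<zeta> < 1"
  shows "C1_metric A (cone_metric g v \<zeta>)"
proof -
  have inner: "is_inner_product (cone_metric g v \<zeta> c p)" if c: "c \<in> A" "p \<in> chart_dom c" for c p
  proof -
    let ?N = "g c p (v c p) (v c p)"
    note ip = is_inner_product_metric[OF c]
    note N = metric_v_pos[OF c]
    have lin: "linear (cone_metric g v \<zeta> c p a)" for a
    proof (rule linearI)
      show "cone_metric g v \<zeta> c p a (x + y) = cone_metric g v \<zeta> c p a x + cone_metric g v \<zeta> c p a y" for x y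
        unfolding cone_metric_eq[OF c] linear_add[OF is_inner_product_D(2)[OF ip]] by (simp add: algebra_simps)
      show "cone_metric g v \<zeta> c p a (r *\<^sub>R x) = r *\<^sub>R cone_metric g v \<zeta> c p a x" for r x
        unfolding cone_metric_eq[OF c] linear_cmul[OF is_inner_product_D(2)[OF ip]] by (simp add: algebra_simps)
    qed
    have sym: "cone_metric g v \<zeta> c p a b = cone_metric g v \<zeta> c p b a" for a b
      unfolding cone_metric_eq[OF c] is_inner_product_D(3)[OF ip, of a b] by (simp add: mult.commute mult.left_commute)
    have pos: "cone_metric g v \<zeta> c p a a > 0" if a: "a \<noteq> 0" for a
    proof -
      let ?t = "g c p (v c p) a * g c p (v c p) a * inverse ?N"
      have "?t \<le> g c p a a"
        using is_inner_product_Cauchy_Schwarz[OF ip, of "v c p" a] N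
        by (simp add: field_simps power2_eq_square)
      then have "\<zeta> * ?t \<le> \<zeta> * g c p a a" using \<zeta>(1) by (rule mult_left_mono)
      also have "\<dots> < g c p a a" using \<zeta>(2) is_inner_product_D(4)[OF ip a] by simp
      finally show ?thesis unfolding cone_metric_eq[OF c] using N by simp
    qed
    have "linear (\<lambda>a. cone_metric g v \<zeta> c p a b)" for b
      using lin[of b] unfolding sym[of _ b] .
    with lin sym pos show ?thesis unfolding is_inner_product_def bilinear_def by blast
  qed
  have change: "cone_metric g v \<zeta> c p a b = cone_metric g v \<zeta> d p (jacobian c d p a) (jacobian c d p b)"
    if cd: "c \<in> A" "d \<in> A" "p \<in> chart_dom c \<inter> chart_dom d" for c d p a b
    unfolding cone_metric_eq[OF cd(1) IntD1[OF cd(3)]] cone_metric_eq[OF cd(2) IntD2[OF cd(3)]]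
      v_change_chart[OF cd(1,2) IntD1[OF cd(3)] IntD2[OF cd(3)]]
      metric_change_chart[OF cd(1,2) IntD1[OF cd(3)] IntD2[OF cd(3)]] ..
  have C1: "Ck_on 1 (\<lambda>x. cone_metric g v \<zeta> c (chart_inv c x) a b) (chart_image c)" if c: "c \<in> A" for c a b
  proof -
    have op: "open (chart_image c)" by (rule open_chart_image[OF c])
    have ip: "is_inner_product (g c (chart_inv c x))" if "x \<in> chart_image c" for x
      by (rule is_inner_product_metric[OF c chart_inv_in_dom[OF c that]])
    have V: "Ck_on 1 (\<lambda>x. v c (chart_inv c x)) (chart_image c)"
      by (rule vector_field_C1[OF vector_field_v c])
    have G: "Ck_on 1 (\<lambda>x. g c (chart_inv c x) a b) (chart_image c)" for a b
      using C1_metric c unfolding C1_metric_def by blast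
    have GV: "Ck_on 1 (\<lambda>x. g c (chart_inv c x) (v c (chart_inv c x)) b) (chart_image c)" for b
      by (rule Ck_on_linear_apply[OF op G is_inner_product_D(1)[OF ip] V])
    have GVV: "Ck_on 1 (\<lambda>x. g c (chart_inv c x) (v c (chart_inv c x)) (v c (chart_inv c x))) (chart_image c)"
      by (rule Ck_on_linear_apply[OF op GV is_inner_product_D(2)[OF ip] V])
    have iGVV: "Ck_on 1 (\<lambda>x. inverse (g c (chart_inv c x) (v c (chart_inv c x)) (v c (chart_inv c x)))) (chart_image c)"
      by (rule C1_on_inverse[OF op GVV]) (use metric_v_pos[OF c chart_inv_in_dom[OF c]] in force)
    show ?thesis
      by (rule Ck_on_cong[OF op, THEN iffD1, rotated, OF Ck_on_mult[OF op iGVV Ck_on_diff[OF op G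
              Ck_on_mult[OF op Ck_on_const Ck_on_mult[OF op Ck_on_mult[OF op GV GV] iGVV]]]]])
        (rule cone_metric_eq[OF c chart_inv_in_dom[OF c], symmetric])
  qed
  show ?thesis
    unfolding C1_metric_def by (intro conjI ballI allI inner change C1)
qed

lemma riemannian_cone_metric:
  assumes "0 \<le> \<zeta>" "\<zeta> < 1"
  shows "riemannian M A (cone_metric g v \<zeta>)"
  using compact_manifold_axioms C1_metric_cone_metric[OF assms] by (simp add: riemannian_def riemannian_axioms_def)

sublocale cone0: riemannian M A "cone_metric g v 0"
  by (rule riemannian_cone_metric) auto

lemma cone_metric_v_v:
  assumes "c \<in> A" "p \<in> chart_dom c"
  shows "cone_metric g v 0 c p (v c p) (v c p) = 1"
  using metric_v_pos[OF assms] by (simp add: cone_metric_eq[OF assms])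

lemma cone_metric_eq_cone0:
  assumes c: "c \<in> A" "p \<in> chart_dom c"
  shows "cone_metric g v \<zeta> c p a b = cone_metric g v 0 c p a b -
    \<zeta> * (cone_metric g v 0 c p (v c p) a * cone_metric g v 0 c p (v c p) b)"
  unfolding cone_metric_eq[OF c] by (simp add: algebra_simps)

text \<open>
  The Gram matrix of \<open>h\<^sub>\<zeta>\<close> is that of \<open>h\<^sub>0\<close> times a rank-one perturbation of the identity, whose
  determinant is \<open>1 - \<zeta> h\<^sub>0(v, v)\<close>.
\<close>

lemma metric_density_cone_metric:
  assumes c: "c \<in> A" "p \<in> chart_dom c" and \<zeta>: "\<zeta> < 1"
  shows "metric_density (cone_metric g v \<zeta>) c p = sqrt (1 - \<zeta>) * metric_density (cone_metric g v 0) c p"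
proof -
  define G where "G = gram (cone_metric g v 0) c p"
  define \<theta> where "\<theta> = G *v v c p"
  have ip: "is_inner_product (cone_metric g v 0 c p)" by (rule cone0.is_inner_product_metric[OF c])
  have \<theta>: "cone_metric g v 0 c p (v c p) a = \<theta> \<bullet> a" for a
    using is_inner_product_D(3)[OF ip, of "v c p" a] cone0.metric_eq_gram[OF c, of a "v c p"]
    by (simp add: \<theta>_def G_def inner_commute)
  have "gram (cone_metric g v \<zeta>) c p = G ** (mat 1 + (\<chi> i j. (- \<zeta> *\<^sub>R v c p) $ i * \<theta> $ j))"
  proof -
    have "(G ** (\<chi> i j. (- \<zeta> *\<^sub>R v c p) $ i * \<theta> $ j)) $ i $ j = - \<zeta> * (\<theta> $ i * \<theta> $ j)" for i j
    proof -
      have "\<theta> $ i = (\<Sum>k\<in>UNIV. G $ i $ k * v c p $ k)" by (simp add: \<theta>_def matrix_vector_mult_def)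
      then show ?thesis
        by (simp add: matrix_matrix_mult_def sum_distrib_left sum_distrib_right sum_negf mult_ac)
    qed
    moreover have "gram (cone_metric g v \<zeta>) c p $ i $ j = G $ i $ j - \<zeta> * (\<theta> $ i * \<theta> $ j)" for i j
      unfolding gram_def G_def vec_lambda_beta cone_metric_eq_cone0[OF c, of \<zeta>] \<theta> by (simp add: inner_axis)
    ultimately show ?thesis
      by (simp add: vec_eq_iff matrix_add_ldistrib)
  qed
  moreover have "v c p \<bullet> \<theta> = 1"
    using cone_metric_v_v[OF c] unfolding \<theta> by (simp add: inner_commute)
  ultimately have "det (gram (cone_metric g v \<zeta>) c p) = (1 - \<zeta>) * det G"
    by (simp only: det_mul det_mat_1_plus_rank_one inner_scaleR_left) simp
  then show ?thesis unfolding metric_density_def G_def by (simp add: real_sqrt_mult)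
qed

text \<open>
  The field dual to \<open>w\<close> with respect to \<open>h\<^sub>0\<close>, split into its component along \<open>v\<close> and the one that is
  \<open>h\<^sub>0\<close>-orthogonal to \<open>v\<close>.
\<close>

definition along_v :: "('a, 'm) covec_field \<Rightarrow> ('a, 'm) vec_field" where
  "along_v w c p = w c p (v c p) *\<^sub>R v c p"

definition across_v :: "('a, 'm) covec_field \<Rightarrow> ('a, 'm) vec_field" where
  "across_v w c p = sharp (cone_metric g v 0) w c p - along_v w c p"

lemma vector_field_along_v:
  assumes w: "one_form 1 A w"
  shows "vector_field 1 A (along_v w)"
proof -
  have "along_v w d p = jacobian c d p (along_v w c p)"
    if c: "c \<in> A" "p \<in> chart_dom c" and d: "d \<in> A" "p \<in> chart_dom d" for c d p
    unfolding along_v_def v_change_chart[OF c(1) d(1) c(2) d(2)]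
      one_form_change_chart[OF w c(1) d(1) c(2) d(2), symmetric]
      linear_cmul[OF linear_jacobian[OF c(1) d(1) c(2) d(2)]] ..
  moreover have "Ck_on 1 (along_v w c \<circ> chart_inv c) (chart_image c)" if c: "c \<in> A" for c
    unfolding along_v_def o_def
    by (rule Ck_on_scaleR[OF open_chart_image[OF c] Ck_on_linear_apply[OF open_chart_image[OF c]
            C1_one_form[OF w c] linear_one_form[OF w c chart_inv_in_dom[OF c]]]])
      (assumption | rule vector_field_C1[OF vector_field_v c])+
  ultimately show ?thesis unfolding vector_field_def by blast
qed

lemma vector_field_across_v:
  assumes w: "one_form 1 A w"
  shows "vector_field 1 A (across_v w)"
proof -
  have "across_v w d p = jacobian c d p (across_v w c p)"
    if c: "c \<in> A" "p \<in> chart_dom c" and d: "d \<in> A" "p \<in> chart_dom d" for c d p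
  proof -
    have "sharp (cone_metric g v 0) w d p = jacobian c d p (sharp (cone_metric g v 0) w c p)"
      "along_v w d p = jacobian c d p (along_v w c p)"
      using cone0.vector_field_sharp[OF w] vector_field_along_v[OF w] that unfolding vector_field_def by blast+
    then show ?thesis
      unfolding across_v_def by (simp add: linear_diff[OF linear_jacobian[OF c(1) d(1) c(2) d(2)]])
  qed
  moreover have "Ck_on 1 (across_v w c \<circ> chart_inv c) (chart_image c)" if c: "c \<in> A" for c
    unfolding across_v_def o_def
    by (rule Ck_on_diff[OF open_chart_image[OF c] vector_field_C1[OF cone0.vector_field_sharp[OF w] c]
          vector_field_C1[OF vector_field_along_v[OF w] c]])
  ultimately show ?thesis unfolding vector_field_def by blast
qed

text \<open>
  Along \<open>v\<close> the metric \<open>h\<^sub>\<zeta>\<close> is \<open>1 - \<zeta>\<close> times \<open>h\<^sub>0\<close>, so the dual component is divided by \<open>1 - \<zeta>\<close>; on the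
  orthogonal complement the two metrics agree.
\<close>

lemma sharp_cone_metric:
  assumes w: "one_form 1 A w" and c: "c \<in> A" "p \<in> chart_dom c" and \<zeta>: "0 \<le> \<zeta>" "\<zeta> < 1"
  shows "sharp (cone_metric g v \<zeta>) w c p = (1 / (1 - \<zeta>)) *\<^sub>R along_v w c p + across_v w c p"
proof -
  interpret h: riemannian M A "cone_metric g v \<zeta>" by (rule riemannian_cone_metric[OF \<zeta>])
  let ?X = "(1 / (1 - \<zeta>)) *\<^sub>R along_v w c p + across_v w c p" and ?h = "cone_metric g v 0 c p"
  have ip: "is_inner_product ?h" by (rule cone0.is_inner_product_metric[OF c])
  have wl: "linear (w c p)" by (rule linear_one_form[OF w c])
  note lin = linear_add[OF is_inner_product_D(1)[OF ip]] linear_diff[OF is_inner_product_D(1)[OF ip]]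
    linear_cmul[OF is_inner_product_D(1)[OF ip]]
  define k where "k = 1 / (1 - \<zeta>)"
  have k: "k * (1 - \<zeta>) = 1" using \<zeta>(2) by (simp add: k_def)
  have hX: "?h ?X a = k * (w c p (v c p) * ?h (v c p) a) + (w c p a - w c p (v c p) * ?h (v c p) a)" for a
    unfolding across_v_def along_v_def lin cone0.metric_sharp[where w = w, OF c wl] k_def by simp
  have "cone_metric g v \<zeta> c p ?X a = cone_metric g v \<zeta> c p (sharp (cone_metric g v \<zeta>) w c p) a" for a
  proof -
    have "cone_metric g v \<zeta> c p ?X a = ?h ?X a - \<zeta> * (?h ?X (v c p) * ?h (v c p) a)"
      unfolding cone_metric_eq_cone0[OF c, of \<zeta>] is_inner_product_D(3)[OF ip, of "v c p" ?X] ..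
    also have "\<dots> = w c p a + (k * (1 - \<zeta>) - 1) * (w c p (v c p) * ?h (v c p) a)"
      unfolding hX cone_metric_v_v[OF c] by (simp add: algebra_simps)
    also have "\<dots> = cone_metric g v \<zeta> c p (sharp (cone_metric g v \<zeta>) w c p) a"
      unfolding k h.metric_sharp[where w = w, OF c wl] by simp
    finally show ?thesis .
  qed
  then show ?thesis using h.metric_left_unique[OF c] by metis
qed

text \<open>
  The density of \<open>h\<^sub>\<zeta>\<close> is a constant multiple of that of \<open>h\<^sub>0\<close>, and the constant cancels in the
  divergence. The expansion is therefore exact, with a second term that is the same for all \<open>\<zeta>\<close>.
\<close>

lemma cone_codifferential_eq:
  assumes w: "one_form 1 A w" and p: "p \<in> M" and \<zeta>: "0 \<le> \<zeta>" "\<zeta> < 1"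
  shows "cone_codifferential M A g v \<zeta> w p =
    - (1 / (1 - \<zeta>)) * divergence A (volume_form (cone_metric g v 0)) (along_v w) p
    - divergence A (volume_form (cone_metric g v 0)) (across_v w) p"
proof -
  interpret h: riemannian M A "cone_metric g v \<zeta>" by (rule riemannian_cone_metric[OF \<zeta>])
  obtain c where c: "c \<in> A" "p \<in> chart_dom c" by (rule ex_chart[OF p])
  let ?x = "chart_map c p" and ?\<rho> = "\<lambda>x. metric_density (cone_metric g v 0) c (chart_inv c x)"
  let ?X = "sharp (cone_metric g v \<zeta>) w"
  define k where "k = sqrt (1 - \<zeta>)"
  have k: "k > 0" using \<zeta> by (simp add: k_def)
  note along = vector_field_along_v[OF w] and across = vector_field_across_v[OF w]
  have "coord_div (\<lambda>x. metric_density (cone_metric g v \<zeta>) c (chart_inv c x) *\<^sub>R ?X c (chart_inv c x)) ?x =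
    (k * (1 / (1 - \<zeta>))) * coord_div (\<lambda>x. ?\<rho> x *\<^sub>R along_v w c (chart_inv c x)) ?x +
    k * coord_div (\<lambda>x. ?\<rho> x *\<^sub>R across_v w c (chart_inv c x)) ?x"
  proof (rule coord_div_linear_combination[OF open_chart_image[OF c(1)]])
    show "?x \<in> chart_image c" using c by simp
    show "Ck_on 1 (\<lambda>x. ?\<rho> x *\<^sub>R along_v w c (chart_inv c x)) (chart_image c)"
      "Ck_on 1 (\<lambda>x. ?\<rho> x *\<^sub>R across_v w c (chart_inv c x)) (chart_image c)"
      by (intro cone0.C1_density_times_field c vector_field_C1[OF along] vector_field_C1[OF across])+
    fix y assume "y \<in> chart_image c"
    then have y: "chart_inv c y \<in> chart_dom c" using c by simp
    show "metric_density (cone_metric g v \<zeta>) c (chart_inv c y) *\<^sub>R ?X c (chart_inv c y) =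
      (k * (1 / (1 - \<zeta>))) *\<^sub>R (?\<rho> y *\<^sub>R along_v w c (chart_inv c y)) +
      k *\<^sub>R (?\<rho> y *\<^sub>R across_v w c (chart_inv c y))"
      unfolding metric_density_cone_metric[OF c(1) y \<zeta>(2)] sharp_cone_metric[OF w c(1) y \<zeta>] k_def
      by (simp add: algebra_simps)
  qed
  then have "chart_divergence (cone_metric g v \<zeta>) ?X c p =
    1 / (1 - \<zeta>) * chart_divergence (cone_metric g v 0) (along_v w) c p +
    chart_divergence (cone_metric g v 0) (across_v w) c p"
    using k cone0.metric_density_pos[OF c]
    unfolding chart_divergence_def metric_density_cone_metric[OF c \<zeta>(2)] k_def[symmetric]
    by (simp add: add_divide_distrib)
  then show ?thesis
    unfolding cone_codifferential_def h.codifferential_eq_divergence_sharp[OF w p]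
      h.divergence_eq_chart_divergence[OF h.vector_field_sharp[OF w] c]
      cone0.divergence_eq_chart_divergence[OF along c] cone0.divergence_eq_chart_divergence[OF across c]
    by simp
qed

end

theorem lemma3p2:
  fixes M :: "'a::t2_space set"
    and A :: "('a, 'm::finite) chart set"
    and v :: "('a, 'm) vec_field"
    and F :: "'a \<Rightarrow> real ^ 'n::finite"
    and ip :: "real ^ 'n \<Rightarrow> real ^ 'n \<Rightarrow> real"
    and w :: "('a, 'm) covec_field"
  defines "g \<equiv> induced_metric ip F"
  assumes "compact M"
    and "smooth_atlas M A"
    and "vector_field 1 A v"
    and "\<forall>c\<in>A. \<forall>p\<in>chart_dom c. v c p \<noteq> 0"
    and "Ck_embedding 2 M A F"
    and "is_inner_product ip"
    and "one_form 1 A w"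
  shows "\<exists>C. \<forall>\<^sub>F \<zeta> in at 1 within {0..<1}. \<forall>p\<in>M.
           \<bar>cone_codifferential M A g v \<zeta> w p - 1 / (1 - \<zeta>) * delta_bar A g v w p\<bar>
             \<le> C * (1 - \<zeta>) ^ 0"
proof -
  interpret compact_manifold M A
    using assms(2,3) by unfold_locales
  interpret riemannian_flow M A g v
    using C1_metric_induced_metric[OF assms(6,7)] assms(4,5) unfolding g_def by unfold_locales auto
  have "g c p (v c p) (v c p) \<ge> 0" for c p
    unfolding g_def induced_metric_def by (rule is_inner_product_D(5)[OF assms(7)])
  then have nu: "nu_bar g v = volume_form (cone_metric g v 0)"
    by (rule nu_bar_eq_volume_form)
  have along: "(\<lambda>c q. w c q (v c q) *\<^sub>R v c q) = along_v w"
    by (simp add: along_v_def fun_eq_iff)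
  let ?R = "divergence A (volume_form (cone_metric g v 0)) (across_v w)"
  have "compact (?R ` M)"
    by (intro compact_continuous_image compact_M cone0.continuous_on_divergence vector_field_across_v assms(8))
  then obtain C where "\<forall>y\<in>?R ` M. norm y \<le> C"
    using compact_imp_bounded bounded_iff by blast
  then have C: "\<bar>?R p\<bar> \<le> C" if "p \<in> M" for p using that by simp
  have "\<bar>cone_codifferential M A g v \<zeta> w p - 1 / (1 - \<zeta>) * delta_bar A g v w p\<bar> \<le> C * (1 - \<zeta>) ^ 0"
    if "\<zeta> \<in> {0..<1}" "p \<in> M" for \<zeta> p
    using C[OF that(2)] cone_codifferential_eq[OF assms(8) that(2), of \<zeta>] that(1)
    unfolding delta_bar_def nu along by simp
  then have "\<forall>\<^sub>F \<zeta> in at 1 within {0..<1}. \<forall>p\<in>M.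
      \<bar>cone_codifferential M A g v \<zeta> w p - 1 / (1 - \<zeta>) * delta_bar A g v w p\<bar> \<le> C * (1 - \<zeta>) ^ 0"
    unfolding eventually_at_filter by (intro always_eventually) blast
  then show ?thesis ..
qed

end
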